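(* Let $A$ be a rack and let $I=\{a_i\}_{i\in\pi_0(A)}\subseteq A$ be a pointing of $A$. There is a natural equivalence of categories between the category $\mathsf{CExt}(A)$ of central extensions above $A$ (in racks) and the category $\mathsf{Set}^{\pi_1(A)}$ of functors from the groupoid $\pi_1(A)$ to the category $\mathsf{Set}$ of sets. The latter category is then also equivalent (but not naturally) to $\mathsf{Set}^{\pi_1(A,I)}\cong\coprod_{i\in\pi_0(A)}\mathsf{Set}^{\mathrm{Loop}_{a_i}}$, where $\coprod_{i\in\pi_0(A)}\mathsf{Set}^{\mathrm{Loop}_{a_i}}$ denotes the category whose objects are families, indexed by $i\in\pi_0(A)$, of sets equipped with an action of the group $\mathrm{Loop}_{a_i}$, and whose morphisms are $\pi_0(A)$-indexed families of morphisms of group actions. The same theorem holds for $A$ a quandle, with central extensions in quandles, with $\pi_1^q(A)$ and $\pi_1^q(A,I)$ in place of $\pi_1(A)$ and $\pi_1(A,I)$, and with the groups $\mathrm{Loop}_{a_i}$ as defined for quandles.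
   Context: A rack is a set $X$ with two binary operations $\triangleleft,\triangleleft^{-1}$ such that $(x\triangleleft y)\triangleleft^{-1}y = x = (x\triangleleft^{-1}y)\triangleleft y$ and $(x\triangleleft y)\triangleleft z=(x\triangleleft z)\triangleleft(y\triangleleft z)$; a quandle is a rack with $x\triangleleft x=x$. An extension is a surjective morphism. $\pi_0(X)$ is the quotient of the set $X$ by the equivalence relation generated by the pairs $(x,x\triangleleft y)$, with quotient map $\eta_X$. An extension $t\colon X\to Y$ is trivial if the square $\eta_Yt=\pi_0(t)\eta_X$ is a pullback (sets being viewed as racks with $x\triangleleft y=x$); an extension $f\colon B\to A$ is central if its pullback along some extension $E\to A$ is trivial. Everything is taken in racks, respectively in quandles. $\mathsf{CExt}(A)$ has as objects the central extensions with codomain $A$ and as morphisms the commutative triangles over $A$. $\mathrm{Pth}(X)$ is the group with generators $\underline x$ ($x\in X$) and relations $\underline{x\triangleleft a}=\underline a^{-1}\underline x\,\underline a$; it acts on the right on $X$ by $x\cdot\underline y=x\triangleleft y$. $\mathrm{Pth}^\circ(X)$ is the kernel of the homomorphism $\mathrm{Pth}(X)\to\mathbb Z$ sending every $\underline x$ to $1$. For a group $G$ acting on the right on a set $X$, $\mathcal G_{(X,G)}$ is the groupoid with objects $X$, arrows $(a,g)\in X\times G$ from $a$ to $a\cdot g$, and composite of $(a,g)$ followed by $(a\cdot g,h)$ equal to $(a,gh)$. The fundamental groupoid is $\pi_1(A)=\mathcal G_{(A,\mathrm{Pth}(A))}$ for a rack $A$, and $\pi_1^q(A)=\mathcal G_{(A,\mathrm{Pth}^\circ(A))}$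 for a quandle $A$. A pointing of $A$ is a choice of representatives $I=\{a_i\}_{i\in\pi_0(A)}\subseteq A$ with $\eta_A(a_i)=i$ for each $i$. For $a\in A$, $\mathrm{Loop}_a=\{l\in\mathrm{Pth}(A)\mid a\cdot l=a\}$ in the rack case, and $\mathrm{Loop}_a=\{l\in\mathrm{Pth}^\circ(A)\mid a\cdot l=a\}$ in the quandle case. $\pi_1(A,I)$ (respectively $\pi_1^q(A,I)$) is the totally disconnected groupoid with set of objects $\pi_0(A)$, and with $\mathrm{Loop}_{a_i}$ as group of endomorphisms of $i$. $\mathsf{Set}^{\pi_1(A,I)}$ is the category of functors from $\pi_1(A,I)$ to $\mathsf{Set}$, and $\mathsf{Set}^{\mathrm{Loop}_{a_i}}$ is the category of sets with an action of $\mathrm{Loop}_{a_i}$.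
   Formalization: Extensions being surjective, CExt(A) is shown equivalent to the functors from π_1(A) (resp. π_1^q(A)) to nonempty sets only; as stated it fails for every nonempty A. Sets, racks and quandles are subsets of an arbitrary infinite set. "Not naturally" is not formalized. *)

theory Defs
  imports "HOL-Algebra.Elementary_Groups"
begin

section \<open>Categories\<close>

record ('o, 'm) cat =
  Obj :: "'o set"
  Arr :: "'m set"
  Src :: "'m \<Rightarrow> 'o"
  Tgt :: "'m \<Rightarrow> 'o"
  Idn :: "'o \<Rightarrow> 'm"
  Cmp :: "'m \<Rightarrow> 'm \<Rightarrow> 'm"  \<comment> \<open>\<open>Cmp g f\<close> is \<open>f\<close> followed by \<open>g\<close>\<close>

locale category =
  fixes C :: "('o, 'm) cat"
  assumes Src_Obj: "f \<in> Arr C \<Longrightarrow> Src C f \<in> Obj C"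
    and Tgt_Obj: "f \<in> Arr C \<Longrightarrow> Tgt C f \<in> Obj C"
    and Idn_Arr: "x \<in> Obj C \<Longrightarrow> Idn C x \<in> Arr C"
    and Src_Idn: "x \<in> Obj C \<Longrightarrow> Src C (Idn C x) = x"
    and Tgt_Idn: "x \<in> Obj C \<Longrightarrow> Tgt C (Idn C x) = x"
    and Cmp_Arr: "\<lbrakk>f \<in> Arr C; g \<in> Arr C; Tgt C f = Src C g\<rbrakk> \<Longrightarrow> Cmp C g f \<in> Arr C"
    and Src_Cmp: "\<lbrakk>f \<in> Arr C; g \<in> Arr C; Tgt C f = Src C g\<rbrakk> \<Longrightarrow> Src C (Cmp C g f) = Src C f"
    and Tgt_Cmp: "\<lbrakk>f \<in> Arr C; g \<in> Arr C; Tgt C f = Src C g\<rbrakk> \<Longrightarrow> Tgt C (Cmp C g f) = Tgt C g"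
    and Cmp_Idn_right: "f \<in> Arr C \<Longrightarrow> Cmp C f (Idn C (Src C f)) = f"
    and Cmp_Idn_left: "f \<in> Arr C \<Longrightarrow> Cmp C (Idn C (Tgt C f)) f = f"
    and Cmp_assoc: "\<lbrakk>f \<in> Arr C; g \<in> Arr C; h \<in> Arr C; Tgt C f = Src C g; Tgt C g = Src C h\<rbrakk>
      \<Longrightarrow> Cmp C h (Cmp C g f) = Cmp C (Cmp C h g) f"

definition invertible_arrow :: "('o, 'm) cat \<Rightarrow> 'm \<Rightarrow> bool" where
  "invertible_arrow C f \<longleftrightarrow> f \<in> Arr C \<and>
    (\<exists>g \<in> Arr C. Src C g = Tgt C f \<and> Tgt C g = Src C f \<and>
      Cmp C g f = Idn C (Src C f) \<and> Cmp C f g = Idn C (Tgt C f))"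

definition isomorphic_objects :: "('o, 'm) cat \<Rightarrow> 'o \<Rightarrow> 'o \<Rightarrow> bool" where
  "isomorphic_objects C x y \<longleftrightarrow> (\<exists>f. invertible_arrow C f \<and> Src C f = x \<and> Tgt C f = y)"

text \<open>Functors, natural transformations and maps between carriers are taken extensional (undefined
  off their domain), so that equality in HOL is equality of the mathematical objects.\<close>

record ('o, 'm, 'p, 'n) ftr =
  fobj :: "'o \<Rightarrow> 'p"
  farr :: "'m \<Rightarrow> 'n"

definition functors :: "('o, 'm) cat \<Rightarrow> ('p, 'n) cat \<Rightarrow> ('o, 'm, 'p, 'n) ftr set" where
  "functors C D = {F.
    fobj F \<in> Obj C \<rightarrow>\<^sub>E Obj D \<and> farr F \<in> Arr C \<rightarrow>\<^sub>E Arr D \<and>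
    (\<forall>f \<in> Arr C. Src D (farr F f) = fobj F (Src C f) \<and> Tgt D (farr F f) = fobj F (Tgt C f)) \<and>
    (\<forall>x \<in> Obj C. farr F (Idn C x) = Idn D (fobj F x)) \<and>
    (\<forall>f \<in> Arr C. \<forall>g \<in> Arr C. Tgt C f = Src C g \<longrightarrow>
      farr F (Cmp C g f) = Cmp D (farr F g) (farr F f))}"

definition id_functor :: "('o, 'm) cat \<Rightarrow> ('o, 'm, 'o, 'm) ftr" where
  "id_functor C = \<lparr>fobj = (\<lambda>x \<in> Obj C. x), farr = (\<lambda>f \<in> Arr C. f)\<rparr>"

definition comp_functor ::
  "('o, 'm) cat \<Rightarrow> ('p, 'n, 'q, 'k) ftr \<Rightarrow> ('o, 'm, 'p, 'n) ftr \<Rightarrow> ('o, 'm, 'q, 'k) ftr" where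
  "comp_functor C G F =
    \<lparr>fobj = compose (Obj C) (fobj G) (fobj F), farr = compose (Arr C) (farr G) (farr F)\<rparr>"

text \<open>A natural transformation \<open>F \<Rightarrow> G\<close> with components \<open>\<alpha>\<close> is the triple \<open>(F, \<alpha>, G)\<close>.\<close>

type_synonym ('o, 'm, 'p, 'n) nattrans =
  "('o, 'm, 'p, 'n) ftr \<times> ('o \<Rightarrow> 'n) \<times> ('o, 'm, 'p, 'n) ftr"

definition functor_cat ::
  "('o, 'm) cat \<Rightarrow> ('p, 'n) cat \<Rightarrow> (('o, 'm, 'p, 'n) ftr, ('o, 'm, 'p, 'n) nattrans) cat" where
  "functor_cat C D = \<lparr>
    Obj = functors C D,
    Arr = {(F, \<alpha>, G). F \<in> functors C D \<and> G \<in> functors C D \<and> \<alpha> \<in> Obj C \<rightarrow>\<^sub>E Arr D \<and>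
      (\<forall>x \<in> Obj C. Src D (\<alpha> x) = fobj F x \<and> Tgt D (\<alpha> x) = fobj G x) \<and>
      (\<forall>f \<in> Arr C. Cmp D (\<alpha> (Tgt C f)) (farr F f) = Cmp D (farr G f) (\<alpha> (Src C f)))},
    Src = (\<lambda>(F, \<alpha>, G). F),
    Tgt = (\<lambda>(F, \<alpha>, G). G),
    Idn = (\<lambda>F. (F, \<lambda>x \<in> Obj C. Idn D (fobj F x), F)),
    Cmp = (\<lambda>(G', \<beta>, H) (F, \<alpha>, G). (F, \<lambda>x \<in> Obj C. Cmp D (\<beta> x) (\<alpha> x), H))\<rparr>"

definition whisker ::
  "('o, 'm) cat \<Rightarrow> ('p, 'n, 'q, 'k) nattrans \<Rightarrow> ('o, 'm, 'p, 'n) ftr \<Rightarrow> ('o, 'm, 'q, 'k) nattrans" where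
  "whisker C \<tau> H = (case \<tau> of (F, \<alpha>, G) \<Rightarrow>
    (comp_functor C F H, compose (Obj C) \<alpha> (fobj H), comp_functor C G H))"

definition category_equivalence ::
  "('o, 'm) cat \<Rightarrow> ('p, 'n) cat \<Rightarrow> ('o, 'm, 'p, 'n) ftr \<Rightarrow> bool" where
  "category_equivalence C D F \<longleftrightarrow> category C \<and> category D \<and> F \<in> functors C D \<and>
    (\<exists>G \<in> functors D C.
      isomorphic_objects (functor_cat C C) (comp_functor C G F) (id_functor C) \<and>
      isomorphic_objects (functor_cat D D) (comp_functor D F G) (id_functor D))"

definition equivalent_categories :: "('o, 'm) cat \<Rightarrow> ('p, 'n) cat \<Rightarrow> bool" where
  "equivalent_categories C D \<longleftrightarrow> (\<exists>F. category_equivalence C D F)"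

definition isomorphic_categories :: "('o, 'm) cat \<Rightarrow> ('p, 'n) cat \<Rightarrow> bool" where
  "isomorphic_categories C D \<longleftrightarrow> category C \<and> category D \<and>
    (\<exists>F \<in> functors C D. \<exists>G \<in> functors D C.
      comp_functor C G F = id_functor C \<and> comp_functor D F G = id_functor D)"

text \<open>The category of sets consists of the subsets of a type \<open>'u\<close>; it is \<open>set_cat UNIV\<close>. A map
  \<open>f : S \<rightarrow> T\<close> is the triple \<open>(S, f, T)\<close>. Smaller \<open>\<S>\<close>
  give its full subcategories. The one of nonempty sets is needed because a central extension is
  surjective, so that its fibres are nonempty: the functors to \<open>Set\<close> that correspond to central
  extensions are exactly those with nonempty values.\<close>

definition set_cat :: "'u set set \<Rightarrow> ('u set, 'u set \<times> ('u \<Rightarrow> 'u) \<times> 'u set) cat" where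
  "set_cat \<S> = \<lparr>
    Obj = \<S>,
    Arr = {(S, f, T). S \<in> \<S> \<and> T \<in> \<S> \<and> f \<in> S \<rightarrow>\<^sub>E T},
    Src = (\<lambda>(S, f, T). S),
    Tgt = (\<lambda>(S, f, T). T),
    Idn = (\<lambda>S. (S, \<lambda>x \<in> S. x, S)),
    Cmp = (\<lambda>(T', g, U) (S, f, T). (S, compose S g f, U))\<rparr>"

abbreviation nonempty_sets :: "'u set set" where
  "nonempty_sets \<equiv> {S. S \<noteq> {}}"

definition product_cat ::
  "'i set \<Rightarrow> ('i \<Rightarrow> ('o, 'm) cat) \<Rightarrow> ('i \<Rightarrow> 'o, 'i \<Rightarrow> 'm) cat" where
  "product_cat J C = \<lparr>
    Obj = (\<Pi>\<^sub>E i\<in>J. Obj (C i)),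
    Arr = (\<Pi>\<^sub>E i\<in>J. Arr (C i)),
    Src = (\<lambda>f. \<lambda>i \<in> J. Src (C i) (f i)),
    Tgt = (\<lambda>f. \<lambda>i \<in> J. Tgt (C i) (f i)),
    Idn = (\<lambda>x. \<lambda>i \<in> J. Idn (C i) (x i)),
    Cmp = (\<lambda>g f. \<lambda>i \<in> J. Cmp (C i) (g i) (f i))\<rparr>"


section \<open>Group actions\<close>

definition right_action :: "('g, 'b) monoid_scheme \<Rightarrow> 'x set \<Rightarrow> ('x \<Rightarrow> 'g \<Rightarrow> 'x) \<Rightarrow> bool" where
  "right_action G X act \<longleftrightarrow>
    (\<forall>x \<in> X. \<forall>g \<in> carrier G. act x g \<in> X) \<and>
    (\<forall>x \<in> X. act x \<one>\<^bsub>G\<^esub> = x) \<and>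
    (\<forall>x \<in> X. \<forall>g \<in> carrier G. \<forall>h \<in> carrier G. act x (g \<otimes>\<^bsub>G\<^esub> h) = act (act x g) h)"

definition action_groupoid ::
  "'x set \<Rightarrow> ('g, 'b) monoid_scheme \<Rightarrow> ('x \<Rightarrow> 'g \<Rightarrow> 'x) \<Rightarrow> ('x, 'x \<times> 'g) cat" where
  "action_groupoid X G act = \<lparr>
    Obj = X,
    Arr = X \<times> carrier G,
    Src = (\<lambda>(a, g). a),
    Tgt = (\<lambda>(a, g). act a g),
    Idn = (\<lambda>a. (a, \<one>\<^bsub>G\<^esub>)),
    Cmp = (\<lambda>(b, h) (a, g). (a, g \<otimes>\<^bsub>G\<^esub> h))\<rparr>"

text \<open>Sets with a group action: the actions are on the right, because composition of loops
  \<open>l\<close>, \<open>m\<close> (first \<open>l\<close>) is the product \<open>l m\<close>. The action map is uncurried, so that it can be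
  extensional.\<close>

definition gset_cat ::
  "'u set set \<Rightarrow> ('g, 'b) monoid_scheme \<Rightarrow>
   ('u set \<times> ('u \<times> 'g \<Rightarrow> 'u), ('u set \<times> ('u \<times> 'g \<Rightarrow> 'u)) \<times> ('u \<Rightarrow> 'u) \<times> ('u set \<times> ('u \<times> 'g \<Rightarrow> 'u))) cat" where
  "gset_cat \<S> G = (let Ob = {(S, act). S \<in> \<S> \<and> act \<in> extensional (S \<times> carrier G) \<and>
      right_action G S (\<lambda>x g. act (x, g))} in \<lparr>
    Obj = Ob,
    Arr = {((S, act), f, (T, act')). (S, act) \<in> Ob \<and> (T, act') \<in> Ob \<and> f \<in> S \<rightarrow>\<^sub>E T \<and>
      (\<forall>x \<in> S. \<forall>g \<in> carrier G. f (act (x, g)) = act' (f x, g))},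
    Src = (\<lambda>(X, f, Y). X),
    Tgt = (\<lambda>(X, f, Y). Y),
    Idn = (\<lambda>X. (X, \<lambda>x \<in> fst X. x, X)),
    Cmp = (\<lambda>(Y', g, Z) (X, f, Y). (X, compose (fst X) g f, Z))\<rparr>)"


section \<open>Racks and quandles\<close>

record 'a rack = "'a partial_object" +
  rop :: "'a \<Rightarrow> 'a \<Rightarrow> 'a"  (infixl \<open>\<triangleleft>\<index>\<close> 70)
  rinv :: "'a \<Rightarrow> 'a \<Rightarrow> 'a"  (infixl \<open>\<triangleleft>\<inverse>\<index>\<close> 70)

locale rack =
  fixes X :: "'a rack" (structure)
  assumes rop_closed: "\<lbrakk>x \<in> carrier X; y \<in> carrier X\<rbrakk> \<Longrightarrow> x \<triangleleft> y \<in> carrier X"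
    and rinv_closed: "\<lbrakk>x \<in> carrier X; y \<in> carrier X\<rbrakk> \<Longrightarrow> x \<triangleleft>\<inverse> y \<in> carrier X"
    and rop_rinv: "\<lbrakk>x \<in> carrier X; y \<in> carrier X\<rbrakk> \<Longrightarrow> (x \<triangleleft> y) \<triangleleft>\<inverse> y = x"
    and rinv_rop: "\<lbrakk>x \<in> carrier X; y \<in> carrier X\<rbrakk> \<Longrightarrow> (x \<triangleleft>\<inverse> y) \<triangleleft> y = x"
    and rop_distrib: "\<lbrakk>x \<in> carrier X; y \<in> carrier X; z \<in> carrier X\<rbrakk>
      \<Longrightarrow> (x \<triangleleft> y) \<triangleleft> z = (x \<triangleleft> z) \<triangleleft> (y \<triangleleft> z)"

locale quandle = rack +
  assumes rop_idem: "x \<in> carrier X \<Longrightarrow> x \<triangleleft> x = x"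

definition rack_hom :: "'a rack \<Rightarrow> 'b rack \<Rightarrow> ('a \<Rightarrow> 'b) set" where
  "rack_hom X Y = {f \<in> carrier X \<rightarrow>\<^sub>E carrier Y. \<forall>x \<in> carrier X. \<forall>y \<in> carrier X.
    f (x \<triangleleft>\<^bsub>X\<^esub> y) = f x \<triangleleft>\<^bsub>Y\<^esub> f y \<and> f (x \<triangleleft>\<inverse>\<^bsub>X\<^esub> y) = f x \<triangleleft>\<inverse>\<^bsub>Y\<^esub> f y}"

definition rack_iso :: "'a rack \<Rightarrow> 'b rack \<Rightarrow> ('a \<Rightarrow> 'b) set" where
  "rack_iso X Y = {f \<in> rack_hom X Y. bij_betw f (carrier X) (carrier Y)}"

definition extension :: "'a rack \<Rightarrow> 'b rack \<Rightarrow> ('a \<Rightarrow> 'b) \<Rightarrow> bool" where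
  "extension X Y f \<longleftrightarrow> f \<in> rack_hom X Y \<and> f ` carrier X = carrier Y"

definition pullback_rack ::
  "'a rack \<Rightarrow> ('a \<Rightarrow> 'c) \<Rightarrow> 'b rack \<Rightarrow> ('b \<Rightarrow> 'c) \<Rightarrow> ('a \<times> 'b) rack" where
  "pullback_rack X h Y k = \<lparr>
    carrier = {(x, y). x \<in> carrier X \<and> y \<in> carrier Y \<and> h x = k y},
    rop = (\<lambda>(x, y) (x', y'). (x \<triangleleft>\<^bsub>X\<^esub> x', y \<triangleleft>\<^bsub>Y\<^esub> y')),
    rinv = (\<lambda>(x, y) (x', y'). (x \<triangleleft>\<inverse>\<^bsub>X\<^esub> x', y \<triangleleft>\<inverse>\<^bsub>Y\<^esub> y'))\<rparr>"

text \<open>The square with sides \<open>f : P \<rightarrow> X\<close>, \<open>g : P \<rightarrow> Y\<close>, \<open>h : X \<rightarrow> Z\<close>, \<open>k : Y \<rightarrow> Z\<close> commutes and is a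
  pullback.\<close>

definition is_pullback ::
  "'p rack \<Rightarrow> ('p \<Rightarrow> 'a) \<Rightarrow> ('p \<Rightarrow> 'b) \<Rightarrow> 'a rack \<Rightarrow> ('a \<Rightarrow> 'c) \<Rightarrow> 'b rack \<Rightarrow> ('b \<Rightarrow> 'c) \<Rightarrow> bool" where
  "is_pullback P f g X h Y k \<longleftrightarrow> (\<lambda>p \<in> carrier P. (f p, g p)) \<in> rack_iso P (pullback_rack X h Y k)"


section \<open>Connected components, trivial and central extensions\<close>

definition pi0_rel :: "'a rack \<Rightarrow> ('a \<times> 'a) set" where
  "pi0_rel X = (let R = {(x, x \<triangleleft>\<^bsub>X\<^esub> y) | x y. x \<in> carrier X \<and> y \<in> carrier X} in
    (R \<union> R\<inverse>)\<^sup>* \<inter> carrier X \<times> carrier X)"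

definition pi0 :: "'a rack \<Rightarrow> 'a set set" where
  "pi0 X = carrier X // pi0_rel X"

definition eta :: "'a rack \<Rightarrow> 'a \<Rightarrow> 'a set" where
  "eta X = (\<lambda>x \<in> carrier X. pi0_rel X `` {x})"

definition pi0_map :: "'a rack \<Rightarrow> 'b rack \<Rightarrow> ('a \<Rightarrow> 'b) \<Rightarrow> 'a set \<Rightarrow> 'b set" where
  "pi0_map X Y t = (\<lambda>c \<in> pi0 X. \<Union>x\<in>c. eta Y (t x))"

definition set_rack :: "'s set \<Rightarrow> 's rack" where
  "set_rack S = \<lparr>carrier = S, rop = (\<lambda>x y. x), rinv = (\<lambda>x y. x)\<rparr>"

definition trivial_extension :: "'a rack \<Rightarrow> 'b rack \<Rightarrow> ('a \<Rightarrow> 'b) \<Rightarrow> bool" where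
  "trivial_extension X Y t \<longleftrightarrow> extension X Y t \<and>
    is_pullback X t (eta X) Y (eta Y) (set_rack (pi0 X)) (pi0_map X Y t)"

text \<open>In the following, \<open>K\<close> is one of the predicates \<^const>\<open>rack\<close> and \<^const>\<open>quandle\<close> and selects the
  category in which one works; its objects are those racks, respectively quandles, whose carrier is
  a subset of the type \<open>'u\<close>.\<close>

definition central_extension ::
  "('u rack \<Rightarrow> bool) \<Rightarrow> 'u rack \<Rightarrow> 'u rack \<Rightarrow> ('u \<Rightarrow> 'u) \<Rightarrow> bool" where
  "central_extension K B A f \<longleftrightarrow> K B \<and> K A \<and> extension B A f \<and>
    (\<exists>E e. K E \<and> extension E A e \<and>
      (let P = pullback_rack E e B f in trivial_extension P E (restrict fst (carrier P))))"

type_synonym 'u over = "'u rack \<times> ('u \<Rightarrow> 'u)"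

definition CExt :: "('u rack \<Rightarrow> bool) \<Rightarrow> 'u rack \<Rightarrow> ('u over, 'u over \<times> ('u \<Rightarrow> 'u) \<times> 'u over) cat" where
  "CExt K A = \<lparr>
    Obj = {(B, f). central_extension K B A f},
    Arr = {((B, f), k, (C, g)). central_extension K B A f \<and> central_extension K C A g \<and>
      k \<in> rack_hom B C \<and> (\<forall>b \<in> carrier B. g (k b) = f b)},
    Src = (\<lambda>(p, k, q). p),
    Tgt = (\<lambda>(p, k, q). q),
    Idn = (\<lambda>p. (p, \<lambda>b \<in> carrier (fst p). b, p)),
    Cmp = (\<lambda>(q', l, r) (p, k, q). (p, compose (carrier (fst p)) l k, r))\<rparr>"


section \<open>The group of paths\<close>

text \<open>The presented group is the set of words in the letters \<open>(x, True)\<close>, standing for the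
  generator of \<open>x\<close>, and \<open>(x, False)\<close>, standing for its inverse, modulo the congruence generated by
  free cancellation and the defining relations.\<close>

type_synonym 'a word = "('a \<times> bool) list"

definition words :: "'a rack \<Rightarrow> 'a word set" where
  "words X = lists (carrier X \<times> UNIV)"

inductive_set path_rel :: "'a rack \<Rightarrow> ('a word \<times> 'a word) set" for X :: "'a rack" where
  refl: "w \<in> words X \<Longrightarrow> (w, w) \<in> path_rel X"
| sym: "(u, v) \<in> path_rel X \<Longrightarrow> (v, u) \<in> path_rel X"
| trans: "\<lbrakk>(u, v) \<in> path_rel X; (v, w) \<in> path_rel X\<rbrakk> \<Longrightarrow> (u, w) \<in> path_rel X"
| cancel: "\<lbrakk>u \<in> words X; v \<in> words X; x \<in> carrier X\<rbrakk>
    \<Longrightarrow> (u @ [(x, b), (x, \<not> b)] @ v, u @ v) \<in> path_rel X"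
| conj: "\<lbrakk>u \<in> words X; v \<in> words X; x \<in> carrier X; a \<in> carrier X\<rbrakk>
    \<Longrightarrow> (u @ [(x \<triangleleft>\<^bsub>X\<^esub> a, True)] @ v, u @ [(a, False), (x, True), (a, True)] @ v) \<in> path_rel X"

type_synonym 'a path_group = "'a word set monoid"

definition Pth :: "'a rack \<Rightarrow> 'a path_group" where
  "Pth X = \<lparr>
    carrier = words X // path_rel X,
    mult = (\<lambda>g h. \<Union>u\<in>g. \<Union>v\<in>h. path_rel X `` {u @ v}),
    one = path_rel X `` {[]}\<rparr>"

definition Pth_map :: "'b rack \<Rightarrow> ('a \<Rightarrow> 'b) \<Rightarrow> 'a word set \<Rightarrow> 'b word set" where
  "Pth_map Y f g = (\<Union>w\<in>g. path_rel Y `` {map (map_prod f id) w})"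

definition Pth_degree :: "'a word set \<Rightarrow> int" where
  "Pth_degree g = the_elem ((\<lambda>w. \<Sum>(x, b)\<leftarrow>w. if b then 1 else - 1) ` g)"

definition Pth0 :: "'a rack \<Rightarrow> 'a path_group" where
  "Pth0 X = (Pth X)\<lparr>carrier := kernel (Pth X) integer_group Pth_degree\<rparr>"

definition word_act :: "'a rack \<Rightarrow> 'a \<Rightarrow> 'a word \<Rightarrow> 'a" where
  "word_act X = foldl (\<lambda>x (y, b). if b then x \<triangleleft>\<^bsub>X\<^esub> y else x \<triangleleft>\<inverse>\<^bsub>X\<^esub> y)"

definition path_act :: "'a rack \<Rightarrow> 'a \<Rightarrow> 'a word set \<Rightarrow> 'a" where
  "path_act X x g = the_elem (word_act X x ` g)"


section \<open>Fundamental groupoids\<close>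

text \<open>Here \<open>P\<close> is \<^const>\<open>Pth\<close> for racks and \<^const>\<open>Pth0\<close> for quandles.\<close>

definition fund_gpd :: "('a rack \<Rightarrow> 'a path_group) \<Rightarrow> 'a rack \<Rightarrow> ('a, 'a \<times> 'a word set) cat" where
  "fund_gpd P A = action_groupoid (carrier A) (P A) (path_act A)"

definition fund_gpd_map ::
  "('a rack \<Rightarrow> 'a path_group) \<Rightarrow> 'a rack \<Rightarrow> 'a rack \<Rightarrow> ('a \<Rightarrow> 'a) \<Rightarrow>
   ('a, 'a \<times> 'a word set, 'a, 'a \<times> 'a word set) ftr" where
  "fund_gpd_map P A' A h = \<lparr>
    fobj = (\<lambda>a \<in> carrier A'. h a),
    farr = restrict (\<lambda>(a, g). (h a, Pth_map A h g)) (carrier A' \<times> carrier (P A'))\<rparr>"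

definition Loop :: "('a rack \<Rightarrow> 'a path_group) \<Rightarrow> 'a rack \<Rightarrow> 'a \<Rightarrow> 'a path_group" where
  "Loop P A a = (P A)\<lparr>carrier := {l \<in> carrier (P A). path_act A a l = a}\<rparr>"

definition pointing :: "'a rack \<Rightarrow> ('a set \<Rightarrow> 'a) \<Rightarrow> bool" where
  "pointing A a \<longleftrightarrow> (\<forall>i \<in> pi0 A. a i \<in> carrier A \<and> eta A (a i) = i)"

definition pointed_fund_gpd ::
  "('a rack \<Rightarrow> 'a path_group) \<Rightarrow> 'a rack \<Rightarrow> ('a set \<Rightarrow> 'a) \<Rightarrow> ('a set, 'a set \<times> 'a word set) cat" where
  "pointed_fund_gpd P A a = \<lparr>
    Obj = pi0 A,
    Arr = (SIGMA i : pi0 A. carrier (Loop P A (a i))),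
    Src = (\<lambda>(i, l). i),
    Tgt = (\<lambda>(i, l). i),
    Idn = (\<lambda>i. (i, \<one>\<^bsub>Loop P A (a i)\<^esub>)),
    Cmp = (\<lambda>(j, m) (i, l). (i, l \<otimes>\<^bsub>Loop P A (a i)\<^esub> m))\<rparr>"

abbreviation "pi1 \<equiv> fund_gpd Pth"
abbreviation "pi1q \<equiv> fund_gpd Pth0"
abbreviation "pi1_pointed \<equiv> pointed_fund_gpd Pth"
abbreviation "pi1q_pointed \<equiv> pointed_fund_gpd Pth0"


section \<open>Naturality in the base\<close>

definition base_change_square ::
  "'u rack \<Rightarrow> 'u over \<Rightarrow> 'u rack \<Rightarrow> 'u over \<Rightarrow> ('u \<Rightarrow> 'u) \<Rightarrow> ('u \<Rightarrow> 'u) \<Rightarrow> bool" where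
  "base_change_square A' p' A p h k \<longleftrightarrow>
    h \<in> rack_hom A' A \<and> k \<in> rack_hom (fst p') (fst p) \<and>
    (\<forall>b \<in> carrier (fst p'). snd p (k b) = h (snd p' b))"

type_synonym 'u set_functor =
  "('u, 'u \<times> 'u word set, 'u set, 'u set \<times> ('u \<Rightarrow> 'u) \<times> 'u set) ftr"
type_synonym 'u set_nattrans =
  "('u, 'u \<times> 'u word set, 'u set, 'u set \<times> ('u \<Rightarrow> 'u) \<times> 'u set) nattrans"
type_synonym 'u CExt_functor =
  "('u over, 'u over \<times> ('u \<Rightarrow> 'u) \<times> 'u over, 'u set_functor, 'u set_nattrans) ftr"

text \<open>Both \<open>A \<mapsto> CExt A\<close> (by pulling back) and \<open>A \<mapsto> Set\<^bsup>\<pi>\<^sub>1(A)\<^esup>\<close> (by precomposition) are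
  contravariant pseudofunctors of \<open>A\<close>, and naturality of functors \<open>\<Phi> A : CExt A \<rightarrow> Set\<^bsup>\<pi>\<^sub>1(A)\<^esup>\<close> means
  pseudonaturality. It is expressed without choosing pullbacks: the \<open>\<Phi> A\<close> extend to a functor over
  the category of racks (quandles) between the corresponding fibrations, i.e. a commutative square
  \<open>(h, k)\<close> from \<open>p' : B' \<rightarrow> A'\<close> to \<open>p : B \<rightarrow> A\<close> induces a natural transformation
  \<open>\<sigma> : \<Phi> A' p' \<Rightarrow> \<Phi> A p \<circ> \<pi>\<^sub>1(h)\<close>, functorially in the square, which is given by \<open>\<Phi> A\<close> if
  \<open>h\<close> is the identity of \<open>A\<close>, and is invertible if the square is a pullback.\<close>

definition natural_in_base ::
  "('u rack \<Rightarrow> bool) \<Rightarrow> ('u rack \<Rightarrow> 'u path_group) \<Rightarrow> 'u set set \<Rightarrow> ('u rack \<Rightarrow> 'u CExt_functor) \<Rightarrow>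
   bool" where
  "natural_in_base K P \<S> \<Phi> \<longleftrightarrow>
    (\<exists>\<sigma> :: 'u rack \<Rightarrow> 'u over \<Rightarrow> 'u rack \<Rightarrow> 'u over \<Rightarrow> ('u \<Rightarrow> 'u) \<Rightarrow> ('u \<Rightarrow> 'u) \<Rightarrow> 'u set_nattrans.
      (\<forall>A' A p' p h k. K A' \<longrightarrow> K A \<longrightarrow> p' \<in> Obj (CExt K A') \<longrightarrow> p \<in> Obj (CExt K A) \<longrightarrow>
        base_change_square A' p' A p h k \<longrightarrow>
          (let D = functor_cat (fund_gpd P A') (set_cat \<S>); s = \<sigma> A' p' A p h k in
            s \<in> Arr D \<and> Src D s = fobj (\<Phi> A') p' \<and>
            Tgt D s = comp_functor (fund_gpd P A') (fobj (\<Phi> A) p) (fund_gpd_map P A' A h) \<and>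
            (is_pullback (fst p') (snd p') k A' h (fst p) (snd p) \<longrightarrow> invertible_arrow D s))) \<and>
      (\<forall>A p k q. K A \<longrightarrow> (p, k, q) \<in> Arr (CExt K A) \<longrightarrow>
        \<sigma> A p A q (\<lambda>a \<in> carrier A. a) k = farr (\<Phi> A) (p, k, q)) \<and>
      (\<forall>A'' A' A p'' p' p h' k' h k. K A'' \<longrightarrow> K A' \<longrightarrow> K A \<longrightarrow>
        p'' \<in> Obj (CExt K A'') \<longrightarrow> p' \<in> Obj (CExt K A') \<longrightarrow> p \<in> Obj (CExt K A) \<longrightarrow>
        base_change_square A'' p'' A' p' h' k' \<longrightarrow> base_change_square A' p' A p h k \<longrightarrow>
          \<sigma> A'' p'' A p (compose (carrier A'') h h') (compose (carrier (fst p'')) k k') =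
          Cmp (functor_cat (fund_gpd P A'') (set_cat \<S>))
            (whisker (fund_gpd P A'') (\<sigma> A' p' A p h k) (fund_gpd_map P A'' A' h'))
            (\<sigma> A'' p'' A' p' h' k')))"

end

theory Submission
  imports Defs
begin

text \<open>
  A central extension is a covering: a surjection \<open>f : B \<rightarrow> A\<close> for which \<open>x \<triangleleft> y\<close> depends on \<open>y\<close> only
  through \<open>f y\<close>. For then the generator of \<^term>\<open>Pth A\<close> given by \<open>f y\<close> can act on \<open>B\<close> as \<open>\<triangleleft> y\<close>, so that
  the group of paths of \<open>A\<close> acts on \<open>B\<close>, compatibly with its action on \<open>A\<close>, and the fibres of \<open>f\<close> form a
  functor on the fundamental groupoid. Conversely, a functor \<open>F\<close> with nonempty values is turned into the
  set of pairs \<open>(a, s)\<close> with \<open>s\<close> in \<open>F a\<close>, where \<open>(a, s) \<triangleleft> (b, t)\<close> is \<open>a \<triangleleft> b\<close> together with \<open>s\<close> moved along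
  the generator of \<open>b\<close>. Maps of coverings are the same as families of maps between the fibres that
  commute with the action of paths. This gives the equivalence (\<open>Fib_equivalence\<close>).

  That central extensions are coverings (\<open>central_extension_iff\<close>) has two halves. A trivial extension is a
  covering, since \<open>x \<triangleleft> y\<close> and \<open>x \<triangleleft> y'\<close> lie in the component of \<open>x\<close>, and the property descends along
  surjective pullbacks. For the converse, consider the covering of the coproduct of all representable
  functors, in which only the trivial path of the groupoid fixes a point. The pullback of any covering along it
  is trivial: a path of the pullback moves both coordinates along the same path of \<open>A\<close>, so that if it
  fixes the first coordinate, it fixes the second one, too.

  For a quandle the groupoid only uses paths of degree zero, and nothing is lost: the loop \<open>x\<close> at \<open>x\<close>
  acts trivially on the fibre over \<open>x\<close>, so that a path \<open>g\<close> from \<open>x\<close> has the same effect as its product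
  with a power of \<open>x\<close>. The locale \<open>path_theory\<close> isolates what is needed of this replacement; the
  classification is proved in it once, and racks and quandles are its two instances.

  Naturality in the base holds because a square of coverings restricts to maps between fibres, and these
  are bijective if the square is a pullback (\<open>Fib_natural\<close>). The statements on base points hold because
  the base points meet every component, so that the inclusion of the pointed groupoid is an
  equivalence; precomposition with an equivalence is an equivalence of functor categories
  (\<open>precomp_equivalence\<close>); and a functor to sets on a totally disconnected groupoid is a family of group
  actions (\<open>functors_disjoint_groups_iso\<close>).

  All carriers are subsets of one infinite type, in which pairs and words are coded; this is where the
  infinity of the type enters.
\<close>

section \<open>Categories, functors and natural transformations\<close>

lemma functor_cat_simps [simp]:
  "Obj (functor_cat C D) = functors C D"
  "Src (functor_cat C D) (F, \<alpha>, G) = F"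
  "Tgt (functor_cat C D) (F, \<alpha>, G) = G"
  "Idn (functor_cat C D) F = (F, \<lambda>x \<in> Obj C. Idn D (fobj F x), F)"
  "Cmp (functor_cat C D) (G', \<beta>, H) (F, \<alpha>, G) = (F, \<lambda>x \<in> Obj C. Cmp D (\<beta> x) (\<alpha> x), H)"
  by (simp_all add: functor_cat_def)

lemma functor_cat_Arr_iff:
  "(F, \<alpha>, G) \<in> Arr (functor_cat C D) \<longleftrightarrow>
    F \<in> functors C D \<and> G \<in> functors C D \<and> \<alpha> \<in> Obj C \<rightarrow>\<^sub>E Arr D \<and>
    (\<forall>x \<in> Obj C. Src D (\<alpha> x) = fobj F x \<and> Tgt D (\<alpha> x) = fobj G x) \<and>
    (\<forall>f \<in> Arr C. Cmp D (\<alpha> (Tgt C f)) (farr F f) = Cmp D (farr G f) (\<alpha> (Src C f)))"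
  by (simp add: functor_cat_def)

lemma functor_cat_Src_Tgt: "Src (functor_cat C D) \<tau> = fst \<tau>" "Tgt (functor_cat C D) \<tau> = snd (snd \<tau>)"
  by (simp_all add: functor_cat_def case_prod_unfold)

lemma functor_fobj: "F \<in> functors C D \<Longrightarrow> x \<in> Obj C \<Longrightarrow> fobj F x \<in> Obj D"
  and functor_farr: "F \<in> functors C D \<Longrightarrow> f \<in> Arr C \<Longrightarrow> farr F f \<in> Arr D"
  and functor_Src: "F \<in> functors C D \<Longrightarrow> f \<in> Arr C \<Longrightarrow> Src D (farr F f) = fobj F (Src C f)"
  and functor_Tgt: "F \<in> functors C D \<Longrightarrow> f \<in> Arr C \<Longrightarrow> Tgt D (farr F f) = fobj F (Tgt C f)"
  and functor_Idn: "F \<in> functors C D \<Longrightarrow> x \<in> Obj C \<Longrightarrow> farr F (Idn C x) = Idn D (fobj F x)"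
  and functor_Cmp: "F \<in> functors C D \<Longrightarrow> f \<in> Arr C \<Longrightarrow> g \<in> Arr C \<Longrightarrow> Tgt C f = Src C g \<Longrightarrow>
      farr F (Cmp C g f) = Cmp D (farr F g) (farr F f)"
  by (auto simp: functors_def)

lemma functor_ext: "F \<in> functors C D \<Longrightarrow> fobj F \<in> extensional (Obj C)"
    "F \<in> functors C D \<Longrightarrow> farr F \<in> extensional (Arr C)"
  by (auto simp: functors_def PiE_def)

lemma functor_eqI:
  assumes "F \<in> functors C D" "G \<in> functors C D"
    and "\<And>x. x \<in> Obj C \<Longrightarrow> fobj F x = fobj G x" "\<And>f. f \<in> Arr C \<Longrightarrow> farr F f = farr G f"
  shows "F = G"
proof -
  have "fobj F = fobj G"
    using assms(3) by (intro extensionalityI[OF functor_ext(1)[OF assms(1)] functor_ext(1)[OF assms(2)]])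
  moreover have "farr F = farr G"
    using assms(4) by (intro extensionalityI[OF functor_ext(2)[OF assms(1)] functor_ext(2)[OF assms(2)]])
  ultimately show ?thesis by (cases F; cases G) simp
qed

lemma nattrans_arrow: "(F, \<alpha>, G) \<in> Arr (functor_cat C D) \<Longrightarrow> x \<in> Obj C \<Longrightarrow> \<alpha> x \<in> Arr D"
  and nattrans_Src: "(F, \<alpha>, G) \<in> Arr (functor_cat C D) \<Longrightarrow> x \<in> Obj C \<Longrightarrow> Src D (\<alpha> x) = fobj F x"
  and nattrans_Tgt: "(F, \<alpha>, G) \<in> Arr (functor_cat C D) \<Longrightarrow> x \<in> Obj C \<Longrightarrow> Tgt D (\<alpha> x) = fobj G x"
  and nattrans_natural: "(F, \<alpha>, G) \<in> Arr (functor_cat C D) \<Longrightarrow> f \<in> Arr C \<Longrightarrow>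
      Cmp D (\<alpha> (Tgt C f)) (farr F f) = Cmp D (farr G f) (\<alpha> (Src C f))"
  and nattrans_functors: "(F, \<alpha>, G) \<in> Arr (functor_cat C D) \<Longrightarrow> F \<in> functors C D"
      "(F, \<alpha>, G) \<in> Arr (functor_cat C D) \<Longrightarrow> G \<in> functors C D"
  and nattrans_ext: "(F, \<alpha>, G) \<in> Arr (functor_cat C D) \<Longrightarrow> \<alpha> \<in> extensional (Obj C)"
  by (auto simp: functor_cat_Arr_iff PiE_def)

lemma id_functor_in: "category C \<Longrightarrow> id_functor C \<in> functors C C"
  by (auto simp: functors_def id_functor_def category.Src_Obj category.Tgt_Obj
      category.Idn_Arr category.Cmp_Arr)

lemma comp_functor_in:
  assumes C: "category C" and G: "G \<in> functors D E" and F: "F \<in> functors C D"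
  shows "comp_functor C G F \<in> functors C E"
proof -
  interpret C: category C by fact
  show ?thesis
    using functor_fobj[OF F] functor_farr[OF F] functor_Src[OF F] functor_Tgt[OF F]
      functor_Idn[OF F] functor_Cmp[OF F]
      functor_fobj[OF G] functor_farr[OF G] functor_Src[OF G] functor_Tgt[OF G]
      functor_Idn[OF G] functor_Cmp[OF G]
    by (auto simp: functors_def comp_functor_def compose_def C.Src_Obj C.Tgt_Obj C.Idn_Arr C.Cmp_Arr)
qed

lemma comp_functor_apply:
  "x \<in> Obj C \<Longrightarrow> fobj (comp_functor C G F) x = fobj G (fobj F x)"
  "f \<in> Arr C \<Longrightarrow> farr (comp_functor C G F) f = farr G (farr F f)"
  by (simp_all add: comp_functor_def compose_def)

lemma id_functor_apply:
  "x \<in> Obj C \<Longrightarrow> fobj (id_functor C) x = x" "f \<in> Arr C \<Longrightarrow> farr (id_functor C) f = f"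
  by (simp_all add: id_functor_def)

lemma category_functor_cat:
  assumes "category C" "category D"
  shows "category (functor_cat C D)"
proof -
  interpret C: category C by fact
  interpret D: category D by fact
  note nt = nattrans_arrow nattrans_Src nattrans_Tgt nattrans_natural nattrans_functors
  note ft = functor_fobj functor_farr functor_Src functor_Tgt functor_Idn
  have vertical: "(F, \<lambda>x \<in> Obj C. Cmp D (\<beta> x) (\<alpha> x), H) \<in> Arr (functor_cat C D)"
    if \<alpha>: "(F, \<alpha>, G) \<in> Arr (functor_cat C D)" and \<beta>: "(G, \<beta>, H) \<in> Arr (functor_cat C D)" for F \<alpha> G \<beta> H
  proof -
    have nat: "Cmp D (Cmp D (\<beta> (Tgt C f)) (\<alpha> (Tgt C f))) (farr F f) =
        Cmp D (farr H f) (Cmp D (\<beta> (Src C f)) (\<alpha> (Src C f)))" if f: "f \<in> Arr C" for f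
    proof -
      let ?s = "Src C f" and ?t = "Tgt C f"
      show ?thesis
        using nt[OF \<alpha>] nt[OF \<beta>] f C.Src_Obj[OF f] C.Tgt_Obj[OF f] D.Cmp_assoc[of "farr F f" "\<alpha> ?t" "\<beta> ?t"]
          D.Cmp_assoc[of "\<alpha> ?s" "farr G f" "\<beta> ?t"] D.Cmp_assoc[of "\<alpha> ?s" "\<beta> ?s" "farr H f"]
        by (simp add: ft)
    qed
    show ?thesis
      using nt[OF \<alpha>] nt[OF \<beta>] nat
      by (auto simp: functor_cat_Arr_iff D.Cmp_Arr D.Src_Cmp D.Tgt_Cmp C.Src_Obj C.Tgt_Obj)
  qed
  show ?thesis
  proof
    fix \<tau> assume "\<tau> \<in> Arr (functor_cat C D)"
    moreover obtain F \<alpha> G where \<tau>: "\<tau> = (F, \<alpha>, G)" by (cases \<tau>)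
    ultimately have \<alpha>: "(F, \<alpha>, G) \<in> Arr (functor_cat C D)" by simp
    show "Src (functor_cat C D) \<tau> \<in> Obj (functor_cat C D)"
      "Tgt (functor_cat C D) \<tau> \<in> Obj (functor_cat C D)"
      using nt[OF \<alpha>] by (simp_all add: \<tau>)
    show "Cmp (functor_cat C D) \<tau> (Idn (functor_cat C D) (Src (functor_cat C D) \<tau>)) = \<tau>"
      using nt[OF \<alpha>] nattrans_ext[OF \<alpha>] D.Cmp_Idn_right
      by (auto simp: \<tau> intro!: extensionalityI[of _ "Obj C"]) metis
    show "Cmp (functor_cat C D) (Idn (functor_cat C D) (Tgt (functor_cat C D) \<tau>)) \<tau> = \<tau>"
      using nt[OF \<alpha>] nattrans_ext[OF \<alpha>] D.Cmp_Idn_left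
      by (auto simp: \<tau> intro!: extensionalityI[of _ "Obj C"]) metis
  next
    fix F assume "F \<in> Obj (functor_cat C D)"
    then have F: "F \<in> functors C D" by simp
    show "Idn (functor_cat C D) F \<in> Arr (functor_cat C D)"
      "Src (functor_cat C D) (Idn (functor_cat C D) F) = F"
      "Tgt (functor_cat C D) (Idn (functor_cat C D) F) = F"
      using F ft[OF F] D.Cmp_Idn_left D.Cmp_Idn_right
      by (auto simp: functor_cat_Arr_iff D.Idn_Arr D.Src_Idn D.Tgt_Idn C.Src_Obj C.Tgt_Obj) metis
  next
    fix \<tau> \<tau>' assume "\<tau> \<in> Arr (functor_cat C D)" "\<tau>' \<in> Arr (functor_cat C D)"
      "Tgt (functor_cat C D) \<tau> = Src (functor_cat C D) \<tau>'"
    moreover obtain F \<alpha> G where \<tau>: "\<tau> = (F, \<alpha>, G)" by (cases \<tau>)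
    moreover obtain G' \<beta> H where \<tau>': "\<tau>' = (G', \<beta>, H)" by (cases \<tau>')
    ultimately have \<alpha>: "(F, \<alpha>, G) \<in> Arr (functor_cat C D)" and \<beta>: "(G, \<beta>, H) \<in> Arr (functor_cat C D)"
      and G': "G' = G" by simp_all
    show "Cmp (functor_cat C D) \<tau>' \<tau> \<in> Arr (functor_cat C D)"
      "Src (functor_cat C D) (Cmp (functor_cat C D) \<tau>' \<tau>) = Src (functor_cat C D) \<tau>"
      "Tgt (functor_cat C D) (Cmp (functor_cat C D) \<tau>' \<tau>) = Tgt (functor_cat C D) \<tau>'"
      using vertical[OF \<alpha> \<beta>] by (simp_all add: \<tau> \<tau>' G')
    fix \<tau>'' assume "\<tau>'' \<in> Arr (functor_cat C D)" "Tgt (functor_cat C D) \<tau>' = Src (functor_cat C D) \<tau>''"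
    moreover obtain H' \<gamma> I where \<tau>'': "\<tau>'' = (H', \<gamma>, I)" by (cases \<tau>'')
    ultimately have \<gamma>: "(H, \<gamma>, I) \<in> Arr (functor_cat C D)" and H': "H' = H" by (simp_all add: \<tau>')
    show "Cmp (functor_cat C D) \<tau>'' (Cmp (functor_cat C D) \<tau>' \<tau>) =
        Cmp (functor_cat C D) (Cmp (functor_cat C D) \<tau>'' \<tau>') \<tau>"
      using nt[OF \<alpha>] nt[OF \<beta>] nt[OF \<gamma>]
      by (auto simp: \<tau> \<tau>' \<tau>'' intro!: restrict_ext D.Cmp_assoc)
  qed
qed

text \<open>The pointwise inverses are natural: compose the naturality square with them on both sides.\<close>

lemma invertible_nattransI:
  assumes C: "category C" and D: "category D"
    and \<alpha>: "(F, \<alpha>, G) \<in> Arr (functor_cat C D)"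
    and inv: "\<And>x. x \<in> Obj C \<Longrightarrow> invertible_arrow D (\<alpha> x)"
  shows "invertible_arrow (functor_cat C D) (F, \<alpha>, G)"
proof -
  interpret C: category C by fact
  interpret D: category D by fact
  note nt = nattrans_arrow nattrans_Src nattrans_Tgt nattrans_natural nattrans_functors
  note F = nt(5)[OF \<alpha>] and G = nt(6)[OF \<alpha>]
  obtain \<beta> where \<beta>: "\<And>x. x \<in> Obj C \<Longrightarrow> \<beta> x \<in> Arr D \<and> Src D (\<beta> x) = fobj G x \<and> Tgt D (\<beta> x) = fobj F x \<and>
      Cmp D (\<beta> x) (\<alpha> x) = Idn D (fobj F x) \<and> Cmp D (\<alpha> x) (\<beta> x) = Idn D (fobj G x)"
    using inv nt(2,3)[OF \<alpha>] unfolding invertible_arrow_def by metis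
  have nat: "Cmp D (\<beta> (Tgt C f)) (farr G f) = Cmp D (farr F f) (\<beta> (Src C f))" if f: "f \<in> Arr C" for f
  proof -
    let ?s = "Src C f" and ?t = "Tgt C f"
    note m = functor_farr[OF F f] functor_farr[OF G f] functor_Src[OF F f] functor_Src[OF G f]
      functor_Tgt[OF F f] functor_Tgt[OF G f] \<beta>[OF C.Src_Obj[OF f]] \<beta>[OF C.Tgt_Obj[OF f]]
      nt(1-3)[OF \<alpha> C.Src_Obj[OF f]] nt(1-3)[OF \<alpha> C.Tgt_Obj[OF f]]
    have "Cmp D (Cmp D (Cmp D (\<beta> ?t) (farr G f)) (\<alpha> ?s)) (\<beta> ?s) = Cmp D (\<beta> ?t) (farr G f)"
      using m D.Cmp_assoc[of "\<beta> ?s" "\<alpha> ?s" "Cmp D (\<beta> ?t) (farr G f)"]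
        D.Cmp_Idn_right[of "Cmp D (\<beta> ?t) (farr G f)"] by (simp add: D.Cmp_Arr D.Src_Cmp)
    moreover have "Cmp D (Cmp D (\<beta> ?t) (farr G f)) (\<alpha> ?s) = farr F f"
      using m nt(4)[OF \<alpha> f] D.Cmp_assoc[of "\<alpha> ?s" "farr G f" "\<beta> ?t"]
        D.Cmp_assoc[of "farr F f" "\<alpha> ?t" "\<beta> ?t"] D.Cmp_Idn_left[of "farr F f"] by simp
    ultimately show ?thesis by simp
  qed
  have "(G, restrict \<beta> (Obj C), F) \<in> Arr (functor_cat C D)"
    using F G \<beta> nat by (auto simp: functor_cat_Arr_iff C.Src_Obj C.Tgt_Obj)
  then show ?thesis
    using \<alpha> \<beta> unfolding invertible_arrow_def
    by (intro conjI bexI[of _ "(G, restrict \<beta> (Obj C), F)"]) (auto intro: restrict_ext)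
qed

lemma isomorphic_functorsI:
  assumes "category C" "category D" "(F, \<alpha>, G) \<in> Arr (functor_cat C D)"
    and "\<And>x. x \<in> Obj C \<Longrightarrow> invertible_arrow D (\<alpha> x)"
  shows "isomorphic_objects (functor_cat C D) F G"
  using invertible_nattransI[OF assms]
  unfolding isomorphic_objects_def by (intro exI[of _ "(F, \<alpha>, G)"]) simp

text \<open>A quasi-inverse picks, for every object of the target, an object that is sent to an isomorphic
  one; full faithfulness then lifts the conjugates of arrows, and makes the lift functorial.\<close>

lemma category_equivalenceI:
  fixes C :: "('o, 'm) cat" and D :: "('p, 'n) cat"
  assumes C: "category C" and D: "category D" and F: "F \<in> functors C D"
    and faithful: "\<And>f g. \<lbrakk>f \<in> Arr C; g \<in> Arr C; Src C f = Src C g; Tgt C f = Tgt C g;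
        farr F f = farr F g\<rbrakk> \<Longrightarrow> f = g"
    and full: "\<And>x y h. \<lbrakk>x \<in> Obj C; y \<in> Obj C; h \<in> Arr D; Src D h = fobj F x; Tgt D h = fobj F y\<rbrakk>
        \<Longrightarrow> \<exists>f \<in> Arr C. Src C f = x \<and> Tgt C f = y \<and> farr F f = h"
    and es: "\<And>y. y \<in> Obj D \<Longrightarrow> \<exists>x \<in> Obj C. isomorphic_objects D (fobj F x) y"
  shows "category_equivalence C D F"
proof -
  interpret C: category C by fact
  interpret D: category D by fact
  note ff = functor_fobj[OF F] functor_farr[OF F] functor_Src[OF F] functor_Tgt[OF F]
  have "\<exists>x e e'. x \<in> Obj C \<and> e \<in> Arr D \<and> Src D e = fobj F x \<and> Tgt D e = y \<and>
      e' \<in> Arr D \<and> Src D e' = y \<and> Tgt D e' = fobj F x \<and>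
      Cmp D e' e = Idn D (fobj F x) \<and> Cmp D e e' = Idn D y" if "y \<in> Obj D" for y
    using es[OF that] unfolding isomorphic_objects_def invertible_arrow_def by metis
  then obtain R e e' where "\<forall>y \<in> Obj D. R y \<in> Obj C \<and> e y \<in> Arr D \<and> Src D (e y) = fobj F (R y) \<and>
      Tgt D (e y) = y \<and> e' y \<in> Arr D \<and> Src D (e' y) = y \<and> Tgt D (e' y) = fobj F (R y) \<and>
      Cmp D (e' y) (e y) = Idn D (fobj F (R y)) \<and> Cmp D (e y) (e' y) = Idn D y"
    by metis
  then have R: "\<And>y. y \<in> Obj D \<Longrightarrow> R y \<in> Obj C"
    and e: "\<And>y. y \<in> Obj D \<Longrightarrow> e y \<in> Arr D" "\<And>y. y \<in> Obj D \<Longrightarrow> Src D (e y) = fobj F (R y)"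
      "\<And>y. y \<in> Obj D \<Longrightarrow> Tgt D (e y) = y"
    and e': "\<And>y. y \<in> Obj D \<Longrightarrow> e' y \<in> Arr D" "\<And>y. y \<in> Obj D \<Longrightarrow> Src D (e' y) = y"
      "\<And>y. y \<in> Obj D \<Longrightarrow> Tgt D (e' y) = fobj F (R y)"
    and e'e: "\<And>y. y \<in> Obj D \<Longrightarrow> Cmp D (e' y) (e y) = Idn D (fobj F (R y))"
    and ee': "\<And>y. y \<in> Obj D \<Longrightarrow> Cmp D (e y) (e' y) = Idn D y"
    by blast+
  have unique: "f = g"
    if y: "y \<in> Obj D" and fg: "f \<in> Arr C" "g \<in> Arr C" "Src C f = Src C g" "Tgt C f = R y" "Tgt C g = R y"
      and eq: "Cmp D (e y) (farr F f) = Cmp D (e y) (farr F g)" for f g y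
  proof (rule faithful)
    have "Cmp D (e' y) (Cmp D (e y) (farr F k)) = farr F k" if "k \<in> Arr C" "Tgt C k = R y" for k
      using that y e e' ff e'e D.Cmp_Idn_left[of "farr F k"] by (simp add: D.Cmp_assoc)
    then show "farr F f = farr F g" using fg eq by metis
  qed (use fg in simp_all)
  \<comment> \<open>The lift of the conjugate of \<open>h\<close> by the isomorphisms \<open>e\<close>.\<close>
  have "\<exists>f \<in> Arr C. Src C f = R (Src D h) \<and> Tgt C f = R (Tgt D h) \<and>
      Cmp D (e (Tgt D h)) (farr F f) = Cmp D h (e (Src D h))" if h: "h \<in> Arr D" for h
  proof -
    let ?s = "Src D h" and ?t = "Tgt D h"
    let ?k = "Cmp D h (e ?s)"
    note o = D.Src_Obj[OF h] D.Tgt_Obj[OF h]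
    have k: "?k \<in> Arr D" "Src D ?k = fobj F (R ?s)" "Tgt D ?k = ?t"
      using h e o by (simp_all add: D.Cmp_Arr D.Src_Cmp D.Tgt_Cmp)
    have "Cmp D (e ?t) (Cmp D (e' ?t) ?k) = ?k"
      using k e[OF o(2)] e'[OF o(2)] ee'[OF o(2)] D.Cmp_Idn_left[OF k(1)] by (simp add: D.Cmp_assoc)
    moreover obtain f where "f \<in> Arr C" "Src C f = R ?s" "Tgt C f = R ?t" "farr F f = Cmp D (e' ?t) ?k"
      using full[of "R ?s" "R ?t" "Cmp D (e' ?t) ?k"] R o k e'[OF o(2)]
      by (auto simp: D.Cmp_Arr D.Src_Cmp D.Tgt_Cmp)
    ultimately show ?thesis by metis
  qed
  then obtain L where L: "\<And>h. h \<in> Arr D \<Longrightarrow> L h \<in> Arr C" "\<And>h. h \<in> Arr D \<Longrightarrow> Src C (L h) = R (Src D h)"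
    "\<And>h. h \<in> Arr D \<Longrightarrow> Tgt C (L h) = R (Tgt D h)"
    "\<And>h. h \<in> Arr D \<Longrightarrow> Cmp D (e (Tgt D h)) (farr F (L h)) = Cmp D h (e (Src D h))"
    by metis
  define G where "G = \<lparr>fobj = restrict R (Obj D), farr = restrict L (Arr D)\<rparr>"
  have Gf: "fobj G y = R y" if "y \<in> Obj D" for y using that by (simp add: G_def)
  have Ga: "farr G h = L h" if "h \<in> Arr D" for h using that by (simp add: G_def)
  have G: "G \<in> functors D C"
  proof -
    have "L (Idn D y) = Idn C (R y)" if y: "y \<in> Obj D" for y
    proof (rule unique[OF y])
      note i = D.Idn_Arr[OF y]
      show "L (Idn D y) \<in> Arr C" "Idn C (R y) \<in> Arr C" "Src C (L (Idn D y)) = Src C (Idn C (R y))"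
        "Tgt C (L (Idn D y)) = R y" "Tgt C (Idn C (R y)) = R y"
        using L[OF i] y R[OF y] by (simp_all add: C.Idn_Arr C.Src_Idn C.Tgt_Idn D.Src_Idn D.Tgt_Idn)
      show "Cmp D (e y) (farr F (L (Idn D y))) = Cmp D (e y) (farr F (Idn C (R y)))"
        using L(4)[OF i] y R[OF y] e[OF y] D.Cmp_Idn_left[of "e y"] D.Cmp_Idn_right[of "e y"]
        by (simp add: D.Src_Idn D.Tgt_Idn functor_Idn[OF F])
    qed
    moreover have "L (Cmp D k h) = Cmp C (L k) (L h)"
      if h: "h \<in> Arr D" and k: "k \<in> Arr D" and hk: "Tgt D h = Src D k" for h k
    proof (rule unique[OF D.Tgt_Obj[OF k]])
      note kh = D.Cmp_Arr[OF h k hk]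
      note o = D.Src_Obj[OF h] D.Src_Obj[OF k] D.Tgt_Obj[OF k]
      show "L (Cmp D k h) \<in> Arr C" "Cmp C (L k) (L h) \<in> Arr C"
        "Src C (L (Cmp D k h)) = Src C (Cmp C (L k) (L h))"
        "Tgt C (L (Cmp D k h)) = R (Tgt D k)" "Tgt C (Cmp C (L k) (L h)) = R (Tgt D k)"
        using L[OF kh] L[OF h] L[OF k] hk h k
        by (simp_all add: C.Cmp_Arr C.Src_Cmp C.Tgt_Cmp D.Src_Cmp D.Tgt_Cmp)
      note m = L(1-3)[OF h] L(1-3)[OF k] ff e[OF o(1)] e[OF o(2)] e[OF o(3)] h k hk
      have "Cmp D (e (Tgt D k)) (farr F (L (Cmp D k h))) = Cmp D k (Cmp D h (e (Src D h)))"
        using L(4)[OF kh] m by (simp add: D.Src_Cmp D.Tgt_Cmp D.Cmp_assoc)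
      also have "\<dots> = Cmp D (Cmp D k (e (Src D k))) (farr F (L h))"
        using L(4)[OF h] m by (simp add: D.Cmp_assoc[symmetric])
      also have "\<dots> = Cmp D (e (Tgt D k)) (Cmp D (farr F (L k)) (farr F (L h)))"
        using L(4)[OF k] m by (simp add: D.Cmp_assoc)
      finally show "Cmp D (e (Tgt D k)) (farr F (L (Cmp D k h))) =
          Cmp D (e (Tgt D k)) (farr F (Cmp C (L k) (L h)))"
        using m by (simp add: functor_Cmp[OF F])
    qed
    ultimately show ?thesis
      using R L(1-3) unfolding functors_def G_def
      by (simp add: D.Src_Obj D.Tgt_Obj D.Idn_Arr D.Cmp_Arr restrict_PiE_iff)
  qed
  have "\<forall>x \<in> Obj C. \<exists>v. v \<in> Arr C \<and> Src C v = R (fobj F x) \<and> Tgt C v = x \<and> farr F v = e (fobj F x)"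
    "\<forall>x \<in> Obj C. \<exists>v. v \<in> Arr C \<and> Src C v = x \<and> Tgt C v = R (fobj F x) \<and> farr F v = e' (fobj F x)"
    using full[OF R _ e(1,2)] full[OF _ R e'(1,2)] e(3) e'(3) ff(1) by (simp_all add: Bex_def)
  from this[THEN bchoice] obtain u u'
    where "\<forall>x \<in> Obj C. u x \<in> Arr C \<and> Src C (u x) = R (fobj F x) \<and> Tgt C (u x) = x \<and> farr F (u x) = e (fobj F x)"
    "\<forall>x \<in> Obj C. u' x \<in> Arr C \<and> Src C (u' x) = x \<and> Tgt C (u' x) = R (fobj F x) \<and> farr F (u' x) = e' (fobj F x)"
    by blast
  then have u: "u x \<in> Arr C" "Src C (u x) = R (fobj F x)" "Tgt C (u x) = x" "farr F (u x) = e (fobj F x)"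
    and u': "u' x \<in> Arr C" "Src C (u' x) = x" "Tgt C (u' x) = R (fobj F x)" "farr F (u' x) = e' (fobj F x)"
    if "x \<in> Obj C" for x
    using that by blast+
  have "isomorphic_objects (functor_cat D D) (comp_functor D F G) (id_functor D)"
  proof (rule isomorphic_functorsI[OF D D])
    show "(comp_functor D F G, restrict e (Obj D), id_functor D) \<in> Arr (functor_cat D D)"
      using e L(4) Ga comp_functor_in[OF D F G] id_functor_in[OF D]
      by (auto simp: functor_cat_Arr_iff comp_functor_apply id_functor_apply Gf D.Src_Obj D.Tgt_Obj)
    show "invertible_arrow D (restrict e (Obj D) x)" if "x \<in> Obj D" for x
      unfolding invertible_arrow_def using that e e' e'e ee'
      by (auto intro!: bexI[of _ "e' x"])
  qed
  moreover have "isomorphic_objects (functor_cat C C) (comp_functor C G F) (id_functor C)"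
  proof (rule isomorphic_functorsI[OF C C])
    have nat: "Cmp C (u (Tgt C f)) (farr G (farr F f)) = Cmp C f (u (Src C f))"
      if f: "f \<in> Arr C" for f
    proof (rule faithful)
      note o = C.Src_Obj[OF f] C.Tgt_Obj[OF f]
      have Ff: "farr F f \<in> Arr D" using f ff by simp
      show "Cmp C (u (Tgt C f)) (farr G (farr F f)) \<in> Arr C" "Cmp C f (u (Src C f)) \<in> Arr C"
        "Src C (Cmp C (u (Tgt C f)) (farr G (farr F f))) = Src C (Cmp C f (u (Src C f)))"
        "Tgt C (Cmp C (u (Tgt C f)) (farr G (farr F f))) = Tgt C (Cmp C f (u (Src C f)))"
        using u o f Ga[OF Ff] L(1-3)[OF Ff] ff by (simp_all add: C.Cmp_Arr C.Src_Cmp C.Tgt_Cmp)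
      show "farr F (Cmp C (u (Tgt C f)) (farr G (farr F f))) = farr F (Cmp C f (u (Src C f)))"
        using u o f Ga[OF Ff] L[OF Ff] ff functor_Cmp[OF F] by simp
    qed
    show "(comp_functor C G F, restrict u (Obj C), id_functor C) \<in> Arr (functor_cat C C)"
      using u nat ff comp_functor_in[OF C G F] id_functor_in[OF C]
      by (auto simp: functor_cat_Arr_iff comp_functor_apply id_functor_apply Gf C.Src_Obj C.Tgt_Obj)
    show "invertible_arrow C (restrict u (Obj C) x)" if x: "x \<in> Obj C" for x
    proof -
      have "Cmp C (u' x) (u x) = Idn C (R (fobj F x))" "Cmp C (u x) (u' x) = Idn C x"
        using u[OF x] u'[OF x] e'e ee' ff R x functor_Cmp[OF F] functor_Idn[OF F]
        by (auto intro!: faithful simp: C.Cmp_Arr C.Src_Cmp C.Tgt_Cmp C.Idn_Arr C.Src_Idn C.Tgt_Idn)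
      then show ?thesis
        unfolding invertible_arrow_def using x u[OF x] u'[OF x] by (auto intro!: bexI[of _ "u' x"])
    qed
  qed
  ultimately show ?thesis
    unfolding category_equivalence_def using C D F G by blast
qed

section \<open>Precomposition with an equivalence\<close>

definition precomp ::
  "('o, 'm) cat \<Rightarrow> ('p, 'n) cat \<Rightarrow> ('q, 'k) cat \<Rightarrow> ('o, 'm, 'p, 'n) ftr \<Rightarrow>
   (('p, 'n, 'q, 'k) ftr, ('p, 'n, 'q, 'k) nattrans, ('o, 'm, 'q, 'k) ftr, ('o, 'm, 'q, 'k) nattrans) ftr"
  where "precomp C' C D J =
    \<lparr>fobj = (\<lambda>F \<in> functors C D. comp_functor C' F J),
     farr = (\<lambda>\<tau> \<in> Arr (functor_cat C D). whisker C' \<tau> J)\<rparr>"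

lemma whisker_in:
  assumes C': "category C'" and J: "J \<in> functors C' C" and \<alpha>: "(F, \<alpha>, G) \<in> Arr (functor_cat C D)"
  shows "whisker C' (F, \<alpha>, G) J \<in> Arr (functor_cat C' D)"
proof -
  interpret category C' by fact
  show ?thesis
    using \<alpha> comp_functor_in[OF C' _ J] functor_fobj[OF J] functor_farr[OF J] functor_Src[OF J]
      functor_Tgt[OF J]
    by (auto simp: whisker_def functor_cat_Arr_iff comp_functor_apply compose_def Src_Obj Tgt_Obj) metis+
qed

lemma precomp_in:
  assumes C': "category C'" and C: "category C" and D: "category D" and J: "J \<in> functors C' C"
  shows "precomp C' C D J \<in> functors (functor_cat C D) (functor_cat C' D)"
proof -
  interpret C': category C' by fact
  interpret CD: category "functor_cat C D" using C D by (rule category_functor_cat)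
  have "whisker C' \<tau> J \<in> Arr (functor_cat C' D)" if "\<tau> \<in> Arr (functor_cat C D)" for \<tau>
    using that whisker_in[OF C' J] by (cases \<tau>) auto
  moreover have "comp_functor C' F J \<in> functors C' D" if "F \<in> functors C D" for F
    using comp_functor_in[OF C' that J] .
  moreover have "whisker C' (Cmp (functor_cat C D) \<tau>' \<tau>) J =
      Cmp (functor_cat C' D) (whisker C' \<tau>' J) (whisker C' \<tau> J)" for \<tau> \<tau>'
    using functor_fobj[OF J]
    by (cases \<tau>; cases \<tau>') (auto simp: whisker_def compose_def restrict_def)
  moreover have "whisker C' (Idn (functor_cat C D) F) J = Idn (functor_cat C' D) (comp_functor C' F J)"
    for F using functor_fobj[OF J]
    by (auto simp: whisker_def compose_def comp_functor_apply restrict_def)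
  ultimately show ?thesis
    using CD.Idn_Arr CD.Cmp_Arr CD.Src_Obj CD.Tgt_Obj unfolding functors_def[of "functor_cat C D"]
    by (auto simp: precomp_def simp del: functor_cat_simps(4,5)) (auto simp: functor_cat_Src_Tgt whisker_def)
qed

lemma comp_functor_assoc:
  assumes F: "F \<in> functors C D"
  shows "comp_functor C (comp_functor D H G) F = comp_functor C H (comp_functor C G F)"
  using functor_fobj[OF F] functor_farr[OF F]
  by (auto simp: comp_functor_def compose_def restrict_def fun_eq_iff)

lemma comp_functor_id: "F \<in> functors C D \<Longrightarrow> comp_functor C F (id_functor C) = F"
  using functor_ext[of F C D]
  by (cases F) (auto simp: comp_functor_def id_functor_def compose_def restrict_def extensional_def fun_eq_iff)

lemma precomp_comp:
  assumes C: "category C" and C': "category C'" and D: "category D"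
    and J: "J \<in> functors C' C" and R: "R \<in> functors C C'"
  shows "comp_functor (functor_cat C' D) (precomp C' C D J) (precomp C C' D R) =
    precomp C' C' D (comp_functor C' R J)"
proof (rule functor_eqI)
  note i = precomp_in[OF C C' D R]
  show "comp_functor (functor_cat C' D) (precomp C' C D J) (precomp C C' D R)
      \<in> functors (functor_cat C' D) (functor_cat C' D)"
    by (rule comp_functor_in[OF category_functor_cat[OF C' D] precomp_in[OF C' C D J] i])
  show "precomp C' C' D (comp_functor C' R J) \<in> functors (functor_cat C' D) (functor_cat C' D)"
    by (rule precomp_in[OF C' C' D comp_functor_in[OF C' R J]])
  fix H assume "H \<in> Obj (functor_cat C' D)"
  then have H: "H \<in> functors C' D" by simp
  show "fobj (comp_functor (functor_cat C' D) (precomp C' C D J) (precomp C C' D R)) H =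
      fobj (precomp C' C' D (comp_functor C' R J)) H"
    using H comp_functor_assoc[OF J] comp_functor_in[OF C H R]
    by (simp add: comp_functor_apply precomp_def)
next
  fix \<tau> assume \<tau>: "\<tau> \<in> Arr (functor_cat C' D)"
  obtain F \<alpha> G where [simp]: "\<tau> = (F, \<alpha>, G)" by (cases \<tau>)
  have "whisker C \<tau> R \<in> Arr (functor_cat C D)" using whisker_in[OF C R] \<tau> by simp
  then show "farr (comp_functor (functor_cat C' D) (precomp C' C D J) (precomp C C' D R)) \<tau> =
      farr (precomp C' C' D (comp_functor C' R J)) \<tau>"
    using \<tau> comp_functor_assoc[OF J] functor_fobj[OF J] nattrans_functors[of F \<alpha> G C' D]
    by (auto simp: comp_functor_apply precomp_def whisker_def compose_def restrict_def fun_eq_iff)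
qed

text \<open>If \<open>\<mu> : S \<Rightarrow> id\<close> is an isomorphism of endofunctors, then the arrows \<open>F (\<mu> x)\<close> form an isomorphism
  \<open>F \<circ> S \<Rightarrow> F\<close>, natural in \<open>F\<close>.\<close>

lemma precomp_iso_id:
  assumes C: "category C" and D: "category D"
    and iso: "isomorphic_objects (functor_cat C C) S (id_functor C)"
  shows "isomorphic_objects (functor_cat (functor_cat C D) (functor_cat C D))
    (precomp C C D S) (id_functor (functor_cat C D))"
proof -
  interpret C: category C by fact
  interpret D: category D by fact
  note CD = category_functor_cat[OF C D]
  obtain T T' where T: "T \<in> Arr (functor_cat C C)" "fst T = S" "snd (snd T) = id_functor C"
    and T': "T' \<in> Arr (functor_cat C C)" "fst T' = id_functor C" "snd (snd T') = S"
    and TT': "Cmp (functor_cat C C) T' T = Idn (functor_cat C C) S"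
      "Cmp (functor_cat C C) T T' = Idn (functor_cat C C) (id_functor C)"
    using iso unfolding isomorphic_objects_def invertible_arrow_def
    by (auto simp: functor_cat_Src_Tgt simp del: functor_cat_simps)
  obtain \<mu> \<mu>' where [simp]: "T = (S, \<mu>, id_functor C)" "T' = (id_functor C, \<mu>', S)"
    using T T' by (cases T; cases T') auto
  have \<mu>: "(S, \<mu>, id_functor C) \<in> Arr (functor_cat C C)"
    and \<mu>': "(id_functor C, \<mu>', S) \<in> Arr (functor_cat C C)"
    using T T' by auto
  have inv: "Cmp C (\<mu>' x) (\<mu> x) = Idn C (fobj S x)" "Cmp C (\<mu> x) (\<mu>' x) = Idn C x"
    if x: "x \<in> Obj C" for x
    using TT' x by (auto simp: id_functor_apply dest: fun_cong[of _ _ x])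
  note S = nattrans_functors(1)[OF \<mu>]
  have m: "\<mu> x \<in> Arr C" "Src C (\<mu> x) = fobj S x" "Tgt C (\<mu> x) = x"
      "\<mu>' x \<in> Arr C" "Tgt C (\<mu>' x) = fobj S x" "Src C (\<mu>' x) = x" if x: "x \<in> Obj C" for x
    using nattrans_arrow[OF \<mu> x] nattrans_Src[OF \<mu> x] nattrans_Tgt[OF \<mu> x]
      nattrans_arrow[OF \<mu>' x] nattrans_Src[OF \<mu>' x] nattrans_Tgt[OF \<mu>' x] x
    by (simp_all add: id_functor_apply)
  have \<mu>_nat: "Cmp C (\<mu> (Tgt C f)) (farr S f) = Cmp C f (\<mu> (Src C f))" if "f \<in> Arr C" for f
    using nattrans_natural[OF \<mu> that] that by (simp add: id_functor_apply)
  define E where "E F = (\<lambda>x \<in> Obj C. farr F (\<mu> x))" for F :: "('a, 'b, 'c, 'd) ftr"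
  have EF: "(comp_functor C F S, E F, F) \<in> Arr (functor_cat C D)" if F: "F \<in> functors C D" for F
    unfolding functor_cat_Arr_iff
    using F comp_functor_in[OF C F S] m functor_farr[OF F] functor_Src[OF F] functor_Tgt[OF F] \<mu>_nat
      functor_Cmp[OF F, symmetric] functor_farr[OF S] functor_Src[OF S] functor_Tgt[OF S]
    by (auto simp: E_def comp_functor_apply C.Src_Obj C.Tgt_Obj)
  show ?thesis
  proof (rule isomorphic_functorsI[OF CD CD])
    let ?E = "\<lambda>F \<in> functors C D. (comp_functor C F S, E F, F)"
    have "Cmp (functor_cat C D) (comp_functor C G S, E G, G) (whisker C (F, \<alpha>, G) S) =
        Cmp (functor_cat C D) (F, \<alpha>, G) (comp_functor C F S, E F, F)"
      if \<alpha>: "(F, \<alpha>, G) \<in> Arr (functor_cat C D)" for F \<alpha> G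
      using nattrans_natural[OF \<alpha> m(1)] m
      by (auto simp: whisker_def compose_def E_def intro!: restrict_ext)
    then show "(precomp C C D S, ?E, id_functor (functor_cat C D))
        \<in> Arr (functor_cat (functor_cat C D) (functor_cat C D))"
      using precomp_in[OF C C D S] id_functor_in[OF CD] EF nattrans_functors[where C = C and D = D]
      unfolding functor_cat_Arr_iff[where C = "functor_cat C D"]
      by (auto simp: precomp_def id_functor_apply  simp del: functor_cat_simps(5))
    fix F assume "F \<in> Obj (functor_cat C D)"
    then have F: "F \<in> functors C D" by simp
    have "invertible_arrow D (farr F (\<mu> x))" if x: "x \<in> Obj C" for x
      unfolding invertible_arrow_def
      using m[OF x] functor_farr[OF F] functor_Src[OF F] functor_Tgt[OF F] functor_Cmp[OF F, symmetric]
        functor_Idn[OF F] inv[OF x] x functor_fobj[OF S]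
      by (auto intro!: bexI[of _ "farr F (\<mu>' x)"])
    then show "invertible_arrow (functor_cat C D) (?E F)"
      using invertible_nattransI[OF C D EF[OF F]] F by (simp add: E_def)
  qed
qed

text \<open>Precomposition reverses composition strictly, so that precomposition with a quasi-inverse of \<open>J\<close> is
  a quasi-inverse.\<close>

lemma precomp_equivalence:
  assumes D: "category D" and J: "category_equivalence C' C J"
  shows "category_equivalence (functor_cat C D) (functor_cat C' D) (precomp C' C D J)"
proof -
  obtain R where C: "category C" "category C'" and JF: "J \<in> functors C' C" and R: "R \<in> functors C C'"
    and iso: "isomorphic_objects (functor_cat C' C') (comp_functor C' R J) (id_functor C')"
      "isomorphic_objects (functor_cat C C) (comp_functor C J R) (id_functor C)"
    using J unfolding category_equivalence_def by auto
  then show ?thesis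
    unfolding category_equivalence_def
    using category_functor_cat[OF _ D] precomp_in[OF C(2,1) D JF] precomp_in[OF C D R]
      precomp_comp[OF C D JF R] precomp_comp[OF C(2,1) D R JF] precomp_iso_id[OF _ D]
    by (metis)
qed

section \<open>The group of paths of a rack\<close>

text \<open>Functions on the group of paths are given by functions on words; they are evaluated by choosing a
  representative (\<open>the_elem_path_class\<close>, \<open>UN_path_class\<close>).\<close>

definition path_class :: "'a rack \<Rightarrow> 'a word \<Rightarrow> 'a word set" where
  "path_class X w = path_rel X `` {w}"

definition letter :: "'a rack \<Rightarrow> 'a \<Rightarrow> bool \<Rightarrow> 'a word set" where
  "letter X a b = path_class X [(a, b)]"

abbreviation gen :: "'a rack \<Rightarrow> 'a \<Rightarrow> 'a word set" where
  "gen X a \<equiv> letter X a True"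

definition rack_step :: "'a rack \<Rightarrow> bool \<Rightarrow> 'a \<Rightarrow> 'a \<Rightarrow> 'a" where
  "rack_step X b x y = (if b then x \<triangleleft>\<^bsub>X\<^esub> y else x \<triangleleft>\<inverse>\<^bsub>X\<^esub> y)"

lemma rack_step_simps [simp]:
  "rack_step X True x y = x \<triangleleft>\<^bsub>X\<^esub> y" "rack_step X False x y = x \<triangleleft>\<inverse>\<^bsub>X\<^esub> y"
  by (simp_all add: rack_step_def)

lemma words_simps [simp]:
  "[] \<in> words X" "(x, b) # w \<in> words X \<longleftrightarrow> x \<in> carrier X \<and> w \<in> words X"
  "u @ v \<in> words X \<longleftrightarrow> u \<in> words X \<and> v \<in> words X"
  by (auto simp: words_def)

lemma word_act_simps [simp]:
  "word_act X x [] = x"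
  "word_act X x ((y, b) # w) = word_act X (rack_step X b x y) w"
  "word_act X x (u @ v) = word_act X (word_act X x u) v"
  by (simp_all add: word_act_def rack_step_def)

context rack
begin

lemma step_closed: "x \<in> carrier X \<Longrightarrow> y \<in> carrier X \<Longrightarrow> rack_step X b x y \<in> carrier X"
  by (cases b) (simp_all add: rop_closed rinv_closed)

lemma step_inverse: "x \<in> carrier X \<Longrightarrow> y \<in> carrier X \<Longrightarrow> rack_step X (\<not> b) (rack_step X b x y) y = x"
  by (cases b) (simp_all add: rop_rinv rinv_rop)

lemma word_act_closed: "x \<in> carrier X \<Longrightarrow> w \<in> words X \<Longrightarrow> word_act X x w \<in> carrier X"
  by (induction w arbitrary: x) (auto simp: step_closed)

lemma path_rel_words: "(u, v) \<in> path_rel X \<Longrightarrow> u \<in> words X \<and> v \<in> words X"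
  by (induction rule: path_rel.induct) (auto simp: rop_closed)

lemma equiv_path_rel: "equiv (words X) (path_rel X)"
proof (rule equivI)
  show "path_rel X \<subseteq> words X \<times> words X" using path_rel_words by auto
  show "refl_on (words X) (path_rel X)" by (simp add: refl_on_def path_rel.refl)
  show "sym (path_rel X)" using path_rel.sym by (rule symI)
  show "trans (path_rel X)" using path_rel.trans by (rule transI)
qed

lemma path_rel_context:
  "(u, v) \<in> path_rel X \<Longrightarrow> p \<in> words X \<Longrightarrow> q \<in> words X \<Longrightarrow> (p @ u @ q, p @ v @ q) \<in> path_rel X"
proof (induction rule: path_rel.induct)
  case (refl w)
  then show ?case by (auto intro: path_rel.refl)
next
  case (sym u v)
  then show ?case using path_rel.sym by blast
next
  case (trans u v w)
  then show ?case using path_rel.trans by blast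
next
  case (cancel u v x b)
  then show ?case using path_rel.cancel[of "p @ u" X "v @ q" x b] by simp
next
  case (conj u v x a)
  then show ?case using path_rel.conj[of "p @ u" X "v @ q" x a] by simp
qed

lemma path_rel_append:
  assumes "(u, u') \<in> path_rel X" "(v, v') \<in> path_rel X"
  shows "(u @ v, u' @ v') \<in> path_rel X"
  using path_rel_context[OF assms(1), of "[]" v] path_rel_context[OF assms(2), of u' "[]"]
    path_rel_words[OF assms(1)] path_rel_words[OF assms(2)] path_rel.trans
  by auto

lemma path_class_eq_iff:
  "u \<in> words X \<Longrightarrow> v \<in> words X \<Longrightarrow> path_class X u = path_class X v \<longleftrightarrow> (u, v) \<in> path_rel X"
  using eq_equiv_class_iff[OF equiv_path_rel] by (simp add: path_class_def)

lemma path_class_in: "w \<in> words X \<Longrightarrow> path_class X w \<in> carrier (Pth X)"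
  by (auto simp: Pth_def path_class_def quotient_def)

lemma path_classE:
  assumes "g \<in> carrier (Pth X)" obtains w where "w \<in> words X" "g = path_class X w"
  using assms unfolding Pth_def path_class_def quotient_def by auto

lemma mem_path_class: "w \<in> words X \<Longrightarrow> u \<in> path_class X w \<longleftrightarrow> (w, u) \<in> path_rel X"
  by (simp add: path_class_def)

lemma the_elem_path_class:
  assumes "w \<in> words X" "\<And>u v. (u, v) \<in> path_rel X \<Longrightarrow> \<phi> u = \<phi> v"
  shows "the_elem (\<phi> ` path_class X w) = \<phi> w"
proof -
  have "w \<in> path_class X w" using assms(1) by (simp add: mem_path_class path_rel.refl)
  moreover have "\<phi> u = \<phi> w" if "u \<in> path_class X w" for u
    using assms(2)[of w u] that assms(1) by (simp add: mem_path_class)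
  ultimately have "\<phi> ` path_class X w = {\<phi> w}" by blast
  then show ?thesis by simp
qed

lemma UN_path_class:
  assumes "w \<in> words X" "\<And>u v. (u, v) \<in> path_rel X \<Longrightarrow> \<phi> u = \<phi> v"
  shows "(\<Union>u \<in> path_class X w. \<phi> u) = \<phi> w"
proof -
  have "w \<in> path_class X w" using assms(1) by (simp add: mem_path_class path_rel.refl)
  moreover have "\<phi> u = \<phi> w" if "u \<in> path_class X w" for u
    using assms(2)[of w u] that assms(1) by (simp add: mem_path_class)
  ultimately show ?thesis by blast
qed

lemma mult_path_class:
  assumes u: "u \<in> words X" and v: "v \<in> words X"
  shows "path_class X u \<otimes>\<^bsub>Pth X\<^esub> path_class X v = path_class X (u @ v)"
proof -
  have c: "path_class X (u @ v) = path_class X (u' @ v')"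
    if "(u, u') \<in> path_rel X" "(v, v') \<in> path_rel X" for u u' v v'
    using that path_rel_words path_rel_append[OF that] by (subst path_class_eq_iff) auto
  have "path_class X u \<otimes>\<^bsub>Pth X\<^esub> path_class X v =
      (\<Union>u' \<in> path_class X u. \<Union>v' \<in> path_class X v. path_class X (u' @ v'))"
    by (simp add: Pth_def path_class_def)
  also have "\<dots> = (\<Union>u' \<in> path_class X u. path_class X (u' @ v))"
    using v path_rel_words[of u] u
    by (intro SUP_cong refl UN_path_class c) (auto simp: mem_path_class intro: path_rel.refl)
  also have "\<dots> = path_class X (u @ v)"
    using v by (intro UN_path_class[OF u] c) (auto intro: path_rel.refl)
  finally show ?thesis .
qed

lemma one_Pth: "\<one>\<^bsub>Pth X\<^esub> = path_class X []"
  by (simp add: Pth_def path_class_def)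

lemma inverse_word: "w \<in> words X \<Longrightarrow>
    (rev (map (\<lambda>(x, b). (x, \<not> b)) w) @ w, []) \<in> path_rel X \<and> rev (map (\<lambda>(x, b). (x, \<not> b)) w) \<in> words X"
proof (induction w)
  case (Cons p w)
  obtain x b where [simp]: "p = (x, b)" by (cases p)
  let ?v = "rev (map (\<lambda>(x, b). (x, \<not> b)) w)"
  have "(?v @ [(x, \<not> b), (x, \<not> \<not> b)] @ w, ?v @ w) \<in> path_rel X"
    using Cons by (intro path_rel.cancel) auto
  then show ?case using Cons path_rel.trans by auto
qed (simp add: path_rel.refl)

lemma group_Pth: "group (Pth X)"
proof (rule groupI)
  fix x assume "x \<in> carrier (Pth X)"
  then obtain w where w: "w \<in> words X" "x = path_class X w" by (rule path_classE)
  show "\<exists>y \<in> carrier (Pth X). y \<otimes>\<^bsub>Pth X\<^esub> x = \<one>\<^bsub>Pth X\<^esub>"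
    using inverse_word[OF w(1)] w
    by (intro bexI[of _ "path_class X (rev (map (\<lambda>(x, b). (x, \<not> b)) w))"])
      (auto simp: mult_path_class one_Pth path_class_eq_iff path_class_in)
qed (auto simp: mult_path_class one_Pth path_class_in elim!: path_classE)

lemma letter_in: "a \<in> carrier X \<Longrightarrow> letter X a b \<in> carrier (Pth X)"
  by (simp add: letter_def path_class_in)

lemma inv_letter:
  assumes a: "a \<in> carrier X"
  shows "inv\<^bsub>Pth X\<^esub> letter X a b = letter X a (\<not> b)"
proof -
  interpret G: group "Pth X" by (rule group_Pth)
  have "([] @ [(a, \<not> b), (a, \<not> \<not> b)] @ [], [] @ []) \<in> path_rel X"
    using a by (intro path_rel.cancel) auto
  then have "letter X a (\<not> b) \<otimes>\<^bsub>Pth X\<^esub> letter X a b = \<one>\<^bsub>Pth X\<^esub>"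
    using a by (simp add: letter_def mult_path_class one_Pth path_class_eq_iff)
  then show ?thesis
    using a by (intro G.inv_equality) (auto simp: letter_in)
qed

text \<open>For \<open>b = True\<close> this is a defining relation. The other case follows by applying it to the inverse
  operation.\<close>

lemma gen_step:
  assumes x: "x \<in> carrier X" and a: "a \<in> carrier X"
  shows "gen X (rack_step X b x a) = inv\<^bsub>Pth X\<^esub> letter X a b \<otimes>\<^bsub>Pth X\<^esub> gen X x \<otimes>\<^bsub>Pth X\<^esub> letter X a b"
proof -
  interpret G: group "Pth X" by (rule group_Pth)
  have rop: "gen X (x \<triangleleft> a) = inv\<^bsub>Pth X\<^esub> gen X a \<otimes>\<^bsub>Pth X\<^esub> gen X x \<otimes>\<^bsub>Pth X\<^esub> gen X a"
    if "x \<in> carrier X" for x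
    unfolding inv_letter[OF a] unfolding letter_def
    using that a path_rel.conj[of "[]" X "[]" x a]
    by (simp add: mult_path_class path_class_eq_iff rop_closed)
  show ?thesis
  proof (cases b)
    case False
    let ?z = "x \<triangleleft>\<inverse> a"
    have z: "?z \<in> carrier X" "?z \<triangleleft> a = x" using x a by (simp_all add: rinv_closed rinv_rop)
    have i: "inv\<^bsub>Pth X\<^esub> letter X a False = gen X a" "letter X a False = inv\<^bsub>Pth X\<^esub> gen X a"
      using a by (simp_all add: inv_letter)
    have "gen X a \<otimes>\<^bsub>Pth X\<^esub> gen X x \<otimes>\<^bsub>Pth X\<^esub> inv\<^bsub>Pth X\<^esub> gen X a =
        gen X a \<otimes>\<^bsub>Pth X\<^esub> (inv\<^bsub>Pth X\<^esub> gen X a \<otimes>\<^bsub>Pth X\<^esub> gen X ?z \<otimes>\<^bsub>Pth X\<^esub> gen X a)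
          \<otimes>\<^bsub>Pth X\<^esub> inv\<^bsub>Pth X\<^esub> gen X a"
      using rop[OF z(1)] z(2) by simp
    also have "\<dots> = gen X ?z"
      using a z by (simp add: letter_in G.m_assoc) (simp add: G.m_assoc[symmetric] letter_in)
    finally show ?thesis using False i by simp
  qed (simp add: rop[OF x])
qed

lemma Pth_induct [consumes 1, case_names one letter]:
  assumes "g \<in> carrier (Pth X)" "Q \<one>\<^bsub>Pth X\<^esub>"
    and "\<And>g a b. g \<in> carrier (Pth X) \<Longrightarrow> a \<in> carrier X \<Longrightarrow> Q g \<Longrightarrow> Q (g \<otimes>\<^bsub>Pth X\<^esub> letter X a b)"
  shows "Q g"
proof -
  have "w \<in> words X \<Longrightarrow> Q (path_class X w)" for w
  proof (induction w rule: rev_induct)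
    case Nil
    then show ?case using assms(2) by (simp add: one_Pth)
  next
    case (snoc p w)
    obtain x b where [simp]: "p = (x, b)" by (cases p)
    have "Q (path_class X w \<otimes>\<^bsub>Pth X\<^esub> letter X x b)"
      using snoc assms(3) by (simp add: path_class_in)
    then show ?case using snoc by (simp add: letter_def mult_path_class)
  qed
  then show ?thesis using assms(1) path_classE by metis
qed

end

subsection \<open>Functoriality\<close>

lemma Pth_map_path_class:
  assumes X: "rack X" and Y: "rack Y" and h: "h \<in> rack_hom X Y" and w: "w \<in> words X"
  shows "Pth_map Y h (path_class X w) = path_class Y (map (map_prod h id) w)"
    "map (map_prod h id) w \<in> words Y"
proof -
  interpret X: rack X by fact
  interpret Y: rack Y by fact
  have hc: "x \<in> carrier X \<Longrightarrow> h x \<in> carrier Y"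
    and hr: "x \<in> carrier X \<Longrightarrow> y \<in> carrier X \<Longrightarrow> h (x \<triangleleft>\<^bsub>X\<^esub> y) = h x \<triangleleft>\<^bsub>Y\<^esub> h y" for x y
    using h by (auto simp: rack_hom_def)
  have hw: "w \<in> words X \<Longrightarrow> map (map_prod h id) w \<in> words Y" for w
    using hc by (auto simp: words_def in_lists_conv_set)
  have "(u, v) \<in> path_rel X \<Longrightarrow> (map (map_prod h id) u, map (map_prod h id) v) \<in> path_rel Y" for u v
  proof (induction rule: path_rel.induct)
    case (sym u v)
    from sym.IH show ?case by (rule path_rel.sym)
  next
    case (trans u v w)
    from trans.IH show ?case by (rule path_rel.trans)
  next
    case (cancel u v x b)
    then show ?case
      using path_rel.cancel[of "map (map_prod h id) u" Y "map (map_prod h id) v" "h x" b] hw hc by (simp add: id_def)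
  next
    case (conj u v x a)
    then show ?case
      using path_rel.conj[of "map (map_prod h id) u" Y "map (map_prod h id) v" "h x" "h a"] hw hc
      by (simp add: hr id_def)
  next
    case (refl w)
    from path_rel.refl[OF hw[OF this]] show ?case unfolding id_def .
  qed
  then have "path_class Y (map (map_prod h id) u) = path_class Y (map (map_prod h id) v)"
    if "(u, v) \<in> path_rel X" for u v
    using that hw X.path_rel_words[OF that] by (simp add: Y.path_class_eq_iff)
  then show "Pth_map Y h (path_class X w) = path_class Y (map (map_prod h id) w)"
    unfolding Pth_map_def using w X.UN_path_class[of w "\<lambda>w. path_class Y (map (map_prod h id) w)"]
    by (simp add: path_class_def)
  show "map (map_prod h id) w \<in> words Y" using hw w by simp
qed

lemma Pth_map_hom:
  assumes X: "rack X" and Y: "rack Y" and h: "h \<in> rack_hom X Y"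
  shows "Pth_map Y h \<in> hom (Pth X) (Pth Y)"
proof (rule homI)
  interpret X: rack X by fact
  interpret Y: rack Y by fact
  note m = Pth_map_path_class[OF X Y h]
  show "Pth_map Y h g \<in> carrier (Pth Y)" if "g \<in> carrier (Pth X)" for g
    using that m by (auto elim!: X.path_classE simp: Y.path_class_in)
  show "Pth_map Y h (g \<otimes>\<^bsub>Pth X\<^esub> g') = Pth_map Y h g \<otimes>\<^bsub>Pth Y\<^esub> Pth_map Y h g'"
    if "g \<in> carrier (Pth X)" "g' \<in> carrier (Pth X)" for g g'
    using that m by (auto elim!: X.path_classE simp: X.mult_path_class Y.mult_path_class)
qed

lemma Pth_map_comp:
  assumes X: "rack X" and Y: "rack Y" and Z: "rack Z" and h: "h \<in> rack_hom X Y"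
    and k: "k \<in> rack_hom Y Z" and kh: "compose (carrier X) k h \<in> rack_hom X Z"
    and g: "g \<in> carrier (Pth X)"
  shows "Pth_map Z k (Pth_map Y h g) = Pth_map Z (compose (carrier X) k h) g"
proof -
  obtain w where w: "w \<in> words X" "g = path_class X w" using g rack.path_classE[OF X] by blast
  have "map (map_prod k id) (map (map_prod h id) w) = map (map_prod (compose (carrier X) k h) id) w"
    using w(1) by (auto simp: words_def compose_def)
  then show ?thesis
    using Pth_map_path_class[OF X Y h w(1)] Pth_map_path_class[OF X Z kh w(1)]
      Pth_map_path_class(1)[OF Y Z k] w(2)
    by (simp del: map_map)
qed

lemma Pth_map_id:
  assumes X: "rack X" and g: "g \<in> carrier (Pth X)"
  shows "Pth_map X (\<lambda>a \<in> carrier X. a) g = g"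
proof -
  obtain w where w: "w \<in> words X" "g = path_class X w" using g rack.path_classE[OF X] by blast
  have "(\<lambda>a \<in> carrier X. a) \<in> rack_hom X X"
    using X by (auto simp: rack_hom_def rack.rop_closed rack.rinv_closed)
  moreover have "map (map_prod (\<lambda>a \<in> carrier X. a) id) w = w"
    using w(1) by (auto simp: words_def intro!: map_idI)
  ultimately show ?thesis using Pth_map_path_class(1)[OF X X _ w(1)] w(2) by simp
qed

subsection \<open>The degree\<close>

definition word_degree :: "'a word \<Rightarrow> int" where
  "word_degree w = (\<Sum>(x, b)\<leftarrow>w. if b then 1 else - 1)"

context rack
begin

lemma Pth_degree_path_class: "w \<in> words X \<Longrightarrow> Pth_degree (path_class X w) = word_degree w"
proof -
  have "(u, v) \<in> path_rel X \<Longrightarrow> word_degree u = word_degree v" for u v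
    by (induction rule: path_rel.induct) (auto simp: word_degree_def)
  then show "w \<in> words X \<Longrightarrow> ?thesis"
    unfolding Pth_degree_def using the_elem_path_class[of w word_degree]
    by (simp add: word_degree_def[abs_def])
qed

lemma Pth_degree_hom: "group_hom (Pth X) integer_group Pth_degree"
proof -
  have "Pth_degree \<in> hom (Pth X) integer_group"
    by (rule homI)
      (auto simp: Pth_degree_path_class mult_path_class word_degree_def elim!: path_classE)
  then show ?thesis
    by (simp add: group_hom_def group_hom_axioms_def group_Pth)
qed

lemma Pth_degree_gen: "a \<in> carrier X \<Longrightarrow> Pth_degree (gen X a) = 1"
  by (simp add: letter_def Pth_degree_path_class word_degree_def)

end

lemma Pth_degree_map:
  assumes X: "rack X" and Y: "rack Y" and h: "h \<in> rack_hom X Y" and g: "g \<in> carrier (Pth X)"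
  shows "Pth_degree (Pth_map Y h g) = Pth_degree g"
proof -
  obtain w where w: "w \<in> words X" "g = path_class X w" using g rack.path_classE[OF X] by blast
  have "word_degree (map (map_prod h id) w) = word_degree w"
    by (simp add: word_degree_def comp_def case_prod_unfold)
  then show ?thesis
    using Pth_map_path_class[OF X Y h w(1)] w
    by (simp add: rack.Pth_degree_path_class[OF X] rack.Pth_degree_path_class[OF Y])
qed

section \<open>Coverings and the action of paths on them\<close>

text \<open>Coverings are the concrete form of central extensions. A word of the base acts on the total space
  through its lifts, and all lifts act in the same way, so that it does not matter which one \<open>cov_act\<close>
  selects.\<close>

definition covering :: "'b rack \<Rightarrow> 'a rack \<Rightarrow> ('b \<Rightarrow> 'a) \<Rightarrow> bool" where
  "covering B A f \<longleftrightarrow> rack B \<and> rack A \<and> extension B A f \<and>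
    (\<forall>x \<in> carrier B. \<forall>y \<in> carrier B. \<forall>y' \<in> carrier B. f y = f y' \<longrightarrow> x \<triangleleft>\<^bsub>B\<^esub> y = x \<triangleleft>\<^bsub>B\<^esub> y')"

definition cov_act :: "'b rack \<Rightarrow> ('b \<Rightarrow> 'a) \<Rightarrow> 'b \<Rightarrow> 'a word set \<Rightarrow> 'b" where
  "cov_act B f b g = the_elem ((\<lambda>w. word_act B b (map (map_prod (inv_into (carrier B) f) id) w)) ` g)"

locale covering_rack = B: rack B + A: rack A for B :: "'b rack" and A :: "'a rack" +
  fixes f :: "'b \<Rightarrow> 'a"
  assumes ext: "extension B A f"
    and cov: "\<lbrakk>x \<in> carrier B; y \<in> carrier B; y' \<in> carrier B; f y = f y'\<rbrakk> \<Longrightarrow> x \<triangleleft>\<^bsub>B\<^esub> y = x \<triangleleft>\<^bsub>B\<^esub> y'"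

lemma covering_rack_iff: "covering B A f \<longleftrightarrow> covering_rack B A f"
  by (auto simp: covering_def covering_rack_def covering_rack_axioms_def)

context covering_rack
begin

sublocale G: group "Pth A" by (rule A.group_Pth)

lemma f_hom: "f \<in> rack_hom B A" and f_surj: "f ` carrier B = carrier A"
  using ext by (auto simp: extension_def)

lemma f_lift: "a \<in> carrier A \<Longrightarrow> \<exists>b \<in> carrier B. f b = a"
  unfolding f_surj[symmetric] by blast

lemma f_in: "b \<in> carrier B \<Longrightarrow> f b \<in> carrier A"
  and f_step: "b \<in> carrier B \<Longrightarrow> c \<in> carrier B \<Longrightarrow> f (rack_step B i b c) = rack_step A i (f b) (f c)"
  using f_hom by (auto simp: rack_hom_def rack_step_def)

lemma cov_step:
  assumes "x \<in> carrier B" "y \<in> carrier B" "y' \<in> carrier B" "f y = f y'"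
  shows "rack_step B i x y = rack_step B i x y'"
  using cov[OF assms] cov[of "x \<triangleleft>\<inverse>\<^bsub>B\<^esub> y" y y'] assms
  by (cases i) (simp, metis B.rinv_closed B.rinv_rop B.rop_rinv rack_step_simps(2))

lemma word_act_lift_unique:
  "\<lbrakk>b \<in> carrier B; u \<in> words B; v \<in> words B; map (map_prod f id) u = map (map_prod f id) v\<rbrakk>
    \<Longrightarrow> word_act B b u = word_act B b v"
proof (induction u arbitrary: b v)
  case (Cons p u)
  obtain q v' where v: "v = q # v'" using Cons.prems by (cases v) auto
  obtain x i where p: "p = (x, i)" by (cases p)
  obtain y j where q: "q = (y, j)" by (cases q)
  show ?case
    using Cons.prems cov_step[of b x y i] by (auto simp: v p q B.rop_closed B.rinv_closed intro!: Cons.IH)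
qed simp

lemma word_lift: "w \<in> words A \<Longrightarrow> \<exists>v \<in> words B. map (map_prod f id) v = w"
proof (induction w)
  case (Cons p w)
  obtain a i where p: "p = (a, i)" by (cases p)
  have "w \<in> words A" using Cons.prems by (simp add: p)
  then obtain v where "v \<in> words B" "map (map_prod f id) v = w" using Cons.IH by blast
  moreover have "a \<in> f ` carrier B" using Cons.prems f_surj by (simp add: p)
  then obtain b where "b \<in> carrier B" "f b = a" by blast
  ultimately show ?case by (intro bexI[of _ "(b, i) # v"]) (auto simp: p)
qed (auto intro: bexI[of _ "[]"])

lemma map_words: "v \<in> words B \<Longrightarrow> map (map_prod f id) v \<in> words A"
  using f_in by (auto simp: words_def in_lists_conv_set)

lemmas word_lift_simps = words_simps map_append list.map map_prod_simp id_def append_Cons append_Nil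
  f_step[where i = True, simplified] B.rop_closed simp_thms

text \<open>For a defining relation, the letter \<open>x \<triangleleft> a\<close> lifts to \<open>y \<triangleleft> b\<close> for lifts \<open>y\<close> and \<open>b\<close> of \<open>x\<close> and
  \<open>a\<close>, and then the self-distributivity of the total space applies.\<close>

lemma word_act_lift_cong:
  "(u, v) \<in> path_rel A \<Longrightarrow> u' \<in> words B \<Longrightarrow> v' \<in> words B \<Longrightarrow> map (map_prod f id) u' = u \<Longrightarrow>
    map (map_prod f id) v' = v \<Longrightarrow> b \<in> carrier B \<Longrightarrow> word_act B b u' = word_act B b v'"
proof (induction arbitrary: u' v' rule: path_rel.induct)
  case (refl w)
  show ?case by (rule word_act_lift_unique) (use refl.prems in \<open>simp_all only:\<close>)
next
  case (sym u v)
  then show ?case by metis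
next
  case (trans u v w)
  then show ?case using A.path_rel_words word_lift by metis
next
  case (cancel u v x i)
  obtain u1 where u1: "u1 \<in> words B" "map (map_prod f id) u1 = u" using cancel.hyps word_lift by metis
  obtain v1 where v1: "v1 \<in> words B" "map (map_prod f id) v1 = v" using cancel.hyps word_lift by metis
  obtain y where y: "y \<in> carrier B" "f y = x" using cancel.hyps f_lift by metis
  have "word_act B b u' = word_act B b (u1 @ [(y, i), (y, \<not> i)] @ v1)"
    by (rule word_act_lift_unique)
      (use cancel.prems u1 v1 y in \<open>simp_all only: word_lift_simps\<close>)
  also have "\<dots> = word_act B b (u1 @ v1)"
    using B.word_act_closed[OF cancel.prems(5) u1(1)] y by (simp add: B.step_inverse)
  also have "\<dots> = word_act B b v'"
    by (rule word_act_lift_unique)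
      (use cancel.prems u1 v1 y in \<open>simp_all only: word_lift_simps\<close>)
  finally show ?case .
next
  case (conj u v x a)
  obtain u1 where u1: "u1 \<in> words B" "map (map_prod f id) u1 = u" using conj.hyps word_lift by metis
  obtain v1 where v1: "v1 \<in> words B" "map (map_prod f id) v1 = v" using conj.hyps word_lift by metis
  obtain y where y: "y \<in> carrier B" "f y = x" using conj.hyps f_lift by metis
  obtain c where c: "c \<in> carrier B" "f c = a" using conj.hyps f_lift by metis
  let ?z = "word_act B b u1"
  have z: "?z \<in> carrier B" using B.word_act_closed conj.prems(5) u1 by blast
  have "word_act B b u' = word_act B b (u1 @ [(y \<triangleleft>\<^bsub>B\<^esub> c, True)] @ v1)"
    by (rule word_act_lift_unique)
      (use conj.prems u1 v1 y c in \<open>simp_all only: word_lift_simps\<close>)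
  also have "?z \<triangleleft>\<^bsub>B\<^esub> (y \<triangleleft>\<^bsub>B\<^esub> c) = ((?z \<triangleleft>\<inverse>\<^bsub>B\<^esub> c) \<triangleleft>\<^bsub>B\<^esub> y) \<triangleleft>\<^bsub>B\<^esub> c"
    using z y c by (simp add: B.rop_distrib B.rinv_closed B.rinv_rop)
  then have "word_act B b (u1 @ [(y \<triangleleft>\<^bsub>B\<^esub> c, True)] @ v1) =
      word_act B b (u1 @ [(c, False), (y, True), (c, True)] @ v1)"
    by simp
  also have "\<dots> = word_act B b v'"
    by (rule word_act_lift_unique)
      (use conj.prems u1 v1 y c in \<open>simp_all only: word_lift_simps\<close>)
  finally show ?case .
qed

lemma cov_act_word:
  assumes "b \<in> carrier B" "v \<in> words B"
  shows "cov_act B f b (path_class A (map (map_prod f id) v)) = word_act B b v"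
proof -
  define s where "s = map (map_prod (inv_into (carrier B) f) (id :: bool \<Rightarrow> bool))"
  have s: "s w \<in> words B" "map (map_prod f id) (s w) = w" if "w \<in> words A" for w
  proof -
    have "\<forall>a \<in> carrier A. inv_into (carrier B) f a \<in> carrier B \<and> f (inv_into (carrier B) f a) = a"
      using f_surj by (auto simp: inv_into_into f_inv_into_f)
    then show "s w \<in> words B" "map (map_prod f id) (s w) = w"
      using that by (auto simp: s_def words_def in_lists_conv_set intro!: map_idI)
  qed
  have "cov_act B f b (path_class A (map (map_prod f id) v)) =
      word_act B b (s (map (map_prod f id) v))"
    unfolding cov_act_def s_def[symmetric]
    using assms A.path_rel_words word_act_lift_cong s map_words
    by (intro A.the_elem_path_class) metis+
  also have "\<dots> = word_act B b v"
    using assms s map_words by (intro word_act_lift_unique) auto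
  finally show ?thesis .
qed

lemma path_liftE:
  assumes "g \<in> carrier (Pth A)"
  obtains v where "v \<in> words B" "g = path_class A (map (map_prod f id) v)"
  using assms word_lift by (metis A.path_classE)

lemma cov_act_closed: "b \<in> carrier B \<Longrightarrow> g \<in> carrier (Pth A) \<Longrightarrow> cov_act B f b g \<in> carrier B"
  by (elim path_liftE) (simp add: cov_act_word B.word_act_closed)

lemma cov_act_one: "b \<in> carrier B \<Longrightarrow> cov_act B f b \<one>\<^bsub>Pth A\<^esub> = b"
  using cov_act_word[of b "[]"] by (simp add: A.one_Pth)

lemma cov_act_mult:
  assumes "b \<in> carrier B" "g \<in> carrier (Pth A)" "h \<in> carrier (Pth A)"
  shows "cov_act B f b (g \<otimes>\<^bsub>Pth A\<^esub> h) = cov_act B f (cov_act B f b g) h"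
proof -
  obtain u where u: "u \<in> words B" "g = path_class A (map (map_prod f id) u)" using assms path_liftE by blast
  obtain v where v: "v \<in> words B" "h = path_class A (map (map_prod f id) v)" using assms path_liftE by blast
  have "g \<otimes>\<^bsub>Pth A\<^esub> h = path_class A (map (map_prod f id) (u @ v))"
    using u v map_words by (simp add: A.mult_path_class)
  then show ?thesis
    using assms u v cov_act_word[of b "u @ v"] by (simp add: cov_act_word B.word_act_closed)
qed

lemma cov_act_letter:
  "b \<in> carrier B \<Longrightarrow> c \<in> carrier B \<Longrightarrow> cov_act B f b (letter A (f c) i) = rack_step B i b c"
  using cov_act_word[of b "[(c, i)]"] by (simp add: letter_def)

lemma cov_act_inv:
  "b \<in> carrier B \<Longrightarrow> g \<in> carrier (Pth A) \<Longrightarrow> cov_act B f (cov_act B f b g) (inv\<^bsub>Pth A\<^esub> g) = b"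
  using cov_act_mult[of b g "inv\<^bsub>Pth A\<^esub> g"] by (simp add: cov_act_one)

end

lemma covering_id: "rack A \<Longrightarrow> covering_rack A A (\<lambda>a \<in> carrier A. a)"
  by (auto simp: covering_rack_def covering_rack_axioms_def extension_def rack_hom_def
      rack.rop_closed rack.rinv_closed)

context rack
begin

interpretation I: covering_rack X X "\<lambda>a \<in> carrier X. a"
  by (rule covering_id) unfold_locales

lemma map_word_id: "w \<in> words X \<Longrightarrow> map (map_prod (\<lambda>a \<in> carrier X. a) id) w = w"
  by (auto simp: words_def intro!: map_idI)

lemma path_act_word: "x \<in> carrier X \<Longrightarrow> w \<in> words X \<Longrightarrow> path_act X x (path_class X w) = word_act X x w"
  unfolding path_act_def using I.word_act_lift_cong[of _ _ _ _ x] map_word_id path_rel_words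
  by (intro the_elem_path_class) metis+

lemma path_act_cov_act:
  "x \<in> carrier X \<Longrightarrow> g \<in> carrier (Pth X) \<Longrightarrow> path_act X x g = cov_act X (\<lambda>a \<in> carrier X. a) x g"
  using I.cov_act_word[of x] by (auto elim!: path_classE simp: path_act_word) (metis map_word_id)

lemma path_act_closed: "x \<in> carrier X \<Longrightarrow> g \<in> carrier (Pth X) \<Longrightarrow> path_act X x g \<in> carrier X"
  by (simp add: path_act_cov_act I.cov_act_closed)

lemma path_act_one: "x \<in> carrier X \<Longrightarrow> path_act X x \<one>\<^bsub>Pth X\<^esub> = x"
  by (simp add: path_act_cov_act I.cov_act_one)

lemma path_act_mult: "x \<in> carrier X \<Longrightarrow> g \<in> carrier (Pth X) \<Longrightarrow> h \<in> carrier (Pth X) \<Longrightarrow>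
    path_act X x (g \<otimes>\<^bsub>Pth X\<^esub> h) = path_act X (path_act X x g) h"
  by (simp add: path_act_cov_act I.cov_act_mult I.cov_act_closed)

lemma path_act_letter: "x \<in> carrier X \<Longrightarrow> a \<in> carrier X \<Longrightarrow> path_act X x (letter X a b) = rack_step X b x a"
  using I.cov_act_letter[of x a] by (simp add: path_act_cov_act letter_in)

lemma path_act_inv: "x \<in> carrier X \<Longrightarrow> g \<in> carrier (Pth X) \<Longrightarrow> path_act X (path_act X x g) (inv\<^bsub>Pth X\<^esub> g) = x"
  by (simp add: path_act_cov_act I.cov_act_inv I.cov_act_closed)

lemma gen_path_act:
  assumes "x \<in> carrier X" "g \<in> carrier (Pth X)"
  shows "gen X (path_act X x g) = inv\<^bsub>Pth X\<^esub> g \<otimes>\<^bsub>Pth X\<^esub> gen X x \<otimes>\<^bsub>Pth X\<^esub> g"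
  using assms(2)
proof (induction rule: Pth_induct)
  case one
  then show ?case using assms by (simp add: path_act_one letter_in)
next
  case (letter g a b)
  then show ?case
    using assms
    by (simp add: path_act_mult path_act_letter path_act_closed gen_step letter_in I.G.inv_mult_group I.G.m_assoc)
qed

end

context covering_rack
begin

lemma f_cov_act:
  assumes "b \<in> carrier B" "g \<in> carrier (Pth A)"
  shows "f (cov_act B f b g) = path_act A (f b) g"
  using assms(2)
proof (induction rule: A.Pth_induct)
  case one
  then show ?case using assms by (simp add: cov_act_one A.path_act_one f_in)
next
  case (letter g a i)
  obtain c where c: "c \<in> carrier B" "a = f c" using f_lift letter.hyps by metis
  have d: "cov_act B f b g \<in> carrier B" using assms(1) letter.hyps by (simp add: cov_act_closed)
  show ?case
    using letter assms(1) c d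
    by (simp only: cov_act_mult A.path_act_mult A.path_act_letter cov_act_letter A.letter_in f_in f_step
        A.path_act_closed)
qed

end

text \<open>A morphism sends the lifts of a word to lifts of its image, and commutes with their action.\<close>

lemma cov_act_equivariant:
  assumes "covering_rack B A f" "covering_rack B' A' f'"
    and h: "h \<in> rack_hom B B'" and k: "k \<in> rack_hom A A'"
    and sq: "\<And>b. b \<in> carrier B \<Longrightarrow> f' (h b) = k (f b)"
    and b: "b \<in> carrier B" and g: "g \<in> carrier (Pth A)"
  shows "h (cov_act B f b g) = cov_act B' f' (h b) (Pth_map A' k g)"
proof -
  interpret X: covering_rack B A f by fact
  interpret Y: covering_rack B' A' f' by fact
  have hb: "b \<in> carrier B \<Longrightarrow> h b \<in> carrier B'" for b using h by (auto simp: rack_hom_def)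
  obtain v where v: "v \<in> words B" "g = path_class A (map (map_prod f id) v)" using g by (rule X.path_liftE)
  have "b \<in> carrier B \<Longrightarrow> w \<in> words B \<Longrightarrow> h (word_act B b w) = word_act B' (h b) (map (map_prod h id) w)"
    for b w
  proof (induction w arbitrary: b)
    case (Cons p w)
    then show ?case
      using h by (cases p) (auto simp: rack_hom_def rack_step_def X.B.rop_closed X.B.rinv_closed)
  qed simp
  moreover have "map (map_prod h id) v \<in> words B'"
    using v hb by (auto simp: words_def in_lists_conv_set)
  moreover have "map (map_prod k id) (map (map_prod f id) v) = map (map_prod f' id) (map (map_prod h id) v)"
    using v(1) sq by (auto simp: words_def)
  moreover have "Pth_map A' k g = path_class A' (map (map_prod k id) (map (map_prod f id) v))"
    unfolding v(2) by (rule Pth_map_path_class(1)[OF X.A.rack_axioms Y.A.rack_axioms k X.map_words[OF v(1)]])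
  ultimately show ?thesis
    using v b hb X.cov_act_word[OF b v(1)] Y.cov_act_word[of "h b" "map (map_prod h id) v"]
    by (simp del: map_map)
qed

section \<open>Racks and quandles simultaneously\<close>

text \<open>The two cases differ in the group \<open>P A\<close> of paths. In both, every path \<open>g\<close> from \<open>x\<close> is replaced
  by \<open>retr A x g\<close> in \<open>P A\<close>, which has the same effect on \<open>x\<close> and on all points of a covering that lie
  over \<open>x\<close>; and \<open>retr\<close> is a retraction of the action groupoid of \<^term>\<open>Pth A\<close> onto that of \<open>P A\<close>.
  For racks it is the identity. For quandles it is \<open>x\<^sup>-\<^sup>n g\<close>, where \<open>n\<close> is the degree of \<open>g\<close>: as
  \<open>x \<triangleleft> x = x\<close>, the loop \<open>x\<close> acts trivially at every point over \<open>x\<close>. All that follows is derived from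
  these properties.\<close>

locale path_theory =
  fixes K :: "'u rack \<Rightarrow> bool" and P :: "'u rack \<Rightarrow> 'u path_group"
    and retr :: "'u rack \<Rightarrow> 'u \<Rightarrow> 'u word set \<Rightarrow> 'u word set"
  assumes K_rack: "K A \<Longrightarrow> rack A"
    and P_subgroup: "K A \<Longrightarrow> subgroup (carrier (P A)) (Pth A)"
    and P_eq: "P A = (Pth A)\<lparr>carrier := carrier (P A)\<rparr>"
    and Pth_map_P: "\<lbrakk>K A'; K A; h \<in> rack_hom A' A; g \<in> carrier (P A')\<rbrakk> \<Longrightarrow> Pth_map A h g \<in> carrier (P A)"
    and retr_in: "\<lbrakk>K A; x \<in> carrier A; g \<in> carrier (Pth A)\<rbrakk> \<Longrightarrow> retr A x g \<in> carrier (P A)"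
    and retr_id: "\<lbrakk>K A; x \<in> carrier A; g \<in> carrier (P A)\<rbrakk> \<Longrightarrow> retr A x g = g"
    and retr_mult: "\<lbrakk>K A; x \<in> carrier A; g \<in> carrier (Pth A); k \<in> carrier (Pth A)\<rbrakk> \<Longrightarrow>
      retr A x (g \<otimes>\<^bsub>Pth A\<^esub> k) = retr A x g \<otimes>\<^bsub>Pth A\<^esub> retr A (path_act A x g) k"
    and cov_act_retr: "\<lbrakk>K B; K A; covering_rack B A f; b \<in> carrier B; g \<in> carrier (Pth A)\<rbrakk> \<Longrightarrow>
      cov_act B f b (retr A (f b) g) = cov_act B f b g"
    and K_I: "\<lbrakk>K A; rack B; (\<And>a. a \<in> carrier A \<Longrightarrow> retr A a (gen A a) = \<one>\<^bsub>Pth A\<^esub>) \<Longrightarrow>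
      (\<And>b. b \<in> carrier B \<Longrightarrow> b \<triangleleft>\<^bsub>B\<^esub> b = b)\<rbrakk> \<Longrightarrow> K B"

text \<open>In the last axiom, idempotence is demanded exactly if a generator retracts to the trivial path at its
  own base point. This is so for quandles, whereas a generator of the full group of paths has degree 1
  and is not trivial.\<close>

lemma path_theory_rack: "path_theory rack Pth (\<lambda>A x g. g)"
proof (rule path_theory.intro, goal_cases)
  case (2 A)
  then show ?case by (intro group.subgroup_self rack.group_Pth)
next
  case (4 A' A h g)
  then show ?case using Pth_map_hom[of A' A h] by (auto simp: hom_def)
qed auto

definition quandle_retr :: "'u rack \<Rightarrow> 'u \<Rightarrow> 'u word set \<Rightarrow> 'u word set" where
  "quandle_retr A x g = gen A x [^]\<^bsub>Pth A\<^esub> (- Pth_degree g) \<otimes>\<^bsub>Pth A\<^esub> g"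

lemma (in group) int_pow_conj:
  assumes "x \<in> carrier G" "g \<in> carrier G"
  shows "(inv g \<otimes> x \<otimes> g) [^] (n::int) = inv g \<otimes> x [^] n \<otimes> g"
proof -
  have "(\<lambda>y. inv g \<otimes> y \<otimes> g) \<in> hom G G"
  proof (rule homI)
    fix y z assume yz: "y \<in> carrier G" "z \<in> carrier G"
    have "inv g \<otimes> y \<otimes> g \<otimes> (inv g \<otimes> z \<otimes> g) = inv g \<otimes> y \<otimes> (g \<otimes> inv g) \<otimes> z \<otimes> g"
      using assms yz by (simp only: m_assoc m_closed inv_closed)
    then show "inv g \<otimes> (y \<otimes> z) \<otimes> g = inv g \<otimes> y \<otimes> g \<otimes> (inv g \<otimes> z \<otimes> g)"
      using assms yz by (simp add: m_assoc)
  qed (use assms in auto)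
  then have "group_hom G G (\<lambda>y. inv g \<otimes> y \<otimes> g)"
    by (simp add: group_hom_def group_hom_axioms_def is_group)
  from group_hom.hom_int_pow[OF this assms(1)] show ?thesis by simp
qed

text \<open>The retraction is multiplicative because the generator of \<open>x \<sqdot> g\<close> is the conjugate \<open>g\<^sup>-\<^sup>1 x g\<close>: if \<open>m\<close>
  and \<open>n\<close> are the degrees of \<open>g\<close> and \<open>h\<close>, then \<open>x\<^sup>-\<^sup>m g (g\<^sup>-\<^sup>1 x g)\<^sup>-\<^sup>n h = x\<^sup>-\<^sup>m\<^sup>-\<^sup>n g h\<close>.\<close>

lemma path_theory_quandle: "path_theory quandle Pth0 quandle_retr"
proof (rule path_theory.intro, goal_cases)
  case (1 A)
  then show ?case by (rule quandle.axioms)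
next
  case (2 A)
  then interpret rack A by (rule quandle.axioms)
  show ?case
    using group_hom.subgroup_kernel[OF Pth_degree_hom] by (simp add: Pth0_def)
next
  case (3 A)
  then show ?case by (simp add: Pth0_def)
next
  case (4 A' A h g)
  then show ?case
    using Pth_map_hom[of A' A h] Pth_degree_map[of A' A h g]
    by (auto simp: hom_def Pth0_def kernel_def quandle.axioms)
next
  case (5 A x g)
  then interpret rack A by (auto intro: quandle.axioms)
  interpret D: group_hom "Pth A" integer_group Pth_degree by (rule Pth_degree_hom)
  have "Pth_degree (gen A x [^]\<^bsub>Pth A\<^esub> (- Pth_degree g)) = - Pth_degree g"
    using 5 D.hom_int_pow[of "gen A x" "- Pth_degree g"] by (simp add: letter_in Pth_degree_gen)
  then show ?case
    using 5 by (simp add: Pth0_def kernel_def quandle_retr_def letter_in)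
next
  case (6 A x g)
  then interpret rack A by (auto intro: quandle.axioms)
  interpret G: group "Pth A" by (rule group_Pth)
  show ?case using 6 by (simp add: Pth0_def kernel_def quandle_retr_def letter_in)
next
  case (7 A x g h)
  then interpret rack A by (auto intro: quandle.axioms)
  interpret D: group_hom "Pth A" integer_group Pth_degree by (rule Pth_degree_hom)
  let ?m = "gen A x [^]\<^bsub>Pth A\<^esub> (- Pth_degree g)" and ?n = "gen A x [^]\<^bsub>Pth A\<^esub> (- Pth_degree h)"
  have mn: "?m \<in> carrier (Pth A)" "?n \<in> carrier (Pth A)" using 7 by (simp_all add: letter_in)
  have "gen A x [^]\<^bsub>Pth A\<^esub> (- Pth_degree (g \<otimes>\<^bsub>Pth A\<^esub> h)) = ?m \<otimes>\<^bsub>Pth A\<^esub> ?n"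
    using 7 by (simp add: D.G.int_pow_mult[symmetric] letter_in)
  moreover have "gen A (path_act A x g) [^]\<^bsub>Pth A\<^esub> (- Pth_degree h) = inv\<^bsub>Pth A\<^esub> g \<otimes>\<^bsub>Pth A\<^esub> ?n \<otimes>\<^bsub>Pth A\<^esub> g"
    using 7 by (simp add: gen_path_act D.G.int_pow_conj letter_in)
  moreover have "g \<otimes>\<^bsub>Pth A\<^esub> (inv\<^bsub>Pth A\<^esub> g \<otimes>\<^bsub>Pth A\<^esub> ?n \<otimes>\<^bsub>Pth A\<^esub> g \<otimes>\<^bsub>Pth A\<^esub> h) = ?n \<otimes>\<^bsub>Pth A\<^esub> (g \<otimes>\<^bsub>Pth A\<^esub> h)"
    using 7 mn by (simp add: D.G.m_assoc[symmetric])
  ultimately show ?case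
    using 7 mn by (simp add: quandle_retr_def D.G.m_assoc)
next
  case (8 B A f b g)
  then interpret covering_rack B A f by simp
  have g1: "gen A (f b) \<in> carrier (Pth A)" using 8 by (simp add: A.letter_in f_in)
  have "subgroup {h \<in> carrier (Pth A). cov_act B f b h = b} (Pth A)"
    using 8 cov_act_inv[of b]
    by (intro G.subgroupI) (auto simp: cov_act_mult intro!: exI[of _ "\<one>\<^bsub>Pth A\<^esub>"] cov_act_one, metis)
  moreover have "gen A (f b) \<in> {h \<in> carrier (Pth A). cov_act B f b h = b}"
    using 8 g1 by (simp add: cov_act_letter quandle.rop_idem)
  ultimately have "gen A (f b) [^]\<^bsub>Pth A\<^esub> (- Pth_degree g) \<in> {h \<in> carrier (Pth A). cov_act B f b h = b}"
    by (rule G.subgroup_int_pow_closed)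
  then show ?case using 8 by (simp add: quandle_retr_def cov_act_mult)
next
  case (9 A B)
  then interpret rack A by (auto intro: quandle.axioms)
  interpret G: group "Pth A" by (rule group_Pth)
  have "quandle_retr A a (gen A a) = \<one>\<^bsub>Pth A\<^esub>" if "a \<in> carrier A" for a
    using that by (simp add: quandle_retr_def Pth_degree_gen letter_in G.int_pow_neg)
  with 9 show ?case by (auto simp: quandle_def quandle_axioms_def)
qed

section \<open>Sets and groupoid actions\<close>

text \<open>The categories of sets, of sets with an action and of central extensions all consist of
  structures with an underlying set and maps that are closed under composition.\<close>

definition concrete_cat ::
  "'o set \<Rightarrow> ('o \<Rightarrow> 'u set) \<Rightarrow> ('o \<Rightarrow> 'o \<Rightarrow> ('u \<Rightarrow> 'u) set) \<Rightarrow> ('o, 'o \<times> ('u \<Rightarrow> 'u) \<times> 'o) cat" where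
  "concrete_cat Ob U Hom = \<lparr>Obj = Ob,
    Arr = {(X, f, Y). X \<in> Ob \<and> Y \<in> Ob \<and> f \<in> U X \<rightarrow>\<^sub>E U Y \<and> f \<in> Hom X Y},
    Src = (\<lambda>(X, f, Y). X), Tgt = (\<lambda>(X, f, Y). Y), Idn = (\<lambda>X. (X, \<lambda>x \<in> U X. x, X)),
    Cmp = (\<lambda>(Y', g, Z) (X, f, Y). (X, compose (U X) g f, Z))\<rparr>"

lemma concrete_cat_simps:
  "Obj (concrete_cat Ob U Hom) = Ob"
  "Src (concrete_cat Ob U Hom) (X, f, Y) = X" "Tgt (concrete_cat Ob U Hom) (X, f, Y) = Y"
  "Idn (concrete_cat Ob U Hom) X = (X, \<lambda>x \<in> U X. x, X)"
  "Cmp (concrete_cat Ob U Hom) (Y', g, Z) (X, f, Y) = (X, compose (U X) g f, Z)"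
  "(X, f, Y) \<in> Arr (concrete_cat Ob U Hom) \<longleftrightarrow> X \<in> Ob \<and> Y \<in> Ob \<and> f \<in> U X \<rightarrow>\<^sub>E U Y \<and> f \<in> Hom X Y"
  by (simp_all add: concrete_cat_def)

lemma category_concrete_cat:
  assumes Idn: "\<And>X. X \<in> Ob \<Longrightarrow> (\<lambda>x \<in> U X. x) \<in> Hom X X"
    and Cmp: "\<And>X Y Z f g. \<lbrakk>X \<in> Ob; Y \<in> Ob; Z \<in> Ob; f \<in> U X \<rightarrow>\<^sub>E U Y; f \<in> Hom X Y; g \<in> U Y \<rightarrow>\<^sub>E U Z;
      g \<in> Hom Y Z\<rbrakk> \<Longrightarrow> compose (U X) g f \<in> Hom X Z"
  shows "category (concrete_cat Ob U Hom)"
proof -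
  have maps: "compose A g f \<in> A \<rightarrow>\<^sub>E D" "compose A h (compose A g f) = compose A (compose B h g) f"
    if "f \<in> A \<rightarrow>\<^sub>E B" "g \<in> B \<rightarrow>\<^sub>E D" for f g h and A B D :: "'b set"
    using that by (auto simp: compose_def fun_eq_iff restrict_def PiE_def extensional_def Pi_iff)
  have maps': "compose A f (\<lambda>x \<in> A. x) = f" "compose A (\<lambda>x \<in> B. x) f = f"
    if "f \<in> A \<rightarrow>\<^sub>E B" for f and A B :: "'b set"
    using that by (auto simp: compose_def fun_eq_iff restrict_def PiE_def extensional_def Pi_iff)
  show ?thesis
    by unfold_locales (auto simp: concrete_cat_simps Idn simp del: PiE_iff intro!: maps' del: PiE_I intro: Cmp maps)
qed

lemma set_cat_concrete: "set_cat \<S> = concrete_cat \<S> (\<lambda>S. S) (\<lambda>S T. UNIV)"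
  by (simp add: set_cat_def concrete_cat_def)

lemmas set_cat_simps [simp] = concrete_cat_simps(1-5)[of \<S> "\<lambda>S. S" "\<lambda>S T. UNIV", folded set_cat_concrete] for \<S>

lemma set_cat_Arr_iff: "(S, f, T) \<in> Arr (set_cat \<S>) \<longleftrightarrow> S \<in> \<S> \<and> T \<in> \<S> \<and> f \<in> S \<rightarrow>\<^sub>E T"
  by (simp add: set_cat_concrete concrete_cat_simps)

lemma category_set_cat: "category (set_cat \<S>)"
  unfolding set_cat_concrete by (rule category_concrete_cat) auto

lemma invertible_set_map:
  assumes "S \<in> \<S>" "T \<in> \<S>" "f \<in> extensional S" "bij_betw f S T"
  shows "invertible_arrow (set_cat \<S>) (S, f, T)"
proof -
  have "(T, restrict (inv_into S f) T, S) \<in> Arr (set_cat \<S>)" "(S, f, T) \<in> Arr (set_cat \<S>)"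
    using assms bij_betw_inv_into[OF assms(4)]
    by (auto simp: set_cat_Arr_iff bij_betw_def intro!: PiE_I dest: extensional_arb)
  moreover have "compose S (restrict (inv_into S f) T) f = (\<lambda>x \<in> S. x)"
    "compose T f (restrict (inv_into S f) T) = (\<lambda>x \<in> T. x)"
    using assms(4) by (auto simp: bij_betw_def compose_def fun_eq_iff f_inv_into_f)
  ultimately show ?thesis
    unfolding invertible_arrow_def by (intro conjI bexI[of _ "(T, restrict (inv_into S f) T, S)"]) auto
qed

lemma action_groupoid_simps [simp]:
  "Obj (action_groupoid X G act) = X" "Arr (action_groupoid X G act) = X \<times> carrier G"
  "Src (action_groupoid X G act) (a, g) = a" "Tgt (action_groupoid X G act) (a, g) = act a g"
  "Idn (action_groupoid X G act) a = (a, \<one>\<^bsub>G\<^esub>)"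
  "Cmp (action_groupoid X G act) (b, h) (a, g) = (a, g \<otimes>\<^bsub>G\<^esub> h)"
  by (simp_all add: action_groupoid_def)

lemma category_action_groupoid:
  assumes "group G" "right_action G X act"
  shows "category (action_groupoid X G act)"
proof -
  interpret group G by fact
  show ?thesis
    using assms(2) by unfold_locales (auto simp: right_action_def m_assoc)
qed

context path_theory
begin

lemma one_P: "\<one>\<^bsub>P A\<^esub> = \<one>\<^bsub>Pth A\<^esub>"
  and mult_P: "x \<otimes>\<^bsub>P A\<^esub> y = x \<otimes>\<^bsub>Pth A\<^esub> y"
  by (subst P_eq, simp)+

lemma P_Pth: "K A \<Longrightarrow> g \<in> carrier (P A) \<Longrightarrow> g \<in> carrier (Pth A)"
  using subgroup.subset[OF P_subgroup] by blast

lemma group_P: "K A \<Longrightarrow> group (P A)"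
  by (subst P_eq) (rule subgroup.subgroup_is_group[OF P_subgroup rack.group_Pth[OF K_rack]])

lemma P_one: "K A \<Longrightarrow> \<one>\<^bsub>Pth A\<^esub> \<in> carrier (P A)"
  and P_mult: "K A \<Longrightarrow> g \<in> carrier (P A) \<Longrightarrow> h \<in> carrier (P A) \<Longrightarrow> g \<otimes>\<^bsub>Pth A\<^esub> h \<in> carrier (P A)"
  and P_inv: "K A \<Longrightarrow> g \<in> carrier (P A) \<Longrightarrow> inv\<^bsub>Pth A\<^esub> g \<in> carrier (P A)"
  using P_subgroup by (auto simp: subgroup_def)

lemma right_action_path_act: "K A \<Longrightarrow> right_action (P A) (carrier A) (path_act A)"
  unfolding right_action_def
  by (auto simp: one_P mult_P P_Pth rack.path_act_closed[OF K_rack] rack.path_act_one[OF K_rack]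
      rack.path_act_mult[OF K_rack])

lemma category_fund_gpd: "K A \<Longrightarrow> category (fund_gpd P A)"
  unfolding fund_gpd_def by (rule category_action_groupoid[OF group_P right_action_path_act])

lemma fund_gpd_simps [simp]:
  "Obj (fund_gpd P A) = carrier A" "Arr (fund_gpd P A) = carrier A \<times> carrier (P A)"
  "Src (fund_gpd P A) (a, g) = a" "Tgt (fund_gpd P A) (a, g) = path_act A a g"
  "Idn (fund_gpd P A) a = (a, \<one>\<^bsub>Pth A\<^esub>)"
  "Cmp (fund_gpd P A) (b, h) (a, g) = (a, g \<otimes>\<^bsub>Pth A\<^esub> h)"
  by (simp_all add: fund_gpd_def one_P mult_P)

lemma path_act_retr:
  assumes "K A" "x \<in> carrier A" "g \<in> carrier (Pth A)"
  shows "path_act A x (retr A x g) = path_act A x g"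
  using cov_act_retr[OF assms(1,1) covering_id[OF K_rack[OF assms(1)]] assms(2,3)] assms
    rack.path_act_cov_act[OF K_rack[OF assms(1)]] P_Pth retr_in
  by simp

lemma retr_one: "K A \<Longrightarrow> x \<in> carrier A \<Longrightarrow> retr A x \<one>\<^bsub>Pth A\<^esub> = \<one>\<^bsub>Pth A\<^esub>"
  by (simp add: retr_id P_one)

end

subsection \<open>Functors to sets as actions\<close>

definition arrow_map ::
  "('o, 'm, 'u set, 'u set \<times> ('u \<Rightarrow> 'u) \<times> 'u set) ftr \<Rightarrow> 'm \<Rightarrow> 'u \<Rightarrow> 'u" where
  "arrow_map F m = fst (snd (farr F m))"

definition action_functor :: "('o, 'm) cat \<Rightarrow> ('o \<Rightarrow> 'u set) \<Rightarrow> ('m \<Rightarrow> 'u \<Rightarrow> 'u) \<Rightarrow>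
    ('o, 'm, 'u set, 'u set \<times> ('u \<Rightarrow> 'u) \<times> 'u set) ftr" where
  "action_functor C S act = \<lparr>fobj = restrict S (Obj C),
    farr = (\<lambda>m \<in> Arr C. (S (Src C m), restrict (act m) (S (Src C m)), S (Tgt C m)))\<rparr>"

lemma action_functor_apply:
  "x \<in> Obj C \<Longrightarrow> fobj (action_functor C S act) x = S x"
    "m \<in> Arr C \<Longrightarrow> s \<in> S (Src C m) \<Longrightarrow> arrow_map (action_functor C S act) m s = act m s"
  by (simp_all add: action_functor_def arrow_map_def)

lemma action_functor_in:
  assumes C: "category C" and S: "\<And>x. x \<in> Obj C \<Longrightarrow> S x \<in> \<S>"
    and act: "\<And>m s. m \<in> Arr C \<Longrightarrow> s \<in> S (Src C m) \<Longrightarrow> act m s \<in> S (Tgt C m)"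
    and Idn: "\<And>x s. x \<in> Obj C \<Longrightarrow> s \<in> S x \<Longrightarrow> act (Idn C x) s = s"
    and Cmp: "\<And>m n s. m \<in> Arr C \<Longrightarrow> n \<in> Arr C \<Longrightarrow> Tgt C m = Src C n \<Longrightarrow> s \<in> S (Src C m) \<Longrightarrow>
      act (Cmp C n m) s = act n (act m s)"
  shows "action_functor C S act \<in> functors C (set_cat \<S>)"
proof -
  interpret category C by fact
  have act': "act m s \<in> S (Src C n)" if "m \<in> Arr C" "s \<in> S (Src C m)" "Tgt C m = Src C n" for m n s
    using act[OF that(1,2)] that(3) by simp
  show ?thesis
    using S act act' Idn Cmp
    by (auto simp: functors_def action_functor_def set_cat_Arr_iff Src_Obj Tgt_Obj Idn_Arr Src_Idn Tgt_Idn
        Cmp_Arr Src_Cmp Tgt_Cmp compose_def intro!: restrict_ext)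
qed

lemma set_functor_arrow:
  assumes F: "F \<in> functors C (set_cat \<S>)" and m: "m \<in> Arr C"
  shows "farr F m = (fobj F (Src C m), arrow_map F m, fobj F (Tgt C m))"
    "arrow_map F m \<in> fobj F (Src C m) \<rightarrow>\<^sub>E fobj F (Tgt C m)"
proof -
  show 1: "farr F m = (fobj F (Src C m), arrow_map F m, fobj F (Tgt C m))"
    using functor_Src[OF F m] functor_Tgt[OF F m]
    by (cases "farr F m") (auto simp: arrow_map_def)
  show "arrow_map F m \<in> fobj F (Src C m) \<rightarrow>\<^sub>E fobj F (Tgt C m)"
    using functor_farr[OF F m] unfolding 1 by (simp add: set_cat_Arr_iff)
qed

lemma arrow_map_closed:
  "F \<in> functors C (set_cat \<S>) \<Longrightarrow> m \<in> Arr C \<Longrightarrow> s \<in> fobj F (Src C m) \<Longrightarrow> arrow_map F m s \<in> fobj F (Tgt C m)"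
  using set_functor_arrow(2) by (rule PiE_mem)

lemma arrow_map_Idn: "F \<in> functors C (set_cat \<S>) \<Longrightarrow> x \<in> Obj C \<Longrightarrow> s \<in> fobj F x \<Longrightarrow> arrow_map F (Idn C x) s = s"
  by (simp add: arrow_map_def functor_Idn)

lemma arrow_map_Cmp:
  assumes F: "F \<in> functors C (set_cat \<S>)" and "m \<in> Arr C" "n \<in> Arr C" "Tgt C m = Src C n"
    and "s \<in> fobj F (Src C m)"
  shows "arrow_map F (Cmp C n m) s = arrow_map F n (arrow_map F m s)"
  unfolding arrow_map_def[of F "Cmp C n m"] functor_Cmp[OF assms(1-4)]
    set_functor_arrow(1)[OF F assms(2)] set_functor_arrow(1)[OF F assms(3)]
  using assms(5) by (simp add: compose_def)

text \<open>The components of a transformation to sets are triples that carry their source and target. This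
  extracts the maps between the sets, whose naturality can be tested on elements.\<close>

lemma set_nattrans_iff:
  assumes C: "category C" and F: "F \<in> functors C (set_cat \<S>)" and G: "G \<in> functors C (set_cat \<S>)"
  shows "(F, \<alpha>, G) \<in> Arr (functor_cat C (set_cat \<S>)) \<longleftrightarrow>
    \<alpha> \<in> extensional (Obj C) \<and>
    (\<forall>x \<in> Obj C. \<alpha> x = (fobj F x, fst (snd (\<alpha> x)), fobj G x) \<and>
      fst (snd (\<alpha> x)) \<in> fobj F x \<rightarrow>\<^sub>E fobj G x) \<and>
    (\<forall>m \<in> Arr C. \<forall>s \<in> fobj F (Src C m). fst (snd (\<alpha> (Tgt C m))) (arrow_map F m s) =
      arrow_map G m (fst (snd (\<alpha> (Src C m))) s))" (is "?l \<longleftrightarrow> ?e \<and> ?f \<and> ?n")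
proof -
  interpret category C by fact
  have f: "\<alpha> x \<in> Arr (set_cat \<S>) \<and> Src (set_cat \<S>) (\<alpha> x) = fobj F x \<and> Tgt (set_cat \<S>) (\<alpha> x) = fobj G x \<longleftrightarrow>
      \<alpha> x = (fobj F x, fst (snd (\<alpha> x)), fobj G x) \<and> fst (snd (\<alpha> x)) \<in> fobj F x \<rightarrow>\<^sub>E fobj G x"
    if "x \<in> Obj C" for x
    using functor_fobj[OF F that] functor_fobj[OF G that]
    by (cases "\<alpha> x") (auto simp: set_cat_Arr_iff)
  have n: "Cmp (set_cat \<S>) (\<alpha> (Tgt C m)) (farr F m) = Cmp (set_cat \<S>) (farr G m) (\<alpha> (Src C m)) \<longleftrightarrow>
      (\<forall>s \<in> fobj F (Src C m). fst (snd (\<alpha> (Tgt C m))) (arrow_map F m s) =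
        arrow_map G m (fst (snd (\<alpha> (Src C m))) s))"
    if f: ?f and m: "m \<in> Arr C" for m
  proof -
    obtain a where a: "\<alpha> (Src C m) = (fobj F (Src C m), a, fobj G (Src C m))"
      using f Src_Obj[OF m] by blast
    obtain b where b: "\<alpha> (Tgt C m) = (fobj F (Tgt C m), b, fobj G (Tgt C m))"
      using f Tgt_Obj[OF m] by blast
    show ?thesis
      unfolding set_functor_arrow(1)[OF F m] set_functor_arrow(1)[OF G m] a b
      by (auto simp: compose_def fun_eq_iff restrict_def)
  qed
  have "?l \<longleftrightarrow> ?e \<and> (\<forall>x \<in> Obj C. \<alpha> x \<in> Arr (set_cat \<S>) \<and> Src (set_cat \<S>) (\<alpha> x) = fobj F x \<and>
        Tgt (set_cat \<S>) (\<alpha> x) = fobj G x) \<and>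
      (\<forall>m \<in> Arr C. Cmp (set_cat \<S>) (\<alpha> (Tgt C m)) (farr F m) = Cmp (set_cat \<S>) (farr G m) (\<alpha> (Src C m)))"
    using F G by (auto simp: functor_cat_Arr_iff PiE_iff)
  also have "\<dots> \<longleftrightarrow> ?e \<and> ?f \<and> ?n" using f n by (metis (no_types, lifting))
  finally show ?thesis .
qed

lemma set_nattransI:
  assumes "category C" "F \<in> functors C (set_cat \<S>)" "G \<in> functors C (set_cat \<S>)"
    and "\<And>x. x \<in> Obj C \<Longrightarrow> \<phi> x \<in> fobj F x \<rightarrow>\<^sub>E fobj G x"
    and "\<And>m s. m \<in> Arr C \<Longrightarrow> s \<in> fobj F (Src C m) \<Longrightarrow>
      \<phi> (Tgt C m) (arrow_map F m s) = arrow_map G m (\<phi> (Src C m) s)"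
  shows "(F, \<lambda>x \<in> Obj C. (fobj F x, \<phi> x, fobj G x), G) \<in> Arr (functor_cat C (set_cat \<S>))"
  using assms by (simp add: set_nattrans_iff category.Src_Obj category.Tgt_Obj)

lemma set_nattrans_maps:
  assumes "category C" "(F, \<alpha>, G) \<in> Arr (functor_cat C (set_cat \<S>))"
  shows "x \<in> Obj C \<Longrightarrow> \<alpha> x = (fobj F x, fst (snd (\<alpha> x)), fobj G x)"
    "x \<in> Obj C \<Longrightarrow> fst (snd (\<alpha> x)) \<in> fobj F x \<rightarrow>\<^sub>E fobj G x"
    "m \<in> Arr C \<Longrightarrow> s \<in> fobj F (Src C m) \<Longrightarrow> fst (snd (\<alpha> (Tgt C m))) (arrow_map F m s) =
      arrow_map G m (fst (snd (\<alpha> (Src C m))) s)"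
  using assms(2) unfolding set_nattrans_iff[OF assms(1) nattrans_functors[OF assms(2)]] by blast+

section \<open>Connected components and trivial extensions\<close>

lemma pi0_rel_carrier: "(x, y) \<in> pi0_rel X \<Longrightarrow> x \<in> carrier X" "(x, y) \<in> pi0_rel X \<Longrightarrow> y \<in> carrier X"
  by (auto simp: pi0_rel_def Let_def)

lemma equiv_pi0_rel: "equiv (carrier X) (pi0_rel X)"
proof (rule equivI)
  show "pi0_rel X \<subseteq> carrier X \<times> carrier X" "refl_on (carrier X) (pi0_rel X)"
    by (auto simp: refl_on_def pi0_rel_def Let_def)
  show "sym (pi0_rel X)"
    unfolding pi0_rel_def Let_def
    by (intro sym_Int sym_rtrancl sym_Un_converse) (auto simp: sym_def)
  show "trans (pi0_rel X)"
    by (auto simp: pi0_rel_def Let_def intro!: transI dest: rtrancl_trans)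
qed

lemma pi0_rel_sym: "(x, y) \<in> pi0_rel X \<Longrightarrow> (y, x) \<in> pi0_rel X"
  and pi0_rel_trans: "(x, y) \<in> pi0_rel X \<Longrightarrow> (y, z) \<in> pi0_rel X \<Longrightarrow> (x, z) \<in> pi0_rel X"
  by (meson equiv_pi0_rel equivE symE, meson equiv_pi0_rel equivE transE)

lemma pi0_rel_step:
  assumes X: "rack X" and x: "x \<in> carrier X" and a: "a \<in> carrier X"
  shows "(x, rack_step X b x a) \<in> pi0_rel X"
proof -
  interpret rack X by fact
  have rop: "(x, x \<triangleleft>\<^bsub>X\<^esub> a) \<in> pi0_rel X" if "x \<in> carrier X" for x
    using that a by (auto simp: pi0_rel_def Let_def rop_closed)
  show ?thesis
    using rop[OF x] pi0_rel_sym[OF rop[of "x \<triangleleft>\<inverse>\<^bsub>X\<^esub> a"]] x a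
    by (cases b) (simp_all add: rinv_closed rinv_rop)
qed

text \<open>A zigzag of elementary steps is a word in the generators and their inverses.\<close>

lemma pi0_rel_iff:
  assumes X: "rack X"
  shows "(x, y) \<in> pi0_rel X \<longleftrightarrow> x \<in> carrier X \<and> (\<exists>g \<in> carrier (Pth X). y = path_act X x g)"
proof -
  interpret rack X by fact
  interpret G: group "Pth X" by (rule group_Pth)
  define R where "R = {(x, x \<triangleleft>\<^bsub>X\<^esub> y) | x y. x \<in> carrier X \<and> y \<in> carrier X}"
  have "\<exists>g \<in> carrier (Pth X). y = path_act X x g" if "(x, y) \<in> (R \<union> R\<inverse>)\<^sup>*" "x \<in> carrier X"
    using that
  proof (induction rule: rtrancl_induct)
    case base
    then show ?case by (intro bexI[of _ "\<one>\<^bsub>Pth X\<^esub>"]) (auto simp: path_act_one)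
  next
    case (step y z)
    then obtain g where g: "g \<in> carrier (Pth X)" "y = path_act X x g" by blast
    have "\<exists>a b. a \<in> carrier X \<and> z = rack_step X b y a"
      using step.hyps(2) unfolding R_def by (auto simp: rop_rinv) (metis rack_step_simps rop_rinv)+
    then obtain a b where "a \<in> carrier X" "z = rack_step X b y a" by blast
    then show ?case using g step.prems
      by (intro bexI[of _ "g \<otimes>\<^bsub>Pth X\<^esub> letter X a b"]) (simp_all add: path_act_mult path_act_letter path_act_closed letter_in)
  qed
  moreover have "(x, path_act X x g) \<in> pi0_rel X" if "x \<in> carrier X" "g \<in> carrier (Pth X)" for g
    using that(2)
  proof (induction rule: Pth_induct)
    case one
    then show ?case using that by (simp add: path_act_one pi0_rel_def Let_def)
  next
    case (letter g a b)
    then show ?case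
      using that pi0_rel_trans[OF letter.IH pi0_rel_step[OF X, of "path_act X x g" a b]]
      by (simp add: path_act_mult path_act_letter path_act_closed letter_in)
  qed
  moreover have "pi0_rel X \<subseteq> (R \<union> R\<inverse>)\<^sup>*" by (auto simp: pi0_rel_def Let_def R_def)
  ultimately show ?thesis using pi0_rel_carrier(1)[of x y X] by blast
qed

lemma eta_eq_iff:
  assumes "x \<in> carrier X" "y \<in> carrier X"
  shows "eta X x = eta X y \<longleftrightarrow> (x, y) \<in> pi0_rel X"
  using eq_equiv_class_iff[OF equiv_pi0_rel assms] assms by (simp add: eta_def)

lemma eta_in: "x \<in> carrier X \<Longrightarrow> eta X x \<in> pi0 X"
  by (auto simp: eta_def pi0_def quotient_def)

lemma pi0E: assumes "c \<in> pi0 X" obtains x where "x \<in> carrier X" "c = eta X x"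
  using assms by (auto simp: eta_def pi0_def quotient_def)

lemma mem_eta: "x \<in> carrier X \<Longrightarrow> y \<in> eta X x \<longleftrightarrow> (x, y) \<in> pi0_rel X"
  by (simp add: eta_def)

lemma pi0_rel_hom:
  assumes X: "rack X" and Y: "rack Y" and t: "t \<in> rack_hom X Y" and xy: "(x, y) \<in> pi0_rel X"
  shows "(t x, t y) \<in> pi0_rel Y"
proof -
  interpret X: rack X by fact
  interpret Y: rack Y by fact
  obtain g where g: "x \<in> carrier X" "g \<in> carrier (Pth X)" "y = path_act X x g"
    using xy pi0_rel_iff[OF X] by auto
  have tc: "x \<in> carrier X \<Longrightarrow> t x \<in> carrier Y" for x using t by (auto simp: rack_hom_def)
  have "t (cov_act X (\<lambda>a \<in> carrier X. a) x g) = cov_act Y (\<lambda>a \<in> carrier Y. a) (t x) (Pth_map Y t g)"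
    using g tc by (intro cov_act_equivariant[OF covering_id[OF X] covering_id[OF Y] t t]) auto
  moreover have "Pth_map Y t g \<in> carrier (Pth Y)"
    using Pth_map_hom[OF X Y t] g by (auto simp: hom_def)
  ultimately show ?thesis
    using g tc unfolding pi0_rel_iff[OF Y] by (metis X.path_act_cov_act Y.path_act_cov_act)
qed

text \<open>As morphisms preserve components, all members of the union that defines \<open>pi0_map\<close> are equal.\<close>

lemma pi0_map_eta:
  assumes X: "rack X" and Y: "rack Y" and t: "t \<in> rack_hom X Y" and x: "x \<in> carrier X"
  shows "pi0_map X Y t (eta X x) = eta Y (t x)"
proof -
  have tc: "x \<in> carrier X \<Longrightarrow> t x \<in> carrier Y" for x using t by (auto simp: rack_hom_def)
  have "eta Y (t y) = eta Y (t x)" if "y \<in> eta X x" for y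
  proof -
    have "(x, y) \<in> pi0_rel X" using that X x by (simp add: mem_eta)
    moreover from this have "y \<in> carrier X" by (simp add: pi0_rel_def Let_def)
    ultimately show ?thesis
      using pi0_rel_hom[OF X Y t] eta_eq_iff tc x by metis
  qed
  moreover have "x \<in> eta X x" using X x by (simp add: mem_eta) (simp add: pi0_rel_def Let_def)
  ultimately have "(\<Union>y \<in> eta X x. eta Y (t y)) = eta Y (t x)" by blast
  then show ?thesis using eta_in[OF x] by (simp add: pi0_map_def)
qed

text \<open>Paths lift along an extension, so that the comparison map to the pullback of a trivial
  extension is always surjective. Injectivity says that a path of \<open>X\<close> whose image is a loop is a
  loop.\<close>

lemma trivial_extension_iff:
  assumes X: "rack X" and Y: "rack Y"
  shows "trivial_extension X Y t \<longleftrightarrow> extension X Y t \<and>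
    (\<forall>x y. (x, y) \<in> pi0_rel X \<longrightarrow> t x = t y \<longrightarrow> x = y)"
proof -
  interpret X: rack X by fact
  interpret Y: rack Y by fact
  let ?m = "\<lambda>x \<in> carrier X. (t x, eta X x)"
  let ?Q = "pullback_rack Y (eta Y) (set_rack (pi0 X)) (pi0_map X Y t)"
  have "?m \<in> rack_iso X ?Q \<longleftrightarrow> (\<forall>x y. (x, y) \<in> pi0_rel X \<longrightarrow> t x = t y \<longrightarrow> x = y)"
    if e: "extension X Y t"
  proof -
    have t: "t \<in> rack_hom X Y" and surj: "t ` carrier X = carrier Y" using e by (auto simp: extension_def)
    have tc: "x \<in> carrier X \<Longrightarrow> t x \<in> carrier Y" for x using t by (auto simp: rack_hom_def)
    have eta_op: "eta X (x \<triangleleft>\<^bsub>X\<^esub> a) = eta X x" "eta X (x \<triangleleft>\<inverse>\<^bsub>X\<^esub> a) = eta X x"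
      if "x \<in> carrier X" "a \<in> carrier X" for x a
      using that pi0_rel_step[OF X that, of True] pi0_rel_step[OF X that, of False]
        eta_eq_iff[of _ X, THEN iffD2, symmetric]
      by (simp_all add: X.rop_closed X.rinv_closed)
    have "?m x \<in> carrier ?Q" if "x \<in> carrier X" for x
      using that tc by (simp add: pullback_rack_def set_rack_def eta_in pi0_map_eta[OF X Y t])
    moreover have "?m (x \<triangleleft>\<^bsub>X\<^esub> y) = ?m x \<triangleleft>\<^bsub>?Q\<^esub> ?m y" "?m (x \<triangleleft>\<inverse>\<^bsub>X\<^esub> y) = ?m x \<triangleleft>\<inverse>\<^bsub>?Q\<^esub> ?m y"
      if "x \<in> carrier X" "y \<in> carrier X" for x y
      using that t eta_op[OF that]
      by (simp_all add: pullback_rack_def set_rack_def rack_hom_def X.rop_closed X.rinv_closed)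
    ultimately have m: "?m \<in> rack_hom X ?Q"
      unfolding rack_hom_def by (intro CollectI conjI ballI PiE_I) (simp_all only:, simp)
    have "carrier ?Q \<subseteq> ?m ` carrier X"
    proof
      fix q assume "q \<in> carrier ?Q"
      then obtain y c where q: "q = (y, c)" "y \<in> carrier Y" "c \<in> pi0 X" "eta Y y = pi0_map X Y t c"
        by (auto simp: pullback_rack_def set_rack_def)
      obtain x where x: "x \<in> carrier X" "c = eta X x" using q(3) by (rule pi0E)
      have "(t x, y) \<in> pi0_rel Y"
        using q x pi0_map_eta[OF X Y t x(1)] eta_eq_iff[OF tc[OF x(1)] q(2)] by simp
      then obtain g where g: "g \<in> carrier (Pth Y)" "y = path_act Y (t x) g"
        by (auto simp: pi0_rel_iff[OF Y])
      have "\<exists>x'. (x, x') \<in> pi0_rel X \<and> t x' = path_act Y (t x) g"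
        using g(1)
      proof (induction rule: Y.Pth_induct)
        case one
        then show ?case
          using x tc by (intro exI[of _ x]) (simp add: Y.path_act_one, simp add: pi0_rel_def Let_def)
      next
        case (letter g b i)
        then obtain x' where x': "(x, x') \<in> pi0_rel X" "t x' = path_act Y (t x) g" by blast
        obtain a where a: "a \<in> carrier X" "t a = b" using surj letter.hyps(2) by (metis imageE)
        have c: "x' \<in> carrier X" using x'(1) by (rule pi0_rel_carrier)
        have "(x, rack_step X i x' a) \<in> pi0_rel X"
          by (rule pi0_rel_trans[OF x'(1) pi0_rel_step[OF X c a(1)]])
        moreover have "t (rack_step X i x' a) = path_act Y (t x) (g \<otimes>\<^bsub>Pth Y\<^esub> letter Y b i)"
          using t c a x' letter.hyps tc[OF x(1)]
          by (simp add: rack_hom_def rack_step_def Y.path_act_mult Y.path_act_letter Y.letter_in Y.path_act_closed)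
        ultimately show ?case by blast
      qed
      then obtain x' where x': "(x, x') \<in> pi0_rel X" "t x' = y" using g by auto
      then have "x' \<in> carrier X" by (simp add: pi0_rel_def Let_def)
      moreover from this have "?m x' = q" using x x' q eta_eq_iff[of x X x'] by simp
      ultimately show "q \<in> ?m ` carrier X" by blast
    qed
    moreover have "?m ` carrier X \<subseteq> carrier ?Q" using m by (auto simp: rack_hom_def)
    ultimately have "?m \<in> rack_iso X ?Q \<longleftrightarrow> inj_on ?m (carrier X)"
      using m by (auto simp: rack_iso_def bij_betw_def)
    also have "\<dots> \<longleftrightarrow> (\<forall>x y. (x, y) \<in> pi0_rel X \<longrightarrow> t x = t y \<longrightarrow> x = y)"
    proof -
      have "(x, y) \<in> pi0_rel X \<Longrightarrow> x \<in> carrier X \<and> y \<in> carrier X" for x y by (simp add: pi0_rel_def Let_def)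
      then show ?thesis unfolding inj_on_def by (auto simp: eta_eq_iff)
    qed
    finally show ?thesis .
  qed
  then show ?thesis unfolding trivial_extension_def is_pullback_def by blast
qed

section \<open>Central extensions are coverings\<close>

lemma rack_hom_compose:
  assumes "rack X" "h \<in> rack_hom X Y" "k \<in> rack_hom Y Z"
  shows "compose (carrier X) k h \<in> rack_hom X Z"
proof -
  have "x \<in> carrier X \<Longrightarrow> h x \<in> carrier Y" for x using assms(2) by (auto simp: rack_hom_def)
  then show ?thesis
    using assms(2,3) rack.rop_closed[OF assms(1)] rack.rinv_closed[OF assms(1)]
    by (auto simp: rack_hom_def compose_def)
qed

lemma rack_pullback:
  assumes "rack X" "rack Y" "h \<in> rack_hom X Z" "k \<in> rack_hom Y Z"
  shows "rack (pullback_rack X h Y k)"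
proof -
  interpret X: rack X by fact
  interpret Y: rack Y by fact
  show ?thesis
    using assms(3,4)
    by unfold_locales
      (auto simp: pullback_rack_def rack_hom_def X.rop_closed Y.rop_closed X.rinv_closed Y.rinv_closed
        X.rop_rinv Y.rop_rinv X.rinv_rop Y.rinv_rop intro: X.rop_distrib Y.rop_distrib)
qed

lemma pullback_projections:
  assumes "rack X" "rack Y" "h \<in> rack_hom X Z" "k \<in> rack_hom Y Z"
  shows "restrict fst (carrier (pullback_rack X h Y k)) \<in> rack_hom (pullback_rack X h Y k) X"
    "restrict snd (carrier (pullback_rack X h Y k)) \<in> rack_hom (pullback_rack X h Y k) Y"
proof -
  interpret rack "pullback_rack X h Y k" by (rule rack_pullback[OF assms])
  show "restrict fst (carrier (pullback_rack X h Y k)) \<in> rack_hom (pullback_rack X h Y k) X"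
    "restrict snd (carrier (pullback_rack X h Y k)) \<in> rack_hom (pullback_rack X h Y k) Y"
    unfolding rack_hom_def using rop_closed rinv_closed
    by (simp_all add: Pi_iff) (simp_all add: pullback_rack_def case_prod_unfold)
qed

text \<open>If \<open>y\<close> and \<open>y'\<close> have the same image, then \<open>x \<triangleleft> y\<close> and \<open>x \<triangleleft> y'\<close> lie in the component of \<open>x\<close>. So a trivial
  pullback is a covering; and being a covering descends from the pullback to \<open>f\<close>.\<close>

lemma covering_if_pullback_trivial:
  assumes B: "rack B" and A: "rack A" and E: "rack E" and f: "extension B A f" and e: "extension E A e"
    and triv: "trivial_extension (pullback_rack E e B f) E (restrict fst (carrier (pullback_rack E e B f)))"
  shows "covering B A f"
proof -
  interpret B: rack B by fact
  interpret E: rack E by fact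
  let ?Q = "pullback_rack E e B f"
  have eh: "e \<in> rack_hom E A" and fh: "f \<in> rack_hom B A" using e f by (auto simp: extension_def)
  have Q: "rack ?Q" by (rule rack_pullback[OF E B eh fh])
  interpret Q: rack ?Q by fact
  have inj: "p = q" if "(p, q) \<in> pi0_rel ?Q" "fst p = fst q" for p q
    using triv that pi0_rel_carrier[OF that(1)] unfolding trivial_extension_iff[OF Q E]
    by (metis restrict_apply)
  have "x \<triangleleft>\<^bsub>B\<^esub> y = x \<triangleleft>\<^bsub>B\<^esub> y'"
    if "x \<in> carrier B" "y \<in> carrier B" "y' \<in> carrier B" "f y = f y'" for x y y'
  proof -
    have "f x \<in> e ` carrier E" "f y \<in> e ` carrier E"
      using e fh that by (auto simp: extension_def rack_hom_def)
    then obtain u v where uv: "u \<in> carrier E" "e u = f x" "v \<in> carrier E" "e v = f y" by (metis imageE)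
    let ?p = "(u, x)" and ?q = "(v, y)" and ?r = "(v, y')"
    have c: "?p \<in> carrier ?Q" "?q \<in> carrier ?Q" "?r \<in> carrier ?Q"
      using uv that by (auto simp: pullback_rack_def)
    have "(?p \<triangleleft>\<^bsub>?Q\<^esub> ?q, ?p \<triangleleft>\<^bsub>?Q\<^esub> ?r) \<in> pi0_rel ?Q"
      using pi0_rel_trans[OF pi0_rel_sym[OF pi0_rel_step[OF Q c(1,2)]] pi0_rel_step[OF Q c(1,3)], of True True]
      by simp
    then have "?p \<triangleleft>\<^bsub>?Q\<^esub> ?q = ?p \<triangleleft>\<^bsub>?Q\<^esub> ?r" by (rule inj) (simp add: pullback_rack_def)
    then show ?thesis by (simp add: pullback_rack_def)
  qed
  then show ?thesis unfolding covering_def using B A f by blast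
qed

text \<open>A path of the pullback acts on both factors by one and the same path of \<open>A\<close>. The premise \<open>free\<close> is what
  distinguishes the universal covering.\<close>

lemma trivial_pullback_covering:
  assumes EA: "covering_rack E A e" and BA: "covering_rack B A f"
    and free: "\<And>x b g. \<lbrakk>x \<in> carrier E; b \<in> carrier B; e x = f b; g \<in> carrier (Pth A);
      cov_act E e x g = x\<rbrakk> \<Longrightarrow> cov_act B f b g = b"
  shows "trivial_extension (pullback_rack E e B f) E (restrict fst (carrier (pullback_rack E e B f)))"
proof -
  interpret E: covering_rack E A e by fact
  interpret B: covering_rack B A f by fact
  let ?Q = "pullback_rack E e B f"
  let ?fst = "restrict fst (carrier ?Q)" and ?snd = "restrict snd (carrier ?Q)"
  have Q: "rack ?Q" by (rule rack_pullback[OF E.B.rack_axioms B.B.rack_axioms E.f_hom B.f_hom])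
  interpret Q: rack ?Q by fact
  have pr: "?fst \<in> rack_hom ?Q E" "?snd \<in> rack_hom ?Q B"
    using pullback_projections[OF E.B.rack_axioms B.B.rack_axioms E.f_hom B.f_hom] by auto
  define d where "d = compose (carrier ?Q) e ?fst"
  have d: "d \<in> rack_hom ?Q A"
    unfolding d_def by (rule rack_hom_compose[OF Q pr(1) E.f_hom])
  have mem: "p \<in> carrier ?Q \<longleftrightarrow> fst p \<in> carrier E \<and> snd p \<in> carrier B \<and> e (fst p) = f (snd p)" for p
    by (auto simp: pullback_rack_def case_prod_unfold)
  have "carrier E \<subseteq> ?fst ` carrier ?Q"
  proof
    fix x assume x: "x \<in> carrier E"
    then obtain b where "b \<in> carrier B" "f b = e x" using B.f_lift E.f_in by metis
    with x have "(x, b) \<in> carrier ?Q" by (simp add: mem)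
    then show "x \<in> ?fst ` carrier ?Q" by force
  qed
  then have "extension ?Q E ?fst" using pr unfolding extension_def rack_hom_def by blast
  moreover have "p = q" if pq: "(p, q) \<in> pi0_rel ?Q" and eq: "?fst p = ?fst q" for p q
  proof -
    obtain g where g: "p \<in> carrier ?Q" "g \<in> carrier (Pth ?Q)" "q = path_act ?Q p g"
      using pq unfolding pi0_rel_iff[OF Q] by blast
    have q: "q \<in> carrier ?Q" using g by (simp add: Q.path_act_closed)
    let ?g = "Pth_map A d g"
    have "?fst (cov_act ?Q (\<lambda>a \<in> carrier ?Q. a) p g) = cov_act E e (?fst p) ?g"
      using g by (intro cov_act_equivariant[OF covering_id[OF Q] EA pr(1) d]) (auto simp: d_def compose_def)
    moreover have "?snd (cov_act ?Q (\<lambda>a \<in> carrier ?Q. a) p g) = cov_act B f (?snd p) ?g"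
      using g by (intro cov_act_equivariant[OF covering_id[OF Q] BA pr(2) d]) (auto simp: d_def compose_def mem)
    ultimately have "fst q = cov_act E e (fst p) ?g" "snd q = cov_act B f (snd p) ?g"
      using g q by (simp_all add: Q.path_act_cov_act[symmetric])
    moreover have "?g \<in> carrier (Pth A)"
      using Pth_map_hom[OF Q E.A.rack_axioms d] g by (auto simp: hom_def)
    ultimately have "snd q = snd p"
      using free[of "fst p" "snd p" ?g] eq g q by (simp add: mem)
    moreover have "fst p = fst q" using eq g(1) q by simp
    ultimately show "p = q" by (simp add: prod_eq_iff)
  qed
  ultimately show ?thesis unfolding trivial_extension_iff[OF Q E.B.rack_axioms] by blast
qed

subsection \<open>Coding of pairs and words in an infinite type\<close>

lemma infinite_pairing:
  assumes "infinite (UNIV :: 'u set)"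
  shows "\<exists>j :: 'u \<times> 'u \<Rightarrow> 'u. inj j"
proof -
  obtain j where "bij_betw j ((UNIV :: 'u set) \<times> (UNIV :: 'u set)) (UNIV :: 'u set)"
    using card_of_Times_same_infinite[OF assms, THEN card_of_ordIso[THEN iffD2]] by blast
  then show ?thesis by (auto simp: bij_betw_def)
qed

lemma infinite_list_coding:
  assumes "infinite (UNIV :: 'u set)"
  shows "\<exists>c :: 'u list \<Rightarrow> 'u. inj c"
proof -
  obtain j :: "'u \<times> 'u \<Rightarrow> 'u" where j: "inj j" using infinite_pairing[OF assms] by blast
  obtain n :: "nat \<Rightarrow> 'u" where n: "inj n" using infinite_countable_subset[OF assms] by auto
  define c where "c = rec_list (n 0) (\<lambda>x _ r. j (x, r))"
  have c: "c [] = n 0" "c (x # xs) = j (x, c xs)" for x xs by (simp_all add: c_def)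
  have "length xs = length ys \<Longrightarrow> c xs = c ys \<Longrightarrow> xs = ys" for xs ys
    by (induction xs ys rule: list_induct2) (use j in \<open>auto simp: c dest: injD\<close>)
  \<comment> \<open>The length has to be coded along, because the code of the empty list may also be that of a pair.\<close>
  then have "inj (\<lambda>xs. j (n (length xs), c xs))"
    using j n by (auto intro!: injI dest!: injD[OF j] injD[OF n])
  then show ?thesis by blast
qed

lemma infinite_word_coding:
  assumes "infinite (UNIV :: 'u set)"
  shows "\<exists>c :: 'u word \<Rightarrow> 'u. inj c"
proof -
  obtain j :: "'u \<times> 'u \<Rightarrow> 'u" where j: "inj j" using infinite_pairing[OF assms] by blast
  obtain l :: "'u list \<Rightarrow> 'u" where l: "inj l" using infinite_list_coding[OF assms] by blast
  obtain u v :: 'u where uv: "u \<noteq> v" using assms by (metis finite.simps finite_subset subsetI singletonI)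
  have "inj (\<lambda>(x, b). j (x, if b then u else v))"
    using j uv by (auto intro!: injI dest!: injD split: if_splits)
  then have "inj (l \<circ> map (\<lambda>(x, b). j (x, if b then u else v)))"
    using l by (intro inj_compose) auto
  then show ?thesis by blast
qed

definition word_code :: "'u word \<Rightarrow> 'u" where
  "word_code = (SOME c. inj c)"

lemma inj_word_code: "infinite (UNIV :: 'u set) \<Longrightarrow> inj (word_code :: 'u word \<Rightarrow> 'u)"
  unfolding word_code_def by (rule someI_ex[OF infinite_word_coding])

definition pairing :: "'u \<times> 'u \<Rightarrow> 'u" where
  "pairing = (SOME j. inj j)"

definition unpair :: "'u \<Rightarrow> 'u \<times> 'u" where
  "unpair = inv_into UNIV pairing"

lemma inj_pairing: "infinite (UNIV :: 'u set) \<Longrightarrow> inj (pairing :: 'u \<times> 'u \<Rightarrow> 'u)"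
  unfolding pairing_def by (rule someI_ex[OF infinite_pairing])

subsection \<open>The covering of a functor\<close>

context path_theory
begin

text \<open>The rack operation of the covering moves the second coordinate along a generator, which need not lie
  in \<open>P A\<close>; so the action of \<open>P A\<close> is first extended along the retraction.\<close>

definition path_map ::
  "'u rack \<Rightarrow> 'u set_functor \<Rightarrow>
   'u \<Rightarrow> 'u word set \<Rightarrow> 'u \<Rightarrow> 'u" where
  "path_map A F a g = arrow_map F (a, retr A a g)"

definition total :: "'u rack \<Rightarrow> 'u set_functor \<Rightarrow> 'u rack" where
  "total A F = (let step = (\<lambda>i x y. let (a, s) = unpair x; (b, t) = unpair y in
      pairing (rack_step A i a b, path_map A F a (letter A b i) s)) in
    \<lparr>carrier = {pairing (a, s) | a s. a \<in> carrier A \<and> s \<in> fobj F a}, rop = step True, rinv = step False\<rparr>)"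

definition proj ::
  "'u rack \<Rightarrow> 'u set_functor \<Rightarrow> 'u \<Rightarrow> 'u" where
  "proj A F = (\<lambda>x \<in> carrier (total A F). fst (unpair x))"

lemma path_map:
  assumes A: "K A" and F: "F \<in> functors (fund_gpd P A) (set_cat \<S>)"
    and a: "a \<in> carrier A" and s: "s \<in> fobj F a"
  shows path_map_closed: "g \<in> carrier (Pth A) \<Longrightarrow> path_map A F a g s \<in> fobj F (path_act A a g)"
    and path_map_one: "path_map A F a \<one>\<^bsub>Pth A\<^esub> s = s"
    and path_map_mult: "g \<in> carrier (Pth A) \<Longrightarrow> h \<in> carrier (Pth A) \<Longrightarrow>
      path_map A F a (g \<otimes>\<^bsub>Pth A\<^esub> h) s = path_map A F (path_act A a g) h (path_map A F a g s)"
proof -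
  interpret rack A using A by (rule K_rack)
  show "path_map A F a g s \<in> fobj F (path_act A a g)" if g: "g \<in> carrier (Pth A)"
    using arrow_map_closed[OF F, of "(a, retr A a g)" s] a s g
    by (simp add: path_map_def retr_in[OF A] path_act_retr[OF A])
  show "path_map A F a \<one>\<^bsub>Pth A\<^esub> s = s"
    using arrow_map_Idn[OF F, of a s] a s by (simp add: path_map_def retr_one[OF A])
  show "path_map A F a (g \<otimes>\<^bsub>Pth A\<^esub> h) s = path_map A F (path_act A a g) h (path_map A F a g s)"
    if g: "g \<in> carrier (Pth A)" and h: "h \<in> carrier (Pth A)"
    using arrow_map_Cmp[OF F, of "(a, retr A a g)" "(path_act A a g, retr A (path_act A a g) h)" s] a s g h
    by (simp add: path_map_def retr_mult[OF A] retr_in[OF A] path_act_retr[OF A] path_act_closed)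
qed

context
  fixes A and F :: "'u set_functor" and \<S>
  assumes inf: "infinite (UNIV :: 'u set)" and A: "K A"
    and F: "F \<in> functors (fund_gpd P A) (set_cat \<S>)"
    and ne: "\<And>a. a \<in> carrier A \<Longrightarrow> fobj F a \<noteq> {}"
begin

interpretation A: rack A using A by (rule K_rack)
interpretation G: group "Pth A" by (rule A.group_Pth)

lemma pairing_eq_iff: "pairing (a, s) = pairing (b, t) \<longleftrightarrow> a = b \<and> (s :: 'u) = t"
  using inj_pairing[OF inf] by (auto dest: injD)

lemma unpair_pairing: "unpair (pairing p) = (p :: 'u \<times> 'u)"
  using inj_pairing[OF inf] by (simp add: unpair_def)

lemma mem_total: "pairing (a, s) \<in> carrier (total A F) \<longleftrightarrow> a \<in> carrier A \<and> s \<in> fobj F a"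
  by (auto simp: total_def Let_def pairing_eq_iff)

lemma totalE: assumes "x \<in> carrier (total A F)"
  obtains a s where "x = pairing (a, s)" "a \<in> carrier A" "s \<in> fobj F a"
  using assms by (auto simp: total_def Let_def)

lemma total_step: "rack_step (total A F) i (pairing (a, s)) (pairing (b, t)) =
    pairing (rack_step A i a b, path_map A F a (letter A b i) s)"
  by (cases i) (simp_all add: total_def unpair_pairing)

lemmas total_rop = total_step[where i = True, simplified]

lemma proj_pairing: "a \<in> carrier A \<Longrightarrow> s \<in> fobj F a \<Longrightarrow> proj A F (pairing (a, s)) = a"
  by (simp add: proj_def mem_total unpair_pairing)

text \<open>Self-distributivity comes from the relation \<open>c (b \<triangleleft> c) = b c\<close> between generators.\<close>

lemma rack_total: "rack (total A F)"
proof
  have step: "path_map A F a (letter A b i) s \<in> fobj F (rack_step A i a b)"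
    if "a \<in> carrier A" "s \<in> fobj F a" "b \<in> carrier A" for a s b i
    using path_map_closed[OF A F that(1,2), of "letter A b i"] that by (simp add: A.letter_in A.path_act_letter)
  fix x y assume "x \<in> carrier (total A F)" "y \<in> carrier (total A F)"
  then obtain a s b t where x: "x = pairing (a, s)" "a \<in> carrier A" "s \<in> fobj F a"
    and y: "y = pairing (b, t)" "b \<in> carrier A" "t \<in> fobj F b"
    by (metis totalE)
  have "rack_step (total A F) i x y \<in> carrier (total A F)" for i
    using x y by (simp add: total_step mem_total step A.step_closed)
  from this[of True] this[of False]
  show "x \<triangleleft>\<^bsub>total A F\<^esub> y \<in> carrier (total A F)" "x \<triangleleft>\<inverse>\<^bsub>total A F\<^esub> y \<in> carrier (total A F)" by simp_all
  have "rack_step (total A F) (\<not> i) (rack_step (total A F) i x y) y = x" for i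
  proof -
    have "letter A b i \<otimes>\<^bsub>Pth A\<^esub> letter A b (\<not> i) = \<one>\<^bsub>Pth A\<^esub>"
      using G.r_inv[OF A.letter_in[OF y(2)]] A.inv_letter[OF y(2)] by simp
    then show ?thesis
      using x y path_map_mult[OF A F x(2,3), of "letter A b i" "letter A b (\<not> i)"] path_map_one[OF A F x(2,3)]
      by (simp add: total_step pairing_eq_iff A.step_inverse A.letter_in A.path_act_letter)
  qed
  from this[of True] this[of False]
  show "(x \<triangleleft>\<^bsub>total A F\<^esub> y) \<triangleleft>\<inverse>\<^bsub>total A F\<^esub> y = x" "(x \<triangleleft>\<inverse>\<^bsub>total A F\<^esub> y) \<triangleleft>\<^bsub>total A F\<^esub> y = x" by simp_all
  fix z assume "z \<in> carrier (total A F)"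
  then obtain c u where z: "z = pairing (c, u)" "c \<in> carrier A" "u \<in> fobj F c" by (rule totalE)
  have "gen A c \<otimes>\<^bsub>Pth A\<^esub> gen A (b \<triangleleft>\<^bsub>A\<^esub> c) = gen A b \<otimes>\<^bsub>Pth A\<^esub> gen A c"
    using y z A.gen_step[of b c True] by (simp add: A.letter_in G.m_assoc[symmetric])
  then show "(x \<triangleleft>\<^bsub>total A F\<^esub> y) \<triangleleft>\<^bsub>total A F\<^esub> z =
      (x \<triangleleft>\<^bsub>total A F\<^esub> z) \<triangleleft>\<^bsub>total A F\<^esub> (y \<triangleleft>\<^bsub>total A F\<^esub> z)"
    using x y z path_map_mult[OF A F x(2,3), of "gen A b" "gen A c"]
      path_map_mult[OF A F x(2,3), of "gen A c" "gen A (b \<triangleleft>\<^bsub>A\<^esub> c)"]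
    by (simp add: total_rop pairing_eq_iff A.rop_distrib[OF x(2) y(2) z(2)] A.letter_in A.rop_closed A.path_act_letter)
qed

lemma covering_total: "covering_rack (total A F) A (proj A F)"
proof -
  interpret T: rack "total A F" by (rule rack_total)
  have "proj A F \<in> rack_hom (total A F) A"
    unfolding rack_hom_def
  proof (intro CollectI conjI ballI)
    show "proj A F \<in> carrier (total A F) \<rightarrow>\<^sub>E carrier A"
      by (auto simp: proj_def unpair_pairing elim!: totalE)
    fix x y assume xy: "x \<in> carrier (total A F)" "y \<in> carrier (total A F)"
    obtain a s b t where "x = pairing (a, s)" "a \<in> carrier A" "s \<in> fobj F a"
      "y = pairing (b, t)" "b \<in> carrier A" "t \<in> fobj F b"
      using xy by (metis totalE)
    then have "proj A F (rack_step (total A F) i x y) = rack_step A i (proj A F x) (proj A F y)" for i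
      using T.step_closed[OF xy, of i] by (simp add: proj_pairing total_step mem_total)
    from this[of True] this[of False]
    show "proj A F (x \<triangleleft>\<^bsub>total A F\<^esub> y) = proj A F x \<triangleleft>\<^bsub>A\<^esub> proj A F y"
      "proj A F (x \<triangleleft>\<inverse>\<^bsub>total A F\<^esub> y) = proj A F x \<triangleleft>\<inverse>\<^bsub>A\<^esub> proj A F y" by simp_all
  qed
  moreover have "carrier A \<subseteq> proj A F ` carrier (total A F)"
  proof
    fix a assume a: "a \<in> carrier A"
    then obtain s where s: "s \<in> fobj F a" using ne by blast
    have "a = proj A F (pairing (a, s))" using a s by (simp add: proj_pairing)
    then show "a \<in> proj A F ` carrier (total A F)" using a s mem_total by blast
  qed
  ultimately have "extension (total A F) A (proj A F)" by (auto simp: extension_def rack_hom_def)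
  then show ?thesis
    by unfold_locales (auto elim!: totalE simp: proj_pairing total_rop)
qed

text \<open>By induction on the path: a letter \<open>b\<close> lifts to any element over \<open>b\<close>, and operates as prescribed in
  \<open>total_step\<close>.\<close>

lemma cov_act_total:
  assumes a: "a \<in> carrier A" and s: "s \<in> fobj F a" and g: "g \<in> carrier (Pth A)"
  shows "cov_act (total A F) (proj A F) (pairing (a, s)) g = pairing (path_act A a g, path_map A F a g s)"
  using g
proof (induction rule: A.Pth_induct)
  interpret T: covering_rack "total A F" A "proj A F" by (rule covering_total)
  have x: "pairing (a, s) \<in> carrier (total A F)" using a s by (simp add: mem_total)
  {
    case one
    then show ?case using a s x by (simp add: T.cov_act_one A.path_act_one path_map_one[OF A F])
  next
    case (letter g b i)
    then obtain t where t: "t \<in> fobj F b" using ne by blast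
    have y: "pairing (b, t) \<in> carrier (total A F)" using t letter by (simp add: mem_total)
    have "cov_act (total A F) (proj A F) (cov_act (total A F) (proj A F) (pairing (a, s)) g) (letter A b i) =
        rack_step (total A F) i (cov_act (total A F) (proj A F) (pairing (a, s)) g) (pairing (b, t))"
      using T.cov_act_letter[OF T.cov_act_closed[OF x letter(1)] y] letter t by (simp add: proj_pairing)
    then show ?case
      using letter a s x
      by (simp add: T.cov_act_mult A.path_act_mult path_map_mult[OF A F] A.letter_in total_step
          A.path_act_letter A.path_act_closed)
  }
qed

lemma K_total: "K (total A F)"
proof (rule K_I[OF A rack_total])
  fix x assume r: "\<And>a. a \<in> carrier A \<Longrightarrow> retr A a (gen A a) = \<one>\<^bsub>Pth A\<^esub>" and "x \<in> carrier (total A F)"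
  then obtain a s where x: "x = pairing (a, s)" "a \<in> carrier A" "s \<in> fobj F a" using totalE by blast
  have "a \<triangleleft>\<^bsub>A\<^esub> a = a"
    using path_act_retr[OF A x(2) A.letter_in[OF x(2), of True]] x
    by (simp add: r A.path_act_one A.path_act_letter)
  moreover have "path_map A F a (gen A a) s = s"
    using path_map_one[OF A F x(2,3)] x(2) by (simp add: path_map_def r retr_one[OF A])
  ultimately show "x \<triangleleft>\<^bsub>total A F\<^esub> x = x" using x by (simp add: total_rop)
qed

end

subsection \<open>The universal covering\<close>

text \<open>The coproduct of all representable functors: the value at \<open>b\<close> is the set of all paths to \<open>b\<close>, a path
  being a pair \<open>(a, g)\<close> with \<open>a \<sqdot> g = b\<close>. Every covering becomes trivial when it is pulled back along the
  covering of this functor, because the only path in \<open>P A\<close> that fixes a point of it is the trivial one.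
  The paths have to be coded by elements of the ambient type.\<close>

definition path_code :: "'u \<times> 'u word set \<Rightarrow> 'u" where
  "path_code = (\<lambda>(a, g). pairing (a, word_code (SOME w. w \<in> g)))"

definition paths_to :: "'u rack \<Rightarrow> 'u \<Rightarrow> ('u \<times> 'u word set) set" where
  "paths_to A b = {(a, g). a \<in> carrier A \<and> g \<in> carrier (P A) \<and> path_act A a g = b}"

definition univ_functor :: "'u rack \<Rightarrow> 'u set_functor" where
  "univ_functor A = action_functor (fund_gpd P A) (\<lambda>b. path_code ` paths_to A b)
    (\<lambda>(b, k) s. let (a, g) = inv_into (carrier A \<times> carrier (P A)) path_code s in path_code (a, g \<otimes>\<^bsub>Pth A\<^esub> k))"

context
  fixes A
  assumes inf: "infinite (UNIV :: 'u set)" and A: "K A"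
begin

interpretation A: rack A using A by (rule K_rack)
interpretation G: group "Pth A" by (rule A.group_Pth)

lemma inj_path_code: "inj_on path_code (carrier A \<times> carrier (P A))"
proof (rule inj_onI, clarify)
  fix a g a' g' assume g: "g \<in> carrier (P A)" "g' \<in> carrier (P A)"
    and eq: "path_code (a, g) = path_code (a', g')"
  obtain w where w: "w \<in> words A" "g = path_class A w" using P_Pth[OF A g(1)] by (rule A.path_classE)
  obtain w' where w': "w' \<in> words A" "g' = path_class A w'" using P_Pth[OF A g(2)] by (rule A.path_classE)
  have "w \<in> g" "w' \<in> g'" using w w' by (simp_all add: A.mem_path_class path_rel.refl)
  then have "(SOME w. w \<in> g) \<in> g" "(SOME w. w \<in> g') \<in> g'" by (metis someI)+
  moreover have "a = a'" "(SOME w. w \<in> g) = (SOME w. w \<in> g')"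
    using eq inj_pairing[OF inf] inj_word_code[OF inf] by (auto simp: path_code_def dest!: injD[OF inj_pairing[OF inf]] injD[OF inj_word_code[OF inf]])
  ultimately have "(w, w') \<in> path_rel A"
    using w w' by (metis A.mem_path_class path_rel.sym path_rel.trans)
  then show "a = a' \<and> g = g'" using w w' \<open>a = a'\<close> by (simp add: A.path_class_eq_iff)
qed

lemma decode_path:
  "a \<in> carrier A \<Longrightarrow> g \<in> carrier (P A) \<Longrightarrow> inv_into (carrier A \<times> carrier (P A)) path_code (path_code (a, g)) = (a, g)"
  by (rule inv_into_f_f[OF inj_path_code]) simp

lemma univ_functor_in: "univ_functor A \<in> functors (fund_gpd P A) (set_cat nonempty_sets)"
  unfolding univ_functor_def
proof (rule action_functor_in[OF category_fund_gpd[OF A]])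
  fix b assume "b \<in> Obj (fund_gpd P A)"
  then have "(b, \<one>\<^bsub>Pth A\<^esub>) \<in> paths_to A b" by (simp add: paths_to_def P_one[OF A] A.path_act_one)
  then show "path_code ` paths_to A b \<in> nonempty_sets" by blast
qed (auto simp: paths_to_def decode_path P_mult[OF A] P_one[OF A] P_Pth[OF A] A.path_act_mult
    G.m_assoc)

lemma univ_functor_act:
  assumes "a \<in> carrier A" "g \<in> carrier (P A)" "k \<in> carrier (P A)"
  shows "arrow_map (univ_functor A) (path_act A a g, k) (path_code (a, g)) = path_code (a, g \<otimes>\<^bsub>Pth A\<^esub> k)"
proof -
  have "path_code (a, g) \<in> path_code ` paths_to A (path_act A a g)"
    using assms by (auto simp: paths_to_def)
  then show ?thesis
    using assms unfolding univ_functor_def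
    by (subst action_functor_apply(2))
      (simp_all add: A.path_act_closed P_Pth[OF A] decode_path)
qed

end

text \<open>If a path fixes a point of the universal covering over \<open>c\<close>, its retraction at \<open>c\<close> is trivial, and so
  it fixes the points of every covering over \<open>c\<close>; hence \<open>trivial_pullback_covering\<close> applies.\<close>

theorem central_extension_iff:
  assumes inf: "infinite (UNIV :: 'u set)"
  shows "central_extension K B A f \<longleftrightarrow> K B \<and> K A \<and> covering_rack B A f"
proof
  assume "central_extension K B A f"
  then obtain E e where c: "K B" "K A" "extension B A f" "K E" "extension E A e"
    "trivial_extension (pullback_rack E e B f) E (restrict fst (carrier (pullback_rack E e B f)))"
    unfolding central_extension_def by (auto simp: Let_def)
  then show "K B \<and> K A \<and> covering_rack B A f"
    using covering_if_pullback_trivial[of B A E f e] K_rack by (auto simp: covering_rack_iff)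
next
  assume c: "K B \<and> K A \<and> covering_rack B A f"
  then have A: "K A" and KB: "K B" and BA: "covering_rack B A f" by auto
  interpret covering_rack B A f by fact
  note U = univ_functor_in[OF inf A]
  have ne: "fobj (univ_functor A) a \<noteq> {}" if "a \<in> carrier A" for a
    using functor_fobj[OF U] that by auto
  let ?E = "total A (univ_functor A)" and ?e = "proj A (univ_functor A)"
  have E: "covering_rack ?E A ?e" by (rule covering_total[OF inf A U ne])
  have "trivial_extension (pullback_rack ?E ?e B f) ?E (restrict fst (carrier (pullback_rack ?E ?e B f)))"
  proof (rule trivial_pullback_covering[OF E BA])
    fix x b k assume x: "x \<in> carrier ?E" and b: "b \<in> carrier B" "?e x = f b"
      and k: "k \<in> carrier (Pth A)" and fixed: "cov_act ?E ?e x k = x"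
    obtain c s where c: "x = pairing (c, s)" "c \<in> carrier A" "s \<in> fobj (univ_functor A) c"
      using totalE[OF inf A U ne x] by blast
    then obtain a g where s: "s = path_code (a, g)" "a \<in> carrier A" "g \<in> carrier (P A)" "c = path_act A a g"
      by (auto simp: univ_functor_def action_functor_apply paths_to_def)
    have r: "retr A c k \<in> carrier (P A)" using A c k by (simp add: retr_in)
    have "path_code (a, g \<otimes>\<^bsub>Pth A\<^esub> retr A c k) = path_code (a, g)"
      using fixed cov_act_total[OF inf A U ne c(2,3) k] univ_functor_act[OF inf A s(2,3) r] s
      by (simp add: c(1) path_map_def pairing_eq_iff[OF inf A U ne])
    then have "g \<otimes>\<^bsub>Pth A\<^esub> retr A c k = g"
      using inj_onD[OF inj_path_code[OF inf A]] s r P_mult[OF A] by blast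
    then have "retr A c k = \<one>\<^bsub>Pth A\<^esub>"
      using s r P_Pth[OF A] by (metis G.l_cancel_one')
    moreover have "c = f b" using b c proj_pairing[OF inf A U ne] by simp
    ultimately show "cov_act B f b k = b"
      using cov_act_retr[of B A f b k] KB A c b k BA by (simp add: cov_act_one)
  qed
  then show "central_extension K B A f"
    unfolding central_extension_def Let_def
    using KB A ext K_total[OF inf A U ne] covering_rack.ext[OF E] by blast
qed

end

section \<open>The fibre functor\<close>

lemma rack_hom_id: "rack X \<Longrightarrow> (\<lambda>x \<in> carrier X. x) \<in> rack_hom X X"
  by (auto simp: rack_hom_def rack.rop_closed rack.rinv_closed)

lemma rack_hom_in: "h \<in> rack_hom X Y \<Longrightarrow> x \<in> carrier X \<Longrightarrow> h x \<in> carrier Y"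
  and rack_hom_ext: "h \<in> rack_hom X Y \<Longrightarrow> h \<in> extensional (carrier X)"
  by (auto simp: rack_hom_def PiE_def)

text \<open>As \<open>\<triangleleft> y\<close> is bijective, compatibility with its inverse is automatic.\<close>

lemma rack_homI:
  assumes "rack X" "rack Y" and h: "h \<in> carrier X \<rightarrow>\<^sub>E carrier Y"
    and hom: "\<And>x y. x \<in> carrier X \<Longrightarrow> y \<in> carrier X \<Longrightarrow> h (x \<triangleleft>\<^bsub>X\<^esub> y) = h x \<triangleleft>\<^bsub>Y\<^esub> h y"
  shows "h \<in> rack_hom X Y"
proof -
  interpret X: rack X by fact
  interpret Y: rack Y by fact
  have "h (x \<triangleleft>\<inverse>\<^bsub>X\<^esub> y) = h x \<triangleleft>\<inverse>\<^bsub>Y\<^esub> h y" if xy: "x \<in> carrier X" "y \<in> carrier X" for x y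
  proof -
    have c: "h (x \<triangleleft>\<inverse>\<^bsub>X\<^esub> y) \<in> carrier Y" "h y \<in> carrier Y" using h xy X.rinv_closed by blast+
    have "h x = h (x \<triangleleft>\<inverse>\<^bsub>X\<^esub> y) \<triangleleft>\<^bsub>Y\<^esub> h y"
      using hom[of "x \<triangleleft>\<inverse>\<^bsub>X\<^esub> y" y] xy by (simp add: X.rinv_closed X.rinv_rop)
    then show ?thesis using c by (simp add: Y.rop_rinv)
  qed
  then show ?thesis using h hom by (auto simp: rack_hom_def)
qed

lemma path_act_Pth_map:
  assumes "rack A'" "rack A" "h \<in> rack_hom A' A" "a \<in> carrier A'" "g \<in> carrier (Pth A')"
  shows "path_act A (h a) (Pth_map A h g) = h (path_act A' a g)"
proof -
  have "h (cov_act A' (\<lambda>a \<in> carrier A'. a) a g) = cov_act A (\<lambda>a \<in> carrier A. a) (h a) (Pth_map A h g)"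
    using assms rack_hom_in[OF assms(3)]
    by (intro cov_act_equivariant[OF covering_id covering_id assms(3,3)]) auto
  moreover have "Pth_map A h g \<in> carrier (Pth A)"
    using Pth_map_hom[OF assms(1-3)] assms(5) by (auto simp: hom_def)
  ultimately show ?thesis
    using assms rack_hom_in[OF assms(3)] by (simp add: rack.path_act_cov_act)
qed

lemma Pth_map_one:
  assumes "rack A'" "rack A" "h \<in> rack_hom A' A"
  shows "Pth_map A h \<one>\<^bsub>Pth A'\<^esub> = \<one>\<^bsub>Pth A\<^esub>"
  by (rule hom_one[OF Pth_map_hom[OF assms] rack.group_Pth[OF assms(1)] rack.group_Pth[OF assms(2)]])

lemma CExt_concrete: "CExt K A = concrete_cat {p. central_extension K (fst p) A (snd p)} (\<lambda>p. carrier (fst p))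
    (\<lambda>p q. {k \<in> rack_hom (fst p) (fst q). \<forall>b \<in> carrier (fst p). snd q (k b) = snd p b})"
  by (auto simp: CExt_def concrete_cat_def rack_hom_def)

lemma CExt_Obj_iff [simp]: "p \<in> Obj (CExt K A) \<longleftrightarrow> central_extension K (fst p) A (snd p)"
  by (simp add: CExt_concrete concrete_cat_simps)

lemmas CExt_simps [simp] = concrete_cat_simps(2-5)[of "{p. central_extension K (fst p) A (snd p)}"
    "\<lambda>p. carrier (fst p)" "\<lambda>p q. {k \<in> rack_hom (fst p) (fst q). \<forall>b \<in> carrier (fst p). snd q (k b) = snd p b}",
    folded CExt_concrete] for K A

lemma CExt_Arr_iff:
  "(p, k, q) \<in> Arr (CExt K A) \<longleftrightarrow> p \<in> Obj (CExt K A) \<and> q \<in> Obj (CExt K A) \<and>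
    k \<in> rack_hom (fst p) (fst q) \<and> (\<forall>b \<in> carrier (fst p). snd q (k b) = snd p b)"
  by (auto simp: CExt_concrete concrete_cat_simps rack_hom_def)

lemma category_CExt:
  assumes "\<And>B. K B \<Longrightarrow> rack B"
  shows "category (CExt K A)"
  unfolding CExt_concrete
  by (rule category_concrete_cat)
    (auto simp: central_extension_def assms rack_hom_id rack_hom_compose rack_hom_in compose_eq)

definition fibre :: "'u over \<Rightarrow> 'u \<Rightarrow> 'u set" where
  "fibre p a = {b \<in> carrier (fst p). snd p b = a}"

abbreviation "reps P A \<equiv> functor_cat (fund_gpd P A) (set_cat nonempty_sets)"

context path_theory
begin

definition fib_functor :: "'u rack \<Rightarrow> 'u over \<Rightarrow> 'u set_functor" where
  "fib_functor A p = action_functor (fund_gpd P A) (fibre p) (\<lambda>(a, g) b. cov_act (fst p) (snd p) b g)"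

definition fib_nattrans ::
  "'u rack \<Rightarrow> 'u over \<Rightarrow> 'u rack \<Rightarrow> 'u over \<Rightarrow> ('u \<Rightarrow> 'u) \<Rightarrow> ('u \<Rightarrow> 'u) \<Rightarrow> 'u set_nattrans" where
  "fib_nattrans A' p' A p h k = (fib_functor A' p',
    \<lambda>a \<in> carrier A'. (fibre p' a, restrict k (fibre p' a), fibre p (h a)),
    comp_functor (fund_gpd P A') (fib_functor A p) (fund_gpd_map P A' A h))"

definition Fib :: "'u rack \<Rightarrow> 'u CExt_functor" where
  "Fib A = \<lparr>fobj = (\<lambda>p \<in> Obj (CExt K A). fib_functor A p),
    farr = (\<lambda>(p, k, q) \<in> Arr (CExt K A). fib_nattrans A p A q (\<lambda>a \<in> carrier A. a) k)\<rparr>"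

context
  assumes inf: "infinite (UNIV :: 'u set)"
begin

lemma CExt_covering:
  assumes "p \<in> Obj (CExt K A)"
  shows "covering_rack (fst p) A (snd p)" "K (fst p)" "K A"
  using assms central_extension_iff[OF inf] by auto

lemma fib_functor_obj: "a \<in> carrier A \<Longrightarrow> fobj (fib_functor A p) a = fibre p a"
  and fib_functor_act: "a \<in> carrier A \<Longrightarrow> g \<in> carrier (P A) \<Longrightarrow> b \<in> fibre p a \<Longrightarrow>
      arrow_map (fib_functor A p) (a, g) b = cov_act (fst p) (snd p) b g"
  by (simp_all add: fib_functor_def action_functor_apply)

lemma fib_functor_in:
  assumes p: "p \<in> Obj (CExt K A)"
  shows "fib_functor A p \<in> functors (fund_gpd P A) (set_cat nonempty_sets)"
proof -
  note A = CExt_covering(3)[OF p]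
  interpret covering_rack "fst p" A "snd p" by (rule CExt_covering(1)[OF p])
  show ?thesis
    unfolding fib_functor_def
  proof (rule action_functor_in[OF category_fund_gpd[OF A]])
    fix a assume "a \<in> Obj (fund_gpd P A)"
    then show "fibre p a \<in> nonempty_sets" using f_lift[of a] by (auto simp: fibre_def)
  qed (auto simp: fibre_def P_Pth[OF A] f_cov_act cov_act_closed cov_act_one cov_act_mult)
qed

lemma fund_gpd_map_in:
  assumes A': "K A'" and A: "K A" and h: "h \<in> rack_hom A' A"
  shows "fund_gpd_map P A' A h \<in> functors (fund_gpd P A') (fund_gpd P A)"
proof -
  note r = K_rack[OF A'] K_rack[OF A]
  interpret A': rack A' by (rule r)
  interpret G': group "Pth A'" by (rule A'.group_Pth)
  have "Pth_map A h (g \<otimes>\<^bsub>Pth A'\<^esub> g') = Pth_map A h g \<otimes>\<^bsub>Pth A\<^esub> Pth_map A h g'"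
    if "g \<in> carrier (P A')" "g' \<in> carrier (P A')" for g g'
    using Pth_map_hom[OF r h] that P_Pth[OF A'] by (auto simp: hom_def)
  then show ?thesis
    unfolding functors_def
    by (auto simp: fund_gpd_map_def rack_hom_in[OF h] Pth_map_P[OF A' A h] path_act_Pth_map[OF r h]
        P_Pth[OF A'] A'.path_act_closed Pth_map_one[OF r h] P_one[OF A'] P_mult[OF A'])
qed

lemma fund_gpd_map_id: "K A \<Longrightarrow> fund_gpd_map P A A (\<lambda>a \<in> carrier A. a) = id_functor (fund_gpd P A)"
  using Pth_map_id[OF K_rack[of A]] P_Pth[of A]
  by (auto simp: fund_gpd_map_def id_functor_def intro!: restrict_ext)

lemma fund_gpd_map_comp:
  assumes "K A''" "K A'" "K A" and h': "h' \<in> rack_hom A'' A'" and h: "h \<in> rack_hom A' A"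
  shows "comp_functor (fund_gpd P A'') (fund_gpd_map P A' A h) (fund_gpd_map P A'' A' h') =
    fund_gpd_map P A'' A (compose (carrier A'') h h')"
  using Pth_map_comp[OF K_rack[OF assms(1)] K_rack[OF assms(2)] K_rack[OF assms(3)] h' h
      rack_hom_compose[OF K_rack[OF assms(1)] h' h]] P_Pth[OF assms(1)] Pth_map_P[OF assms(1,2) h']
    rack_hom_in[OF h']
  by (auto simp: fund_gpd_map_def comp_functor_def compose_def fun_eq_iff)

text \<open>A square of coverings restricts to maps between the fibres, and these commute with the actions
  of paths because morphisms of coverings do.\<close>

lemma fib_nattrans_in:
  assumes p': "p' \<in> Obj (CExt K A')" and p: "p \<in> Obj (CExt K A)"
    and sq: "base_change_square A' p' A p h k"
  shows "fib_nattrans A' p' A p h k \<in> Arr (reps P A')"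
proof -
  note A' = CExt_covering(3)[OF p'] and A = CExt_covering(3)[OF p]
  interpret X: covering_rack "fst p'" A' "snd p'" by (rule CExt_covering(1)[OF p'])
  interpret Y: covering_rack "fst p" A "snd p" by (rule CExt_covering(1)[OF p])
  have h: "h \<in> rack_hom A' A" and k: "k \<in> rack_hom (fst p') (fst p)"
    and c: "\<And>b. b \<in> carrier (fst p') \<Longrightarrow> snd p (k b) = h (snd p' b)"
    using sq by (auto simp: base_change_square_def)
  have kf: "k b \<in> fibre p (h a)" if "b \<in> fibre p' a" for a b
    using that rack_hom_in[OF k] c by (auto simp: fibre_def)
  let ?H = "comp_functor (fund_gpd P A') (fib_functor A p) (fund_gpd_map P A' A h)"
  have H: "fobj ?H a = fibre p (h a)" if "a \<in> carrier A'" for a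
    using that by (simp add: comp_functor_apply fund_gpd_map_def fib_functor_obj rack_hom_in[OF h])
  have H_act: "arrow_map ?H (a, g) c = cov_act (fst p) (snd p) c (Pth_map A h g)"
    if "a \<in> carrier A'" "g \<in> carrier (P A')" "c \<in> fibre p (h a)" for a g c
    using that fib_functor_act[of "h a" A "Pth_map A h g" c p]
    by (simp add: arrow_map_def comp_functor_apply fund_gpd_map_def rack_hom_in[OF h] Pth_map_P[OF A' A h])
  have "(fib_functor A' p', \<lambda>a \<in> Obj (fund_gpd P A'). (fobj (fib_functor A' p') a, restrict k (fibre p' a),
      fobj ?H a), ?H) \<in> Arr (reps P A')"
  proof (rule set_nattransI[OF category_fund_gpd[OF A'] fib_functor_in[OF p'] comp_functor_in[OF
        category_fund_gpd[OF A'] fib_functor_in[OF p] fund_gpd_map_in[OF A' A h]]])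
    fix a assume "a \<in> Obj (fund_gpd P A')"
    then show "restrict k (fibre p' a) \<in> fobj (fib_functor A' p') a \<rightarrow>\<^sub>E fobj ?H a"
      using kf by (simp add: fib_functor_obj H restrict_PiE_iff)
  next
    fix m b assume "m \<in> Arr (fund_gpd P A')" "b \<in> fobj (fib_functor A' p') (Src (fund_gpd P A') m)"
    then obtain a g where m: "m = (a, g)" "a \<in> carrier A'" "g \<in> carrier (P A')" and b: "b \<in> fibre p' a"
      by (auto simp: fib_functor_obj)
    have g: "g \<in> carrier (Pth A')" using P_Pth[OF A' m(3)] .
    have b': "b \<in> carrier (fst p')" "snd p' b = a" using b by (simp_all add: fibre_def)
    have "k (cov_act (fst p') (snd p') b g) = cov_act (fst p) (snd p) (k b) (Pth_map A h g)"
      using c b' g by (intro cov_act_equivariant[OF X.covering_rack_axioms Y.covering_rack_axioms k h]) auto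
    moreover have "cov_act (fst p') (snd p') b g \<in> fibre p' (path_act A' a g)"
      using b' g by (simp add: fibre_def X.f_cov_act X.cov_act_closed)
    ultimately show "restrict k (fibre p' (Tgt (fund_gpd P A') m)) (arrow_map (fib_functor A' p') m b) =
        arrow_map ?H m (restrict k (fibre p' (Src (fund_gpd P A') m)) b)"
      using m b kf[OF b] by (simp add: fib_functor_act H_act)
  qed
  then show ?thesis
    by (simp add: fib_nattrans_def fib_functor_obj H cong: restrict_cong)
qed

text \<open>The fibres of a pullback over \<open>a\<close> are the fibres of the right hand side over \<open>h a\<close>.\<close>

lemma fib_nattrans_invertible:
  assumes p': "p' \<in> Obj (CExt K A')" and p: "p \<in> Obj (CExt K A)"
    and sq: "base_change_square A' p' A p h k"
    and pb: "is_pullback (fst p') (snd p') k A' h (fst p) (snd p)"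
  shows "invertible_arrow (reps P A')
    (fib_nattrans A' p' A p h k)"
proof -
  note n = fib_nattrans_in[OF p' p sq]
  note A' = CExt_covering(3)[OF p'] and A = CExt_covering(3)[OF p]
  interpret X: covering_rack "fst p'" A' "snd p'" by (rule CExt_covering(1)[OF p'])
  interpret Y: covering_rack "fst p" A "snd p" by (rule CExt_covering(1)[OF p])
  have bij: "bij_betw (\<lambda>b \<in> carrier (fst p'). (snd p' b, k b)) (carrier (fst p'))
      {(a, c). a \<in> carrier A' \<and> c \<in> carrier (fst p) \<and> h a = snd p c}"
    using pb by (simp add: is_pullback_def rack_iso_def pullback_rack_def)
  have "bij_betw (restrict k (fibre p' a)) (fibre p' a) (fibre p (h a))" if a: "a \<in> carrier A'" for a
  proof -
    have "inj_on k (fibre p' a)"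
    proof (rule inj_onI)
      fix x y assume "x \<in> fibre p' a" "y \<in> fibre p' a" "k x = k y"
      then show "x = y"
        using inj_onD[OF bij_betw_imp_inj_on[OF bij], of x y] by (simp add: fibre_def)
    qed
    moreover have "k ` fibre p' a = fibre p (h a)"
    proof
      show "k ` fibre p' a \<subseteq> fibre p (h a)"
        using sq by (auto simp: base_change_square_def fibre_def rack_hom_in)
      show "fibre p (h a) \<subseteq> k ` fibre p' a"
      proof
        fix c assume "c \<in> fibre p (h a)"
        then have "(a, c) \<in> {(a, c). a \<in> carrier A' \<and> c \<in> carrier (fst p) \<and> h a = snd p c}"
          using a by (auto simp: fibre_def)
        then obtain b where "b \<in> carrier (fst p')" "(a, c) = (snd p' b, k b)"
          unfolding bij_betw_imp_surj_on[OF bij, symmetric] by auto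
        then show "c \<in> k ` fibre p' a" by (auto simp: fibre_def)
      qed
    qed
    ultimately show ?thesis by (simp add: bij_betw_def inj_on_restrict_eq)
  qed
  moreover have "fibre p' a \<noteq> {}" "h a \<in> carrier A" if "a \<in> carrier A'" for a
    using X.f_lift[OF that] sq that by (auto simp: fibre_def base_change_square_def rack_hom_in)
  moreover from this have "fibre p (h a) \<noteq> {}" if "a \<in> carrier A'" for a
    using Y.f_lift[of "h a"] that by (auto simp: fibre_def)
  ultimately show ?thesis
    using n unfolding fib_nattrans_def
    by (intro invertible_nattransI[OF category_fund_gpd[OF A'] category_set_cat])
      (auto intro!: invertible_set_map)
qed

lemma fib_nattrans_comp:
  assumes A'': "K A''" and A': "K A'" and A: "K A"
    and p'': "p'' \<in> Obj (CExt K A'')" and p': "p' \<in> Obj (CExt K A')" and p: "p \<in> Obj (CExt K A)"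
    and sq': "base_change_square A'' p'' A' p' h' k'" and sq: "base_change_square A' p' A p h k"
  shows "fib_nattrans A'' p'' A p (compose (carrier A'') h h') (compose (carrier (fst p'')) k k') =
    Cmp (reps P A'')
      (whisker (fund_gpd P A'') (fib_nattrans A' p' A p h k) (fund_gpd_map P A'' A' h'))
      (fib_nattrans A'' p'' A' p' h' k')"
proof -
  have h': "h' \<in> rack_hom A'' A'" and h: "h \<in> rack_hom A' A" and k': "k' \<in> rack_hom (fst p'') (fst p')"
    and c: "\<And>b. b \<in> carrier (fst p'') \<Longrightarrow> snd p' (k' b) = h' (snd p'' b)"
    using sq sq' by (auto simp: base_change_square_def)
  have kf: "k' b \<in> fibre p' (h' a)" if "b \<in> fibre p'' a" for a b
    using that rack_hom_in[OF k'] c by (auto simp: fibre_def)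
  have "restrict (compose (carrier (fst p'')) k k') (fibre p'' a) =
      compose (fibre p'' a) (restrict k (fibre p' (h' a))) (restrict k' (fibre p'' a))"
    if "a \<in> carrier A''" for a
    using kf unfolding compose_def by (intro restrict_ext) (auto simp: fibre_def)
  moreover note comp_functor_assoc[OF fund_gpd_map_in[OF A'' A' h'],
      where H = "fib_functor A p" and G = "fund_gpd_map P A' A h"] fund_gpd_map_comp[OF A'' A' A h' h]
  ultimately show ?thesis
    using rack_hom_in[OF h']
    by (auto simp: fib_nattrans_def whisker_def fund_gpd_map_def[of P A'' A' h'] compose_eq intro!: restrict_ext)
qed

lemma fib_nattrans_vertical:
  assumes "K A" "q \<in> Obj (CExt K A)"
  shows "fib_nattrans A p A q (\<lambda>a \<in> carrier A. a) k =
    (fib_functor A p, \<lambda>a \<in> carrier A. (fibre p a, restrict k (fibre p a), fibre q a), fib_functor A q)"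
  using fund_gpd_map_id[OF assms(1)] comp_functor_id[OF fib_functor_in[OF assms(2)]]
  by (auto simp: fib_nattrans_def intro!: restrict_ext)

lemma vertical_square:
  assumes "(p, k, q) \<in> Arr (CExt K A)"
  shows "base_change_square A p A q (\<lambda>a \<in> carrier A. a) k"
proof -
  have "p \<in> Obj (CExt K A)" using assms by (simp add: CExt_Arr_iff)
  then interpret covering_rack "fst p" A "snd p" by (rule CExt_covering(1))
  show ?thesis
    using assms rack_hom_id[OF A.rack_axioms] f_in by (auto simp: base_change_square_def CExt_Arr_iff)
qed

lemma Fib_arr:
  assumes "(p, k, q) \<in> Arr (CExt K A)"
  shows "farr (Fib A) (p, k, q) =
    (fib_functor A p, \<lambda>a \<in> carrier A. (fibre p a, restrict k (fibre p a), fibre q a), fib_functor A q)"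
  using assms fib_nattrans_vertical[of A q p k] CExt_covering(3)[of q A]
  by (simp add: Fib_def CExt_Arr_iff)

lemma Fib_functor:
  assumes A: "K A"
  shows "Fib A \<in> functors (CExt K A) (reps P A)"
proof -
  interpret category "CExt K A" by (rule category_CExt[OF K_rack])
  let ?D = "reps P A"
  have o: "fobj (Fib A) p = fib_functor A p" if "p \<in> Obj (CExt K A)" for p
    using that by (simp add: Fib_def)
  have ar: "farr (Fib A) t \<in> Arr ?D \<and> Src ?D (farr (Fib A) t) = fobj (Fib A) (Src (CExt K A) t) \<and>
      Tgt ?D (farr (Fib A) t) = fobj (Fib A) (Tgt (CExt K A) t)" if t: "t \<in> Arr (CExt K A)" for t
  proof -
    obtain p k q where tt: "t = (p, k, q)" by (cases t)
    with t have pkq: "(p, k, q) \<in> Arr (CExt K A)" "p \<in> Obj (CExt K A)" "q \<in> Obj (CExt K A)"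
      by (simp_all add: CExt_Arr_iff)
    show ?thesis
      using fib_nattrans_in[OF pkq(2,3) vertical_square[OF pkq(1)]]
      unfolding tt Fib_arr[OF pkq(1)] fib_nattrans_vertical[OF A pkq(3)]
      by (simp only: functor_cat_simps CExt_simps(1,2) o[OF pkq(2)] o[OF pkq(3)] simp_thms)
  qed
  have "farr (Fib A) (Idn (CExt K A) p) = Idn ?D (fobj (Fib A) p)" if p: "p \<in> Obj (CExt K A)" for p
  proof -
    have "(p, \<lambda>b \<in> carrier (fst p). b, p) \<in> Arr (CExt K A)" using Idn_Arr[OF p] by simp
    from Fib_arr[OF this] show ?thesis
      using p by (auto simp: o fib_functor_obj fibre_def intro!: restrict_ext)
  qed
  moreover have "farr (Fib A) (Cmp (CExt K A) u t) = Cmp ?D (farr (Fib A) u) (farr (Fib A) t)"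
    if tu: "t \<in> Arr (CExt K A)" "u \<in> Arr (CExt K A)" "Tgt (CExt K A) t = Src (CExt K A) u" for t u
  proof -
    obtain p k q where t: "t = (p, k, q)" by (cases t)
    obtain l r where u: "u = (q, l, r)" using tu(3) by (cases u) (auto simp: t)
    have "k \<in> rack_hom (fst p) (fst q)" "\<forall>b \<in> carrier (fst p). snd q (k b) = snd p b"
      using tu by (auto simp: t CExt_Arr_iff)
    then have "k b \<in> fibre q a" if "b \<in> fibre p a" for a b
      using that rack_hom_in[of k "fst p" "fst q" b] by (auto simp: fibre_def)
    then have "restrict (compose (carrier (fst p)) l k) (fibre p a) =
        compose (fibre p a) (restrict l (fibre q a)) (restrict k (fibre p a))" for a
      unfolding compose_def by (intro restrict_ext) (auto simp: fibre_def)
    moreover have "(p, compose (carrier (fst p)) l k, r) \<in> Arr (CExt K A)"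
      using Cmp_Arr[OF tu] by (simp add: t u)
    ultimately show ?thesis
      using tu unfolding t u by (auto simp: Fib_arr intro!: restrict_ext)
  qed
  moreover have "fobj (Fib A) \<in> Obj (CExt K A) \<rightarrow>\<^sub>E Obj ?D"
    using fib_functor_in by (auto simp: Fib_def)
  moreover have "farr (Fib A) \<in> Arr (CExt K A) \<rightarrow>\<^sub>E Arr ?D"
    using ar by (intro PiE_I) (auto simp: Fib_def)
  ultimately show ?thesis using ar unfolding functors_def by auto
qed

text \<open>Fullness is where the group \<open>P A\<close> has to be large enough: \<open>b \<triangleleft> c\<close> is the translate of \<open>b\<close> by the
  path \<^term>\<open>gen A (f c)\<close>, which need not lie in \<open>P A\<close>, but it is also the translate by the
  retraction of this path to \<open>P A\<close>.\<close>

lemma Fib_full: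
  assumes p: "p \<in> Obj (CExt K A)" and q: "q \<in> Obj (CExt K A)"
    and \<tau>: "(fib_functor A p, \<alpha>, fib_functor A q) \<in>
      Arr (reps P A)"
  shows "\<exists>k. (p, k, q) \<in> Arr (CExt K A) \<and> farr (Fib A) (p, k, q) = (fib_functor A p, \<alpha>, fib_functor A q)"
proof -
  note A = CExt_covering(3)[OF p]
  interpret X: covering_rack "fst p" A "snd p" by (rule CExt_covering(1)[OF p])
  interpret Y: covering_rack "fst q" A "snd q" by (rule CExt_covering(1)[OF q])
  define \<beta> where "\<beta> a = fst (snd (\<alpha> a))" for a
  note maps = set_nattrans_maps[OF category_fund_gpd[OF A] \<tau>]
  have \<alpha>: "\<alpha> a = (fibre p a, \<beta> a, fibre q a)" "\<beta> a \<in> fibre p a \<rightarrow>\<^sub>E fibre q a" if "a \<in> carrier A" for a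
    using maps(1,2)[of a] that unfolding \<beta>_def by (simp_all add: fib_functor_obj)
  have nat: "\<beta> (path_act A a g) (cov_act (fst p) (snd p) b g) = cov_act (fst q) (snd q) (\<beta> a b) g"
    if ag: "a \<in> carrier A" "g \<in> carrier (P A)" and b: "b \<in> fibre p a" for a g b
    using maps(3)[of "(a, g)" b] ag b PiE_mem[OF \<alpha>(2)[OF ag(1)] b]
    by (simp add: fib_functor_obj fib_functor_act \<beta>_def[symmetric])
  define k where "k = (\<lambda>b \<in> carrier (fst p). \<beta> (snd p b) b)"
  have kf: "k b \<in> fibre q (snd p b)" if "b \<in> carrier (fst p)" for b
    using that PiE_mem[OF \<alpha>(2)[OF X.f_in[OF that]], of b] by (simp add: k_def fibre_def)
  have "k \<in> rack_hom (fst p) (fst q)"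
  proof (rule rack_homI[OF X.B.rack_axioms Y.B.rack_axioms])
    show "k \<in> carrier (fst p) \<rightarrow>\<^sub>E carrier (fst q)"
      using kf by (auto simp: k_def fibre_def)
    fix b c assume b: "b \<in> carrier (fst p)" and c: "c \<in> carrier (fst p)"
    let ?a = "snd p b" and ?g = "gen A (snd p c)"
    let ?r = "retr A ?a ?g"
    have g: "?g \<in> carrier (Pth A)" using c by (simp add: X.A.letter_in X.f_in)
    have r: "?r \<in> carrier (P A)" using g b by (simp add: retr_in[OF A] X.f_in)
    have kb: "k b \<in> carrier (fst q)" "snd q (k b) = ?a" and kc: "k c \<in> carrier (fst q)" "snd q (k c) = snd p c"
      using kf[OF b] kf[OF c] by (auto simp: fibre_def)
    have 1: "b \<triangleleft>\<^bsub>fst p\<^esub> c = cov_act (fst p) (snd p) b ?r"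
      using cov_act_retr[OF CExt_covering(2)[OF p] A X.covering_rack_axioms b g] X.cov_act_letter[OF b c] by simp
    have 2: "k b \<triangleleft>\<^bsub>fst q\<^esub> k c = cov_act (fst q) (snd q) (k b) ?r"
      using cov_act_retr[OF CExt_covering(2)[OF q] A Y.covering_rack_axioms kb(1) g]
        Y.cov_act_letter[OF kb(1) kc(1)] by (simp add: kb kc)
    have "k (b \<triangleleft>\<^bsub>fst p\<^esub> c) = \<beta> (snd p (b \<triangleleft>\<^bsub>fst p\<^esub> c)) (b \<triangleleft>\<^bsub>fst p\<^esub> c)"
      using b c by (simp add: k_def X.B.rop_closed)
    also have "\<dots> = \<beta> (path_act A ?a ?r) (cov_act (fst p) (snd p) b ?r)"
      using b r P_Pth[OF A] by (simp add: 1 X.f_cov_act)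
    also have "\<dots> = cov_act (fst q) (snd q) (k b) ?r"
      using nat[of ?a ?r b] b r by (simp add: X.f_in fibre_def k_def)
    finally show "k (b \<triangleleft>\<^bsub>fst p\<^esub> c) = k b \<triangleleft>\<^bsub>fst q\<^esub> k c" using 2 by simp
  qed
  then have k: "(p, k, q) \<in> Arr (CExt K A)"
    using p q kf by (auto simp: CExt_Arr_iff fibre_def)
  have "restrict k (fibre p a) = \<beta> a" if a: "a \<in> carrier A" for a
    using \<alpha>(2)[OF a] by (intro extensionalityI[of _ "fibre p a"]) (auto simp: k_def fibre_def PiE_def)
  then have "(\<lambda>a \<in> carrier A. (fibre p a, restrict k (fibre p a), fibre q a)) = \<alpha>"
    using nattrans_ext[OF \<tau>] \<alpha>(1) by (intro extensionalityI[of _ "carrier A"]) auto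
  with k show ?thesis using Fib_arr[OF k] by auto
qed

text \<open>The fibre over \<open>a\<close> of the covering of \<open>F\<close> is a copy of \<open>F a\<close>. A path in \<open>P A\<close> acts on it as it does in \<open>F\<close>,
  since it is its own retraction.\<close>

lemma Fib_essentially_surjective:
  assumes A: "K A" and F: "F \<in> functors (fund_gpd P A) (set_cat nonempty_sets)"
  shows "\<exists>p \<in> Obj (CExt K A). isomorphic_objects
    (reps P A) (fib_functor A p) F"
proof -
  have ne: "fobj F a \<noteq> {}" if "a \<in> carrier A" for a using functor_fobj[OF F] that by auto
  interpret A: rack A using A by (rule K_rack)
  note T = covering_total[OF inf A F ne] mem_total[OF inf A F ne] proj_pairing[OF inf A F ne]
    unpair_pairing[OF inf A F ne]
  let ?p = "(total A F, proj A F)"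
  have p: "?p \<in> Obj (CExt K A)"
    using T(1) K_total[OF inf A F ne] A by (simp add: central_extension_iff[OF inf])
  have fib: "x \<in> fibre ?p a \<longleftrightarrow> (\<exists>s \<in> fobj F a. x = pairing (a, s))" if a: "a \<in> carrier A" for a x
  proof
    assume "x \<in> fibre ?p a"
    then have x: "x \<in> carrier (total A F)" "proj A F x = a" by (auto simp: fibre_def)
    obtain a' s where "x = pairing (a', s)" "a' \<in> carrier A" "s \<in> fobj F a'"
      using totalE[OF inf A F ne x(1)] by blast
    then show "\<exists>s \<in> fobj F a. x = pairing (a, s)" using x(2) T(3) by auto
  next
    assume "\<exists>s \<in> fobj F a. x = pairing (a, s)"
    then show "x \<in> fibre ?p a" using a T(2,3) by (auto simp: fibre_def)
  qed
  define e where "e a = (\<lambda>x \<in> fibre ?p a. snd (unpair x))" for a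
  have e: "bij_betw (e a) (fibre ?p a) (fobj F a)" if a: "a \<in> carrier A" for a
  proof (rule bij_betw_byWitness[where f' = "\<lambda>s. pairing (a, s)"])
    show "\<forall>x \<in> fibre ?p a. pairing (a, e a x) = x"
      using fib[OF a] by (auto simp: e_def T(4))
    show "\<forall>s \<in> fobj F a. e a (pairing (a, s)) = s"
      using fib[OF a] by (auto simp: e_def T(4))
    show "e a ` fibre ?p a \<subseteq> fobj F a" using fib[OF a] by (auto simp: e_def T(4))
    show "(\<lambda>s. pairing (a, s)) ` fobj F a \<subseteq> fibre ?p a" using fib[OF a] by auto
  qed
  have nat: "e (path_act A a g) (cov_act (total A F) (proj A F) x g) = arrow_map F (a, g) (e a x)"
    if ag: "a \<in> carrier A" "g \<in> carrier (P A)" and x: "x \<in> fibre ?p a" for a g x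
  proof -
    obtain s where s: "s \<in> fobj F a" "x = pairing (a, s)" using fib x ag by blast
    have g: "g \<in> carrier (Pth A)" using ag P_Pth[OF A] by simp
    have "cov_act (total A F) (proj A F) x g = pairing (path_act A a g, arrow_map F (a, g) s)"
      using cov_act_total[OF inf A F ne ag(1) s(1) g] s(2) ag by (simp add: path_map_def retr_id[OF A])
    moreover have "arrow_map F (a, g) s \<in> fobj F (path_act A a g)"
      using arrow_map_closed[OF F, of "(a, g)" s] ag s by simp
    ultimately show ?thesis
      using x s fib[OF A.path_act_closed[OF ag(1) g]] by (auto simp: e_def T(4))
  qed
  have "isomorphic_objects (reps P A) (fib_functor A ?p) F"
  proof (rule isomorphic_functorsI[OF category_fund_gpd[OF A] category_set_cat])
    show "(fib_functor A ?p, \<lambda>a \<in> Obj (fund_gpd P A). (fobj (fib_functor A ?p) a, e a, fobj F a), F) \<in>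
        Arr (reps P A)"
    proof (rule set_nattransI[OF category_fund_gpd[OF A] fib_functor_in[OF p] F])
      show "e a \<in> fobj (fib_functor A ?p) a \<rightarrow>\<^sub>E fobj F a" if "a \<in> Obj (fund_gpd P A)" for a
        using that bij_betwE[OF e[of a]] by (intro PiE_I) (auto simp: fib_functor_obj, simp add: e_def)
    qed (auto simp: fib_functor_obj fib_functor_act nat)
    fix a assume "a \<in> Obj (fund_gpd P A)"
    then have a: "a \<in> carrier A" by simp
    then show "invertible_arrow (set_cat nonempty_sets)
        ((\<lambda>a \<in> Obj (fund_gpd P A). (fobj (fib_functor A ?p) a, e a, fobj F a)) a)"
      using e[OF a] ne[OF a] by (auto simp: fib_functor_obj e_def bij_betw_def intro!: invertible_set_map)
  qed
  with p show ?thesis by blast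
qed

theorem Fib_equivalence:
  assumes A: "K A"
  shows "category_equivalence (CExt K A) (reps P A) (Fib A)"
proof (rule category_equivalenceI[OF category_CExt[OF K_rack]
    category_functor_cat[OF category_fund_gpd[OF A] category_set_cat] Fib_functor[OF A]])
  have o: "fobj (Fib A) p = fib_functor A p" if "p \<in> Obj (CExt K A)" for p
    using that by (simp add: Fib_def)
  show "t = u" if tu: "t \<in> Arr (CExt K A)" "u \<in> Arr (CExt K A)" "Src (CExt K A) t = Src (CExt K A) u"
    "Tgt (CExt K A) t = Tgt (CExt K A) u" "farr (Fib A) t = farr (Fib A) u" for t u
  proof -
    obtain p k q where t: "t = (p, k, q)" by (cases t)
    obtain l where u: "u = (p, l, q)" using tu(3,4) by (cases u) (auto simp: t)
    have "p \<in> Obj (CExt K A)" using tu by (simp add: t CExt_Arr_iff)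
    then interpret covering_rack "fst p" A "snd p" by (rule CExt_covering(1))
    have "k b = l b" if b: "b \<in> carrier (fst p)" for b
    proof -
      have "restrict k (fibre p (snd p b)) = restrict l (fibre p (snd p b))"
        using tu(5) Fib_arr[OF tu(1)[unfolded t]] Fib_arr[OF tu(2)[unfolded u]] f_in[OF b]
        unfolding t u by (auto dest: fun_cong[of _ _ "snd p b"])
      from fun_cong[OF this, of b] show ?thesis using b by (simp add: fibre_def)
    qed
    moreover have "k \<in> extensional (carrier (fst p))" "l \<in> extensional (carrier (fst p))"
      using tu(1,2) rack_hom_ext by (auto simp: t u CExt_Arr_iff)
    ultimately show "t = u" unfolding t u by (auto intro: extensionalityI)
  qed
  show "\<exists>t \<in> Arr (CExt K A). Src (CExt K A) t = p \<and> Tgt (CExt K A) t = q \<and> farr (Fib A) t = \<tau>"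
    if pq: "p \<in> Obj (CExt K A)" "q \<in> Obj (CExt K A)"
      and \<tau>: "\<tau> \<in> Arr (reps P A)"
      "Src (reps P A) \<tau> = fobj (Fib A) p"
      "Tgt (reps P A) \<tau> = fobj (Fib A) q" for p q \<tau>
  proof -
    obtain \<alpha> where "\<tau> = (fib_functor A p, \<alpha>, fib_functor A q)"
      using \<tau>(2,3) o[OF pq(1)] o[OF pq(2)] by (cases \<tau>) auto
    then show ?thesis using Fib_full[OF pq] \<tau>(1) by force
  qed
  show "\<exists>p \<in> Obj (CExt K A). isomorphic_objects
      (reps P A) (fobj (Fib A) p) F"
    if "F \<in> Obj (reps P A)" for F
    using Fib_essentially_surjective[OF A, of F] that o by auto
qed

theorem Fib_natural: "natural_in_base K P nonempty_sets Fib"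
  unfolding natural_in_base_def
proof (intro exI[of _ fib_nattrans] conjI allI impI, goal_cases)
  case (1 A' A p' p h k)
  note o = 1(3,4)
  have "fobj (Fib A') p' = fib_functor A' p'" "fobj (Fib A) p = fib_functor A p"
    using o by (simp_all add: Fib_def)
  then show ?case
    using fib_nattrans_in[OF o 1(5)] fib_nattrans_invertible[OF o 1(5)]
    unfolding Let_def by (simp add: fib_nattrans_def)
next
  case (2 A p k q)
  then show ?case by (simp add: Fib_def)
next
  case (3 A'' A' A p'' p' p h' k' h k)
  then show ?case by (intro fib_nattrans_comp)
qed

end

end

section \<open>Totally disconnected groupoids\<close>

definition disjoint_groups ::
  "'i set \<Rightarrow> ('i \<Rightarrow> ('g, 'b) monoid_scheme) \<Rightarrow> ('i, 'i \<times> 'g) cat" where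
  "disjoint_groups I L = \<lparr>Obj = I, Arr = (SIGMA i : I. carrier (L i)), Src = (\<lambda>(i, l). i),
    Tgt = (\<lambda>(i, l). i), Idn = (\<lambda>i. (i, \<one>\<^bsub>L i\<^esub>)), Cmp = (\<lambda>(j, m) (i, l). (i, l \<otimes>\<^bsub>L i\<^esub> m))\<rparr>"

lemma disjoint_groups_simps [simp]:
  "Obj (disjoint_groups I L) = I" "Arr (disjoint_groups I L) = (SIGMA i : I. carrier (L i))"
  "Src (disjoint_groups I L) (i, l) = i" "Tgt (disjoint_groups I L) (i, l) = i"
  "Idn (disjoint_groups I L) i = (i, \<one>\<^bsub>L i\<^esub>)"
  "Cmp (disjoint_groups I L) (j, m) (i, l) = (i, l \<otimes>\<^bsub>L i\<^esub> m)"
  by (simp_all add: disjoint_groups_def)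

lemma category_disjoint_groups:
  assumes "\<And>i. i \<in> I \<Longrightarrow> group (L i)"
  shows "category (disjoint_groups I L)"
proof -
  note m = group.is_monoid[OF assms]
  show ?thesis
    by unfold_locales (auto simp: monoid.m_closed[OF m] monoid.one_closed[OF m] monoid.m_assoc[OF m]
        monoid.l_one[OF m] monoid.r_one[OF m])
qed

definition gset_objects :: "'u set set \<Rightarrow> ('g, 'b) monoid_scheme \<Rightarrow> ('u set \<times> ('u \<times> 'g \<Rightarrow> 'u)) set" where
  "gset_objects \<S> G = {(S, act). S \<in> \<S> \<and> act \<in> extensional (S \<times> carrier G) \<and>
    right_action G S (\<lambda>x g. act (x, g))}"

definition equivariant_maps ::
  "('g, 'b) monoid_scheme \<Rightarrow> 'u set \<times> ('u \<times> 'g \<Rightarrow> 'u) \<Rightarrow> 'u set \<times> ('u \<times> 'g \<Rightarrow> 'u) \<Rightarrow> ('u \<Rightarrow> 'u) set" where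
  "equivariant_maps G X Y = {f. \<forall>x \<in> fst X. \<forall>g \<in> carrier G. f (snd X (x, g)) = snd Y (f x, g)}"

lemma gset_cat_concrete: "gset_cat \<S> G = concrete_cat (gset_objects \<S> G) fst (equivariant_maps G)"
  by (auto simp: gset_cat_def Let_def concrete_cat_def gset_objects_def equivariant_maps_def)

lemma gset_cat_Obj_iff [simp]:
  "(S, act) \<in> Obj (gset_cat \<S> G) \<longleftrightarrow> S \<in> \<S> \<and> act \<in> extensional (S \<times> carrier G) \<and>
    right_action G S (\<lambda>x g. act (x, g))"
  by (simp add: gset_cat_concrete concrete_cat_simps gset_objects_def)

lemmas gset_cat_simps [simp] = concrete_cat_simps(2-5)[of "gset_objects \<S> G" fst "equivariant_maps G",
    folded gset_cat_concrete] for \<S> G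

lemma gset_cat_Arr_iff:
  "(X, f, Y) \<in> Arr (gset_cat \<S> G) \<longleftrightarrow> X \<in> Obj (gset_cat \<S> G) \<and> Y \<in> Obj (gset_cat \<S> G) \<and>
    f \<in> fst X \<rightarrow>\<^sub>E fst Y \<and> f \<in> equivariant_maps G X Y"
  by (simp add: gset_cat_concrete concrete_cat_simps)

lemma category_gset_cat: "category (gset_cat \<S> G)"
  unfolding gset_cat_concrete
proof (rule category_concrete_cat)
  have closed: "snd X (x, g) \<in> fst X" if "X \<in> gset_objects \<S> G" "x \<in> fst X" "g \<in> carrier G" for X x g
    using that by (auto simp: gset_objects_def right_action_def)
  show "(\<lambda>x \<in> fst X. x) \<in> equivariant_maps G X X" if "X \<in> gset_objects \<S> G" for X
    using that closed by (auto simp: equivariant_maps_def)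
  show "compose (fst X) g f \<in> equivariant_maps G X Z"
    if "X \<in> gset_objects \<S> G" "f \<in> fst X \<rightarrow>\<^sub>E fst Y" "f \<in> equivariant_maps G X Y"
      "g \<in> equivariant_maps G Y Z" for X Y Z f g
    using that closed[of X] by (auto simp: equivariant_maps_def compose_def)
qed

lemma product_cat_simps:
  "Obj (product_cat J C) = (\<Pi>\<^sub>E i\<in>J. Obj (C i))" "Arr (product_cat J C) = (\<Pi>\<^sub>E i\<in>J. Arr (C i))"
  "Src (product_cat J C) f = (\<lambda>i \<in> J. Src (C i) (f i))" "Tgt (product_cat J C) f = (\<lambda>i \<in> J. Tgt (C i) (f i))"
  "Idn (product_cat J C) x = (\<lambda>i \<in> J. Idn (C i) (x i))"
  "Cmp (product_cat J C) g f = (\<lambda>i \<in> J. Cmp (C i) (g i) (f i))"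
  by (simp_all add: product_cat_def)

lemma category_product_cat:
  assumes "\<And>i. i \<in> J \<Longrightarrow> category (C i)"
  shows "category (product_cat J C)"
proof -
  have eq: "f i = g i" if "restrict f J = restrict g J" "i \<in> J" for f g :: "'a \<Rightarrow> 'b" and i
    using fun_cong[OF that(1), of i] that(2) by simp
  note c = category.Src_Obj[OF assms] category.Tgt_Obj[OF assms] category.Idn_Arr[OF assms]
    category.Src_Idn[OF assms] category.Tgt_Idn[OF assms] category.Cmp_Arr[OF assms]
    category.Src_Cmp[OF assms] category.Tgt_Cmp[OF assms] category.Cmp_Idn_right[OF assms]
    category.Cmp_Idn_left[OF assms]
  have assoc: "Cmp (C i) (h i) (Cmp (C i) (g i) (f i)) = Cmp (C i) (Cmp (C i) (h i) (g i)) (f i)"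
    if "i \<in> J" "\<forall>i\<in>J. f i \<in> Arr (C i)" "\<forall>i\<in>J. g i \<in> Arr (C i)" "\<forall>i\<in>J. h i \<in> Arr (C i)"
      "(\<lambda>i \<in> J. Tgt (C i) (f i)) = (\<lambda>i \<in> J. Src (C i) (g i))"
      "(\<lambda>i \<in> J. Tgt (C i) (g i)) = (\<lambda>i \<in> J. Src (C i) (h i))" for i f g h
    using that eq[OF that(5,1)] eq[OF that(6,1)] by (intro category.Cmp_assoc[OF assms]) auto
  show ?thesis
    by unfold_locales
      (auto simp: product_cat_simps PiE_iff c assoc dest: eq intro!: extensionalityI[of _ J])
qed

text \<open>Full faithfulness makes the map on arrows bijective as soon as the map on objects is, and the inverse
  maps then preserve the structure because the given ones do.\<close>

lemma isomorphic_categoriesI: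
  assumes C: "category C" and D: "category D" and F: "F \<in> functors C D"
    and obj: "bij_betw (fobj F) (Obj C) (Obj D)"
    and faithful: "\<And>f g. \<lbrakk>f \<in> Arr C; g \<in> Arr C; Src C f = Src C g; Tgt C f = Tgt C g;
        farr F f = farr F g\<rbrakk> \<Longrightarrow> f = g"
    and full: "\<And>x y h. \<lbrakk>x \<in> Obj C; y \<in> Obj C; h \<in> Arr D; Src D h = fobj F x; Tgt D h = fobj F y\<rbrakk>
        \<Longrightarrow> \<exists>f \<in> Arr C. farr F f = h"
  shows "isomorphic_categories C D"
proof -
  interpret C: category C by fact
  interpret D: category D by fact
  note ff = functor_fobj[OF F] functor_farr[OF F] functor_Src[OF F] functor_Tgt[OF F]
  note inj = inj_onD[OF bij_betw_imp_inj_on[OF obj]]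
  have "inj_on (farr F) (Arr C)"
  proof (rule inj_onI)
    fix f g assume f: "f \<in> Arr C" and g: "g \<in> Arr C" and eq: "farr F f = farr F g"
    have "Src C f = Src C g" "Tgt C f = Tgt C g"
      using inj[of "Src C f" "Src C g"] inj[of "Tgt C f" "Tgt C g"] f g eq
        functor_Src[OF F f] functor_Src[OF F g] functor_Tgt[OF F f] functor_Tgt[OF F g]
      by (simp_all add: C.Src_Obj C.Tgt_Obj)
    then show "f = g" using faithful f g eq by blast
  qed
  moreover have "farr F ` Arr C = Arr D"
  proof
    show "farr F ` Arr C \<subseteq> Arr D" using ff by auto
    show "Arr D \<subseteq> farr F ` Arr C"
    proof
      fix h assume h: "h \<in> Arr D"
      have "Src D h \<in> fobj F ` Obj C" "Tgt D h \<in> fobj F ` Obj C"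
        using D.Src_Obj[OF h] D.Tgt_Obj[OF h] bij_betw_imp_surj_on[OF obj] by auto
      then obtain x y where "x \<in> Obj C" "Src D h = fobj F x" "y \<in> Obj C" "Tgt D h = fobj F y"
        by blast
      then show "h \<in> farr F ` Arr C" using full[of x y h] h by blast
    qed
  qed
  ultimately have arr: "bij_betw (farr F) (Arr C) (Arr D)" by (simp add: bij_betw_def)
  define G where "G = \<lparr>fobj = (\<lambda>y \<in> Obj D. inv_into (Obj C) (fobj F) y),
    farr = (\<lambda>h \<in> Arr D. inv_into (Arr C) (farr F) h)\<rparr>"
  have Go: "fobj G y \<in> Obj C" "fobj F (fobj G y) = y" if "y \<in> Obj D" for y
    using that bij_betw_imp_surj_on[OF obj] by (auto simp: G_def inv_into_into f_inv_into_f)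
  have Ga: "farr G h \<in> Arr C" "farr F (farr G h) = h" if "h \<in> Arr D" for h
    using that bij_betw_imp_surj_on[OF arr] by (auto simp: G_def inv_into_into f_inv_into_f)
  have GFo: "fobj G (fobj F x) = x" if "x \<in> Obj C" for x
    using that ff bij_betw_imp_inj_on[OF obj] by (simp add: G_def)
  have GFa: "farr G (farr F f) = f" if "f \<in> Arr C" for f
    using that ff bij_betw_imp_inj_on[OF arr] by (simp add: G_def)
  have GS: "Src C (farr G h) = fobj G (Src D h)" "Tgt C (farr G h) = fobj G (Tgt D h)" if h: "h \<in> Arr D" for h
    using GFo[OF C.Src_Obj[OF Ga(1)[OF h]]] GFo[OF C.Tgt_Obj[OF Ga(1)[OF h]]]
      functor_Src[OF F Ga(1)[OF h]] functor_Tgt[OF F Ga(1)[OF h]] Ga(2)[OF h] by simp_all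
  have "farr G (Idn D y) = Idn C (fobj G y)" if y: "y \<in> Obj D" for y
    using GFa[OF C.Idn_Arr[OF Go(1)[OF y]]] functor_Idn[OF F Go(1)[OF y]] Go(2)[OF y] by simp
  moreover have "farr G (Cmp D k h) = Cmp C (farr G k) (farr G h)"
    if "h \<in> Arr D" "k \<in> Arr D" "Tgt D h = Src D k" for h k
    using GFa[of "Cmp C (farr G k) (farr G h)"] functor_Cmp[OF F, of "farr G h" "farr G k"] that
    by (simp add: C.Cmp_Arr Ga GS)
  moreover have "fobj G \<in> extensional (Obj D)" "farr G \<in> extensional (Arr D)" by (simp_all add: G_def)
  ultimately have G: "G \<in> functors D C"
    using Go Ga GS by (auto simp: functors_def PiE_def)
  have "comp_functor C G F = id_functor C"
    using GFo GFa by (auto intro!: functor_eqI[OF comp_functor_in[OF C G F] id_functor_in[OF C]]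
        simp: comp_functor_apply id_functor_apply)
  moreover have "comp_functor D F G = id_functor D"
    using Go Ga by (auto intro!: functor_eqI[OF comp_functor_in[OF D F G] id_functor_in[OF D]]
        simp: comp_functor_apply id_functor_apply)
  ultimately show ?thesis unfolding isomorphic_categories_def using C D F G by blast
qed

definition gset_family ::
  "'i set \<Rightarrow> ('i \<Rightarrow> ('g, 'b) monoid_scheme) \<Rightarrow>
   ('i, 'i \<times> 'g, 'u set, 'u set \<times> ('u \<Rightarrow> 'u) \<times> 'u set) ftr \<Rightarrow> 'i \<Rightarrow> 'u set \<times> ('u \<times> 'g \<Rightarrow> 'u)" where
  "gset_family I L F = (\<lambda>i \<in> I. (fobj F i, \<lambda>(x, l) \<in> fobj F i \<times> carrier (L i). arrow_map F (i, l) x))"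

lemma gset_family_in:
  assumes F: "F \<in> functors (disjoint_groups I L) (set_cat \<S>)" and L: "\<And>i. i \<in> I \<Longrightarrow> group (L i)"
    and i: "i \<in> I"
  shows "gset_family I L F i \<in> Obj (gset_cat \<S> (L i))"
proof -
  interpret group "L i" using i by (rule L)
  have "arrow_map F (i, l) x \<in> fobj F i" if "x \<in> fobj F i" "l \<in> carrier (L i)" for x l
    using arrow_map_closed[OF F, of "(i, l)" x] that i by simp
  moreover have "arrow_map F (i, \<one>\<^bsub>L i\<^esub>) x = x" if "x \<in> fobj F i" for x
    using arrow_map_Idn[OF F, of i x] i that by simp
  moreover have "arrow_map F (i, l \<otimes>\<^bsub>L i\<^esub> m) x = arrow_map F (i, m) (arrow_map F (i, l) x)"
    if "x \<in> fobj F i" "l \<in> carrier (L i)" "m \<in> carrier (L i)" for x l m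
    using arrow_map_Cmp[OF F, of "(i, l)" "(i, m)" x] i that by simp
  ultimately show ?thesis
    using i functor_fobj[OF F, of i] by (auto simp: gset_family_def right_action_def)
qed

lemma gset_family_surj:
  fixes X :: "'i \<Rightarrow> 'u set \<times> ('u \<times> 'g \<Rightarrow> 'u)"
  assumes X: "X \<in> (\<Pi>\<^sub>E i\<in>I. Obj (gset_cat \<S> (L i)))" and L: "\<And>i. i \<in> I \<Longrightarrow> group (L i)"
  shows "\<exists>F \<in> functors (disjoint_groups I L) (set_cat \<S>). gset_family I L F = X"
proof -
  have Xi: "fst (X i) \<in> \<S>" "snd (X i) \<in> extensional (fst (X i) \<times> carrier (L i))"
    "right_action (L i) (fst (X i)) (\<lambda>x g. snd (X i) (x, g))" if "i \<in> I" for i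
    using PiE_mem[OF X that] by (cases "X i"; auto)+
  have mon: "monoid (L i)" if "i \<in> I" for i using L[OF that] by (rule group.is_monoid)
  have C: "category (disjoint_groups I L)" by (rule category_disjoint_groups[OF L])
  let ?F = "action_functor (disjoint_groups I L) (\<lambda>i. fst (X i)) (\<lambda>(i, l) x. snd (X i) (x, l))"
  have "?F \<in> functors (disjoint_groups I L) (set_cat \<S>)"
    using Xi mon by (intro action_functor_in[OF C]) (auto simp: right_action_def)
  moreover have "gset_family I L ?F = X"
  proof (rule extensionalityI[of _ I])
    show "gset_family I L ?F \<in> extensional I" by (simp add: gset_family_def)
    show "X \<in> extensional I" using X by (simp add: PiE_def)
    fix i assume i: "i \<in> I"
    have "(\<lambda>(x, l) \<in> fst (X i) \<times> carrier (L i). arrow_map ?F (i, l) x) = snd (X i)"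
      using i Xi(2)[OF i] by (intro extensionalityI[of _ "fst (X i) \<times> carrier (L i)"])
        (auto simp: action_functor_apply)
    then show "gset_family I L ?F i = X i"
      using i by (simp add: gset_family_def action_functor_apply)
  qed
  ultimately show ?thesis by blast
qed

lemma gset_family_inj:
  assumes F: "F \<in> functors (disjoint_groups I L) (set_cat \<S>)"
    and G: "G \<in> functors (disjoint_groups I L) (set_cat \<S>)"
    and eq: "gset_family I L F = gset_family I L G"
  shows "F = G"
proof (rule functor_eqI[OF F G])
  have eqi: "gset_family I L F i = gset_family I L G i" for i using eq by simp
  show o: "fobj F i = fobj G i" if "i \<in> Obj (disjoint_groups I L)" for i
    using eqi[of i] that by (simp add: gset_family_def)
  fix m assume m: "m \<in> Arr (disjoint_groups I L)"
  then obtain i l where il: "m = (i, l)" "i \<in> I" "l \<in> carrier (L i)" by auto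
  have "arrow_map F m = arrow_map G m"
  proof (rule extensionalityI[of _ "fobj F i"])
    show "arrow_map F m \<in> extensional (fobj F i)" "arrow_map G m \<in> extensional (fobj F i)"
      using set_functor_arrow(2)[OF F m] set_functor_arrow(2)[OF G m] il o[of i] by (auto simp: PiE_def)
    fix x assume "x \<in> fobj F i"
    then show "arrow_map F m x = arrow_map G m x"
      using eqi[of i] il by (auto simp: gset_family_def dest: fun_cong[of _ _ "(x, l)"])
  qed
  then show "farr F m = farr G m"
    using set_functor_arrow(1)[OF F m] set_functor_arrow(1)[OF G m] o il by simp
qed

text \<open>All arrows of a totally disconnected groupoid are loops, so that a functor to sets is a family of
  actions. They are right actions, because a composite of loops is their product in the order of
  traversal.\<close>

lemma functors_disjoint_groups_iso:
  fixes L :: "'i \<Rightarrow> ('g, 'b) monoid_scheme" and \<S> :: "'u set set"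
  assumes L: "\<And>i. i \<in> I \<Longrightarrow> group (L i)"
  shows "isomorphic_categories (functor_cat (disjoint_groups I L) (set_cat \<S>))
    (product_cat I (\<lambda>i. gset_cat \<S> (L i)))"
proof -
  let ?Fun = "functors (disjoint_groups I L) (set_cat \<S>)"
  let ?C = "functor_cat (disjoint_groups I L) (set_cat \<S>)"
  let ?D = "product_cat I (\<lambda>i. gset_cat \<S> (L i))"
  let ?g = "gset_family I L :: ('i, 'i \<times> 'g, 'u set, 'u set \<times> ('u \<Rightarrow> 'u) \<times> 'u set) ftr \<Rightarrow> _"
  have C0: "category (disjoint_groups I L)" by (rule category_disjoint_groups[OF L])
  have C: "category ?C" by (rule category_functor_cat[OF C0 category_set_cat])
  have D: "category ?D" by (rule category_product_cat[OF category_gset_cat])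
  define \<Phi> where "\<Phi> = \<lparr>fobj = (\<lambda>F \<in> Obj ?C. ?g F),
    farr = (\<lambda>(F, \<alpha>, G) \<in> Arr ?C. \<lambda>i \<in> I. (?g F i, fst (snd (\<alpha> i)), ?g G i))\<rparr>"
  have fst_g: "fst (?g F i) = fobj F i" if "i \<in> I" for F i using that by (simp add: gset_family_def)
  have snd_g: "snd (?g F i) (x, l) = arrow_map F (i, l) x"
    if "i \<in> I" "x \<in> fobj F i" "l \<in> carrier (L i)" for F i x l
    using that by (simp add: gset_family_def)
  \<comment> \<open>Naturality at the loops of \<open>i\<close> is equivariance.\<close>
  have arrow: "(F, \<alpha>, G) \<in> Arr ?C \<longleftrightarrow> \<alpha> \<in> extensional I \<and>
      (\<forall>i \<in> I. \<alpha> i = (fobj F i, fst (snd (\<alpha> i)), fobj G i) \<and>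
        (?g F i, fst (snd (\<alpha> i)), ?g G i) \<in> Arr (gset_cat \<S> (L i)))"
    if F: "F \<in> ?Fun"
      and G: "G \<in> ?Fun" for F \<alpha> G
  proof -
    let ?m = "\<lambda>i. fst (snd (\<alpha> i))"
    have mem: "?m i x \<in> fobj G i" if "?m i \<in> fobj F i \<rightarrow>\<^sub>E fobj G i" "x \<in> fobj F i" for i x
      using that by (rule PiE_mem)
    have "(?g F i, ?m i, ?g G i) \<in> Arr (gset_cat \<S> (L i)) \<longleftrightarrow> ?m i \<in> fobj F i \<rightarrow>\<^sub>E fobj G i \<and>
        (\<forall>l \<in> carrier (L i). \<forall>x \<in> fobj F i. ?m i (arrow_map F (i, l) x) = arrow_map G (i, l) (?m i x))"
      if "i \<in> I" for i
      using that gset_family_in[OF F L that] gset_family_in[OF G L that]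
      by (auto simp: gset_cat_Arr_iff fst_g equivariant_maps_def snd_g mem)
    then show ?thesis
      unfolding set_nattrans_iff[OF C0 F G] by auto
  qed
  have \<Phi>o: "fobj \<Phi> F = ?g F" if "F \<in> ?Fun" for F
    using that by (simp add: \<Phi>_def)
  have \<Phi>a: "farr \<Phi> (F, \<alpha>, G) = (\<lambda>i \<in> I. (?g F i, fst (snd (\<alpha> i)), ?g G i))" if "(F, \<alpha>, G) \<in> Arr ?C" for F \<alpha> G
    using that by (simp add: \<Phi>_def)
  have g_ext: "?g F = (\<lambda>i \<in> I. ?g F i)" for F by (simp add: gset_family_def fun_eq_iff)
  have g_obj: "?g F \<in> Obj ?D" if "F \<in> ?Fun" for F
    using gset_family_in[OF that L] by (subst g_ext) (auto simp: product_cat_simps)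
  show ?thesis
  proof (rule isomorphic_categoriesI[OF C D])
    have "farr \<Phi> t \<in> Arr ?D \<and> Src ?D (farr \<Phi> t) = fobj \<Phi> (Src ?C t) \<and> Tgt ?D (farr \<Phi> t) = fobj \<Phi> (Tgt ?C t)"
      if t: "t \<in> Arr ?C" for t
    proof -
      obtain F \<alpha> G where tt: "t = (F, \<alpha>, G)" by (cases t)
      have FG: "F \<in> ?Fun"
        "G \<in> ?Fun"
        using t nattrans_functors unfolding tt by blast+
      show ?thesis
        using t arrow[OF FG, of \<alpha>] g_ext[of F] g_ext[of G] unfolding tt
        by (auto simp: \<Phi>a \<Phi>o FG product_cat_simps fun_eq_iff restrict_def cong: if_cong)
    qed
    moreover have "farr \<Phi> (Idn ?C F) = Idn ?D (fobj \<Phi> F)" if F: "F \<in> Obj ?C" for F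
    proof -
      have "(F, \<lambda>i \<in> I. (fobj F i, \<lambda>x \<in> fobj F i. x, fobj F i), F) \<in> Arr ?C"
        using category.Idn_Arr[OF C F] by simp
      from \<Phi>a[OF this] show ?thesis
        using F by (auto simp: \<Phi>o product_cat_simps fst_g intro!: restrict_ext)
    qed
    moreover have "farr \<Phi> (Cmp ?C u t) = Cmp ?D (farr \<Phi> u) (farr \<Phi> t)"
      if tu: "t \<in> Arr ?C" "u \<in> Arr ?C" "Tgt ?C t = Src ?C u" for t u
    proof -
      obtain F \<alpha> G where t: "t = (F, \<alpha>, G)" by (cases t)
      obtain \<beta> H where u: "u = (G, \<beta>, H)" using tu(3) by (cases u) (auto simp: t)
      have FGH: "F \<in> ?Fun"
        "G \<in> ?Fun" "H \<in> ?Fun"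
        using tu nattrans_functors unfolding t u by blast+
      have \<alpha>\<beta>: "\<alpha> i = (fobj F i, fst (snd (\<alpha> i)), fobj G i)" "\<beta> i = (fobj G i, fst (snd (\<beta> i)), fobj H i)"
        if "i \<in> I" for i
        using tu that arrow[OF FGH(1,2), of \<alpha>] arrow[OF FGH(2,3), of \<beta>] unfolding t u by auto
      have "Cmp (set_cat \<S>) (\<beta> i) (\<alpha> i) = (fobj F i, compose (fobj F i) (fst (snd (\<beta> i))) (fst (snd (\<alpha> i))), fobj H i)"
        if "i \<in> I" for i
        by (subst \<alpha>\<beta>(1)[OF that], subst \<alpha>\<beta>(2)[OF that]) simp
      then show ?thesis
        using category.Cmp_Arr[OF C tu] tu(1,2) unfolding t u
        by (auto simp: \<Phi>a product_cat_simps fst_g intro!: restrict_ext)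
    qed
    moreover have "fobj \<Phi> \<in> Obj ?C \<rightarrow>\<^sub>E Obj ?D" using g_obj by (auto simp: \<Phi>_def)
    moreover have "farr \<Phi> \<in> extensional (Arr ?C)" by (simp add: \<Phi>_def)
    ultimately show "\<Phi> \<in> functors ?C ?D" by (auto simp: functors_def PiE_def)
  next
    show "bij_betw (fobj \<Phi>) (Obj ?C) (Obj ?D)"
      unfolding bij_betw_def
    proof
      show "inj_on (fobj \<Phi>) (Obj ?C)" using gset_family_inj by (auto simp: inj_on_def \<Phi>o)
      show "fobj \<Phi> ` Obj ?C = Obj ?D"
      proof
        show "fobj \<Phi> ` Obj ?C \<subseteq> Obj ?D" using g_obj by (auto simp: \<Phi>o)
        show "Obj ?D \<subseteq> fobj \<Phi> ` Obj ?C"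
        proof
          fix X assume "X \<in> Obj ?D"
          then obtain F where "F \<in> ?Fun" "?g F = X"
            using gset_family_surj[where X = X and L = L, OF _ L] unfolding product_cat_simps by blast
          then show "X \<in> fobj \<Phi> ` Obj ?C" by (intro image_eqI[of _ _ F]) (simp_all add: \<Phi>o)
        qed
      qed
    qed
  next
    fix t u assume tu: "t \<in> Arr ?C" "u \<in> Arr ?C" "Src ?C t = Src ?C u" "Tgt ?C t = Tgt ?C u"
      and eq: "farr \<Phi> t = farr \<Phi> u"
    obtain F \<alpha> G where t: "t = (F, \<alpha>, G)" by (cases t)
    obtain \<beta> where u: "u = (F, \<beta>, G)" using tu(3,4) by (cases u) (auto simp: t)
    have FG: "F \<in> ?Fun"
      "G \<in> ?Fun"
      using tu nattrans_functors unfolding t by blast+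
    have "\<alpha> = \<beta>"
    proof (rule extensionalityI[of _ I])
      show "\<alpha> \<in> extensional I" "\<beta> \<in> extensional I" using tu arrow[OF FG] by (auto simp: t u)
      fix i assume i: "i \<in> I"
      have "fst (snd (\<alpha> i)) = fst (snd (\<beta> i))"
        using fun_cong[OF eq, of i] i tu(1,2) unfolding t u by (simp add: \<Phi>a)
      then show "\<alpha> i = \<beta> i"
        using tu(1,2) i arrow[OF FG, of \<alpha>] arrow[OF FG, of \<beta>] unfolding t u by metis
    qed
    then show "t = u" by (simp add: t u)
  next
    fix F G h assume FG: "F \<in> Obj ?C" "G \<in> Obj ?C" and h: "h \<in> Arr ?D" "Src ?D h = fobj \<Phi> F" "Tgt ?D h = fobj \<Phi> G"
    have FG': "F \<in> ?Fun"
      "G \<in> ?Fun" using FG by simp_all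
    define \<alpha> where "\<alpha> = (\<lambda>i \<in> I. (fobj F i, fst (snd (h i)), fobj G i))"
    have hi: "h i = (?g F i, fst (snd (h i)), ?g G i)" if i: "i \<in> I" for i
      using fun_cong[OF h(2), of i] fun_cong[OF h(3), of i] i
      by (cases "h i") (auto simp: product_cat_simps \<Phi>o[OF FG'(1)] \<Phi>o[OF FG'(2)])
    have "(?g F i, fst (snd (h i)), ?g G i) \<in> Arr (gset_cat \<S> (L i))" if i: "i \<in> I" for i
      using h(1) i hi[OF i] by (auto simp: product_cat_simps PiE_iff)
    then have \<alpha>: "(F, \<alpha>, G) \<in> Arr ?C"
      unfolding arrow[OF FG'] by (simp add: \<alpha>_def)
    moreover have "farr \<Phi> (F, \<alpha>, G) = h"
      unfolding \<Phi>a[OF \<alpha>]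
      using h(1) hi by (intro extensionalityI[of _ I]) (auto simp: \<alpha>_def product_cat_simps PiE_def)
    ultimately show "\<exists>t \<in> Arr ?C. farr \<Phi> t = h" by blast
  qed
qed

section \<open>Choosing base points\<close>

context path_theory
begin

lemma Loop_simps [simp]:
  "carrier (Loop P A x) = {l \<in> carrier (P A). path_act A x l = x}"
  "\<one>\<^bsub>Loop P A x\<^esub> = \<one>\<^bsub>Pth A\<^esub>" "l \<otimes>\<^bsub>Loop P A x\<^esub> m = l \<otimes>\<^bsub>Pth A\<^esub> m"
  by (simp_all add: Loop_def one_P mult_P)

lemma group_Loop:
  assumes A: "K A" and x: "x \<in> carrier A"
  shows "group (Loop P A x)"
proof -
  interpret A: rack A using A by (rule K_rack)
  interpret G: group "Pth A" by (rule A.group_Pth)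
  have "path_act A x (inv\<^bsub>Pth A\<^esub> l) = x" if "l \<in> carrier (Pth A)" "path_act A x l = x" for l
    using A.path_act_inv[OF x that(1)] that(2) by simp
  then have "subgroup {l \<in> carrier (P A). path_act A x l = x} (Pth A)"
    using x P_Pth[OF A] P_one[OF A] P_mult[OF A] P_inv[OF A]
    by unfold_locales (auto simp: A.path_act_one A.path_act_mult)
  moreover have "Loop P A x = (Pth A)\<lparr>carrier := {l \<in> carrier (P A). path_act A x l = x}\<rparr>"
    using arg_cong[OF P_eq[of A], of "\<lambda>G. G\<lparr>carrier := {l \<in> carrier (P A). path_act A x l = x}\<rparr>"]
    by (simp add: Loop_def)
  ultimately show ?thesis using subgroup.subgroup_is_group[OF _ G.is_group] by simp
qed

lemma pointed_fund_gpd_eq: "pointed_fund_gpd P A a = disjoint_groups (pi0 A) (\<lambda>i. Loop P A (a i))"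
  by (simp add: pointed_fund_gpd_def disjoint_groups_def)

text \<open>A path between two base points is a loop, because it stays in one component; and every point is
  joined to the base point of its component by a path, which can be taken in \<open>P A\<close>.\<close>

lemma pointed_inclusion_equivalence:
  assumes A: "K A" and a: "pointing A a"
  shows "\<exists>J. category_equivalence (pointed_fund_gpd P A a) (fund_gpd P A) J"
proof -
  interpret A: rack A using A by (rule K_rack)
  interpret G: group "Pth A" by (rule A.group_Pth)
  have ac: "a i \<in> carrier A" and ai: "eta A (a i) = i" if "i \<in> pi0 A" for i
    using a that by (auto simp: pointing_def)
  let ?C = "pointed_fund_gpd P A a"
  have C: "category ?C"
    unfolding pointed_fund_gpd_eq by (rule category_disjoint_groups) (rule group_Loop[OF A ac])
  define J where "J = \<lparr>fobj = (\<lambda>i \<in> pi0 A. a i),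
    farr = (\<lambda>(i, l) \<in> (SIGMA i : pi0 A. carrier (Loop P A (a i))). (a i, l))\<rparr>"
  have "category_equivalence ?C (fund_gpd P A) J"
  proof (rule category_equivalenceI[OF C category_fund_gpd[OF A]])
    show "J \<in> functors ?C (fund_gpd P A)"
      using ac P_Pth[OF A] by (auto simp: functors_def J_def pointed_fund_gpd_eq P_one[OF A] P_mult[OF A]
          A.path_act_one A.path_act_mult)
    show "m = n" if "m \<in> Arr ?C" "n \<in> Arr ?C" "Src ?C m = Src ?C n" "Tgt ?C m = Tgt ?C n"
      "farr J m = farr J n" for m n
      using that by (auto simp: J_def pointed_fund_gpd_eq)
    show "\<exists>m \<in> Arr ?C. Src ?C m = i \<and> Tgt ?C m = j \<and> farr J m = h"
      if ij: "i \<in> Obj ?C" "j \<in> Obj ?C" and h: "h \<in> Arr (fund_gpd P A)" "Src (fund_gpd P A) h = fobj J i"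
        "Tgt (fund_gpd P A) h = fobj J j" for i j h
    proof -
      have I: "i \<in> pi0 A" "j \<in> pi0 A" using ij by (simp_all add: pointed_fund_gpd_eq)
      obtain g where g: "h = (a i, g)" "g \<in> carrier (P A)" "path_act A (a i) g = a j"
        using h I by (cases h) (auto simp: J_def)
      have "(a i, a j) \<in> pi0_rel A"
        using ac[OF I(1)] g(3) P_Pth[OF A g(2)] unfolding pi0_rel_iff[OF A.rack_axioms] by metis
      then have "i = j"
        using eta_eq_iff[OF ac ac] ai I by metis
      then show ?thesis using g I by (intro bexI[of _ "(i, g)"]) (auto simp: J_def pointed_fund_gpd_eq)
    qed
    show "\<exists>i \<in> Obj ?C. isomorphic_objects (fund_gpd P A) (fobj J i) y" if "y \<in> Obj (fund_gpd P A)" for y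
    proof -
      have y: "y \<in> carrier A" using that by simp
      have i: "eta A y \<in> pi0 A" using y by (rule eta_in)
      let ?x = "a (eta A y)"
      have "(?x, y) \<in> pi0_rel A" using eta_eq_iff[OF ac[OF i] y] ai[OF i] by simp
      then obtain k where k: "k \<in> carrier (Pth A)" "y = path_act A ?x k"
        by (auto simp: pi0_rel_iff[OF A.rack_axioms])
      let ?g = "retr A ?x k"
      have g: "?g \<in> carrier (P A)" "path_act A ?x ?g = y"
        using k ac[OF i] by (simp_all add: retr_in[OF A] path_act_retr[OF A])
      have "path_act A y (inv\<^bsub>Pth A\<^esub> ?g) = ?x"
        using A.path_act_inv[OF ac[OF i] P_Pth[OF A g(1)]] g by simp
      then have "invertible_arrow (fund_gpd P A) (?x, ?g)"
        using g ac[OF i] y P_inv[OF A g(1)] P_Pth[OF A g(1)] unfolding invertible_arrow_def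
        by (auto intro!: bexI[of _ "(y, inv\<^bsub>Pth A\<^esub> ?g)"])
      then have "isomorphic_objects (fund_gpd P A) ?x y"
        using g unfolding isomorphic_objects_def by (intro exI[of _ "(?x, ?g)"]) simp
      then show ?thesis using i by (intro bexI[of _ "eta A y"]) (auto simp: J_def pointed_fund_gpd_eq)
    qed
  qed
  then show ?thesis ..
qed

theorem pointed_equivalence:
  assumes A: "K A" and a: "pointing A a"
  shows "equivalent_categories (functor_cat (fund_gpd P A) (set_cat \<S>))
    (functor_cat (pointed_fund_gpd P A a) (set_cat \<S>))"
  using pointed_inclusion_equivalence[OF A a] precomp_equivalence[OF category_set_cat]
  unfolding equivalent_categories_def by blast

theorem pointed_isomorphism:
  assumes A: "K A" and a: "pointing A a"
  shows "isomorphic_categories (functor_cat (pointed_fund_gpd P A a) (set_cat \<S>))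
    (product_cat (pi0 A) (\<lambda>i. gset_cat \<S> (Loop P A (a i))))"
  unfolding pointed_fund_gpd_eq
  using group_Loop[OF A] a by (intro functors_disjoint_groups_iso) (auto simp: pointing_def)

end

section \<open>Classification of central extensions\<close>

theorem theorem3p6p0p1:
  assumes "infinite (UNIV :: 'u set)"
  shows
    "(\<exists>\<Phi> :: 'u rack \<Rightarrow> 'u CExt_functor.
        (\<forall>A. rack A \<longrightarrow>
          category_equivalence (CExt rack A) (functor_cat (pi1 A) (set_cat nonempty_sets)) (\<Phi> A)) \<and>
        natural_in_base rack Pth nonempty_sets \<Phi>) \<and>
     (\<forall>(A :: 'u rack) a. rack A \<longrightarrow> pointing A a \<longrightarrow>
        (\<forall>\<S> \<in> {UNIV :: 'u set set, nonempty_sets}.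
          equivalent_categories (functor_cat (pi1 A) (set_cat \<S>))
            (functor_cat (pi1_pointed A a) (set_cat \<S>)) \<and>
          isomorphic_categories (functor_cat (pi1_pointed A a) (set_cat \<S>))
            (product_cat (pi0 A) (\<lambda>i. gset_cat \<S> (Loop Pth A (a i)))))) \<and>
     (\<exists>\<Phi> :: 'u rack \<Rightarrow> 'u CExt_functor.
        (\<forall>A. quandle A \<longrightarrow>
          category_equivalence (CExt quandle A) (functor_cat (pi1q A) (set_cat nonempty_sets)) (\<Phi> A)) \<and>
        natural_in_base quandle Pth0 nonempty_sets \<Phi>) \<and>
     (\<forall>(A :: 'u rack) a. quandle A \<longrightarrow> pointing A a \<longrightarrow>
        (\<forall>\<S> \<in> {UNIV :: 'u set set, nonempty_sets}.
          equivalent_categories (functor_cat (pi1q A) (set_cat \<S>))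
            (functor_cat (pi1q_pointed A a) (set_cat \<S>)) \<and>
          isomorphic_categories (functor_cat (pi1q_pointed A a) (set_cat \<S>))
            (product_cat (pi0 A) (\<lambda>i. gset_cat \<S> (Loop Pth0 A (a i))))))"
proof -
  interpret R: path_theory "rack :: 'u rack \<Rightarrow> bool" Pth "\<lambda>A x g. g" by (rule path_theory_rack)
  interpret Q: path_theory "quandle :: 'u rack \<Rightarrow> bool" Pth0 quandle_retr by (rule path_theory_quandle)
  show ?thesis
    using R.Fib_equivalence[OF assms] R.Fib_natural[OF assms] R.pointed_equivalence R.pointed_isomorphism
      Q.Fib_equivalence[OF assms] Q.Fib_natural[OF assms] Q.pointed_equivalence Q.pointed_isomorphism
    by blast
qed

end
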